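(* Let $n\ge 2$, let $r_1,\dots,r_N>0$, and let $\mathbf p(t)=(\mathbf p_1(t),\dots,\mathbf p_N(t))$, $0\le t\le 1$, be a smooth motion of a configuration in $\mathbb E^n$ such that for each $t$ the points $\mathbf p_1(t),\dots,\mathbf p_N(t)$ are pairwise distinct. Then for each $t$, with $\mathbf p=\mathbf p(t)$, $$\frac{\partial}{\partial s}V_n(t,s)\Big|_{s=0}=\frac12\sum_{i=1}^N\frac{K_i(\mathbf p,\mathbf r)}{r_i}\qquad\text{and}\qquad \frac{\partial}{\partial s}V^n(t,s)\Big|_{s=0}=\frac12\sum_{i=1}^N\frac{K^i(\mathbf p,\mathbf r)}{r_i}.$$ Consequently, if the motion is expanding (i.e. each distance $|\mathbf p_i(t)-\mathbf p_j(t)|$ is non-decreasing in $t$), then the weighted boundary volumes $\frac12\sum_{i=1}^N K_i(\mathbf p(t),\mathbf r)/r_i$ and $\frac12\sum_{i=1}^N K^i(\mathbf p(t),\mathbf r)/r_i$ are monotone functions of $t$.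
   Context: $\mathbb E^n$ is Euclidean $n$-space, $B(\mathbf x,r)$ the closed ball of radius $r$ about $\mathbf x$, $\mathrm{Vol}_n$ the $n$-dimensional volume, $\mathrm{Bdy}[X]$ the boundary of $X$ in $\mathbb E^n$. Write $\mathbf r=(r_1,\dots,r_N)$ and, for $s\ge 0$, $r_i(s)=\sqrt{r_i^2+s}$ and $\mathbf r(s)=(r_1(s),\dots,r_N(s))$, so $\mathbf r(0)=\mathbf r$; derivatives at $s=0$ are one-sided. For a configuration $\mathbf p$ and radii $\mathbf r$ put $$X_n(\mathbf p,\mathbf r)=\bigcup_{i=1}^N B(\mathbf p_i,r_i),\qquad X^n(\mathbf p,\mathbf r)=\bigcap_{i=1}^N B(\mathbf p_i,r_i),$$ and $V_n(t,s)=\mathrm{Vol}_n[X_n(\mathbf p(t),\mathbf r(s))]$, $V^n(t,s)=\mathrm{Vol}_n[X^n(\mathbf p(t),\mathbf r(s))]$. The extended nearest point and farthest point Voronoi cells of $(\mathbf p,\mathbf r)$ are $$C_i=\{\mathbf p_0\in\mathbb E^n:\ |\mathbf p_0-\mathbf p_i|^2-r_i^2\le|\mathbf p_0-\mathbf p_j|^2-r_j^2\ \text{for all } j\ne i\},$$ $$C^i=\{\mathbf p_0\in\mathbb E^n:\ |\mathbf p_0-\mathbf p_i|^2-r_i^2\ge|\mathbf p_0-\mathbf p_j|^2-r_j^2\ \text{for all } j\ne i\}.$$ $K_i(\mathbf p,\mathbf r)$ and $K^i(\mathbf p,\mathbf r)$ denote the $(n-1)$-dimensional surface volumes of $\mathrm{Bdy}[X_n(\mathbf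 p,\mathbf r)]\cap C_i$ and $\mathrm{Bdy}[X^n(\mathbf p,\mathbf r)]\cap C^i$, respectively. *)

theory Defs
  imports "HOL-Analysis.Analysis"
begin

text \<open>
  The \<open>d\<close>-dimensional Hausdorff (outer) measure, normalised by the volume of the \<open>d\<close>-dimensional
  unit ball so that it agrees with the usual \<open>d\<close>-dimensional surface volume.  Covers are restricted
  to bounded sets because \<^const>\<open>diameter\<close> is not meaningful for unbounded ones; empty members are
  given weight 0 separately only because \<open>0 ^ 0 = 1\<close>.
\<close>

definition hausdorff_content ::
    "nat \<Rightarrow> real \<Rightarrow> 'a::metric_space set \<Rightarrow> ennreal" where
  "hausdorff_content d \<delta> A =
     (INF E \<in> {E :: nat \<Rightarrow> 'a set. A \<subseteq> (\<Union>k. E k) \<and> (\<forall>k. bounded (E k) \<and> diameter (E k) \<le> \<delta>)}.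
        \<Sum>k. if E k = {} then 0
             else ennreal (unit_ball_vol (real d) * (diameter (E k) / 2) ^ d))"

definition hausdorff_measure :: "nat \<Rightarrow> 'a::metric_space set \<Rightarrow> ennreal" where
  "hausdorff_measure d A = (SUP \<delta> \<in> {0<..}. hausdorff_content d \<delta> A)"

definition surface_volume :: "'a::euclidean_space set \<Rightarrow> real" where
  "surface_volume A = enn2real (hausdorff_measure (DIM('a) - 1) A)"

text \<open>
  A configuration of \<open>N\<close> points is a function on \<^typ>\<open>nat\<close> of which only the values at the indices
  \<open>1, \<dots>, N\<close> matter; likewise for the radii.
\<close>

definition ball_union :: "nat \<Rightarrow> (nat \<Rightarrow> 'a::euclidean_space) \<Rightarrow> (nat \<Rightarrow> real) \<Rightarrow> 'a set" where
  "ball_union N p r = (\<Union>i\<in>{1..N}. cball (p i) (r i))"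

definition ball_inter :: "nat \<Rightarrow> (nat \<Rightarrow> 'a::euclidean_space) \<Rightarrow> (nat \<Rightarrow> real) \<Rightarrow> 'a set" where
  "ball_inter N p r = (\<Inter>i\<in>{1..N}. cball (p i) (r i))"

definition nearest_cell ::
    "nat \<Rightarrow> (nat \<Rightarrow> 'a::euclidean_space) \<Rightarrow> (nat \<Rightarrow> real) \<Rightarrow> nat \<Rightarrow> 'a set" where
  "nearest_cell N p r i =
     {x. \<forall>j\<in>{1..N} - {i}. (dist x (p i))\<^sup>2 - (r i)\<^sup>2 \<le> (dist x (p j))\<^sup>2 - (r j)\<^sup>2}"

definition farthest_cell ::
    "nat \<Rightarrow> (nat \<Rightarrow> 'a::euclidean_space) \<Rightarrow> (nat \<Rightarrow> real) \<Rightarrow> nat \<Rightarrow> 'a set" where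
  "farthest_cell N p r i =
     {x. \<forall>j\<in>{1..N} - {i}. (dist x (p i))\<^sup>2 - (r i)\<^sup>2 \<ge> (dist x (p j))\<^sup>2 - (r j)\<^sup>2}"

definition union_face_volume ::
    "nat \<Rightarrow> (nat \<Rightarrow> 'a::euclidean_space) \<Rightarrow> (nat \<Rightarrow> real) \<Rightarrow> nat \<Rightarrow> real" where
  "union_face_volume N p r i =
     surface_volume (frontier (ball_union N p r) \<inter> nearest_cell N p r i)"

definition inter_face_volume ::
    "nat \<Rightarrow> (nat \<Rightarrow> 'a::euclidean_space) \<Rightarrow> (nat \<Rightarrow> real) \<Rightarrow> nat \<Rightarrow> real" where
  "inter_face_volume N p r i =
     surface_volume (frontier (ball_inter N p r) \<inter> farthest_cell N p r i)"

definition shifted_radii :: "(nat \<Rightarrow> real) \<Rightarrow> real \<Rightarrow> nat \<Rightarrow> real" where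
  "shifted_radii r s i = sqrt ((r i)\<^sup>2 + s)"

text \<open>
  Infinite differentiability relative to \<open>S\<close>; at an endpoint of an interval the derivatives are
  one-sided.  \<open>D k\<close> is the \<open>k\<close>-th derivative.
\<close>

definition smooth_on :: "real set \<Rightarrow> (real \<Rightarrow> 'a::real_normed_vector) \<Rightarrow> bool" where
  "smooth_on S f \<longleftrightarrow>
     (\<exists>D :: nat \<Rightarrow> real \<Rightarrow> 'a. (\<forall>t\<in>S. D 0 t = f t) \<and>
        (\<forall>k. \<forall>t\<in>S. (D k has_vector_derivative D (Suc k) t) (at t within S)))"

definition smooth_motion :: "nat \<Rightarrow> (real \<Rightarrow> nat \<Rightarrow> 'a::euclidean_space) \<Rightarrow> bool" where
  "smooth_motion N p \<longleftrightarrow> (\<forall>i\<in>{1..N}. smooth_on {0..1} (\<lambda>t. p t i))"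

definition expanding_motion :: "nat \<Rightarrow> (real \<Rightarrow> nat \<Rightarrow> 'a::euclidean_space) \<Rightarrow> bool" where
  "expanding_motion N p \<longleftrightarrow>
     (\<forall>i\<in>{1..N}. \<forall>j\<in>{1..N}. mono_on {0..1} (\<lambda>t. dist (p t i) (p t j)))"

end

(* The extended Voronoi cells do not change when r is replaced by r(s), so each of the two volumes
   is a sum of volumes of polyhedral cells cut out by balls of radius r_i(s), and its s-derivative
   is read off from thin spherical shells.  That such shells see the (n-1)-dimensional Hausdorff
   measure of the faces rests on two facts in dimension n - 1, transported to the sphere by central
   projection onto tangent hyperplanes: the isodiametric inequality (by Steiner symmetrization) for
   the lower bound, and Vitali's covering theorem for the upper bound.

   For the monotonicity, indicators of balls are approximated by polynomials Q in
   exp (- |x - p_i|^2).  The integral of prod_i Q (e^s z_i) is then a finite combination of Gaussian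
   integrals, each an explicit function of the mutual distances |p_i - p_j|.  Its mixed derivative
   in s and t is minus the sum over pairs i < j of d/dt |p_i - p_j|^2 times the integral of
   z_i Q'(z_i) z_j Q'(z_j) prod_{k != i, j} Q (z_k), which is nonnegative if Q is nonnegative and
   monotone.  Hence for t1 < t2 the difference V(t2, s) - V(t1, s) is monotone in s, and comparing
   right derivatives at s = 0 gives the claim. *)

theory Submission
  imports Defs "HOL-Probability.Distributions" "HOL-Computational_Algebra.Polynomial"
begin

section \<open>Hausdorff content and measure\<close>

text \<open>Surface measure on the unit sphere is represented by n times the volume of the solid
  cone over a set: it is additive on disjoint pieces, and a shell over the set between radii r and r
  + h has exactly (r + h)^n - r^n times the volume of the cone. Central projection distorts
  distances, but on small caps by factors tending to 1, so the comparison with Hausdorff measure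
  loses a factor that is removed at the end.

  The parameter s enters every level exp (r_i^2 + s - |x - p_i|^2) through the same factor e^s. A
  monomial with exponents g_i gains the factor sum g_i under d/ds, while its Gaussian integral has
  the exponent - (sum g_i g_j |p_i - p_j|^2) / (2 sum g_i). The denominator cancels in the mixed
  derivative, and the remaining g_i g_j is what z_i d/dz_i and z_j d/dz_j produce. The constant
  monomial is not integrable and is subtracted; for the union this leaves minus the volume, so the
  two weighted boundary volumes move in opposite directions. Only finite sums are differentiated in
  t; the limit is taken in inequalities.\<close>

definition piece_weight :: "nat \<Rightarrow> 'a::metric_space set \<Rightarrow> ennreal" where
  "piece_weight d E = (if E = {} then 0 else ennreal (unit_ball_vol (real d) * (diameter E / 2) ^ d))"

lemma piece_weight_empty [simp]: "piece_weight d {} = 0"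
  by (simp add: piece_weight_def)

lemma diameter_le_dist:
  fixes S :: "'a::metric_space set"
  assumes "0 \<le> D" and "\<And>x y. x \<in> S \<Longrightarrow> y \<in> S \<Longrightarrow> dist x y \<le> D"
  shows "bounded S" "diameter S \<le> D"
proof -
  show "bounded S" by (meson assms(2) bounded_two_points)
  show "diameter S \<le> D"
  proof (cases "S = {}")
    case False
    then show ?thesis unfolding diameter_def by (auto intro!: cSUP_least simp: assms(2))
  qed (simp add: assms)
qed

lemma piece_weight_le:
  fixes E :: "'a::metric_space set"
  assumes "0 \<le> D" and "\<And>x y. x \<in> E \<Longrightarrow> y \<in> E \<Longrightarrow> dist x y \<le> D"
  shows "piece_weight d E \<le> ennreal (unit_ball_vol (real d) * (D / 2) ^ d)"
proof (cases "E = {}")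
  case False
  have "diameter E \<le> D" "bounded E" using diameter_le_dist[OF assms] by auto
  then show ?thesis using False diameter_ge_0[of E]
    by (auto simp: piece_weight_def intro!: ennreal_leI mult_left_mono power_mono divide_right_mono)
qed simp

text \<open>The definition of content asks for a sequence of sets, but the covers that occur are
  indexed by pairs. A countable family is enumerated and padded with empty sets, which have weight
  0; \<open>0 \<le> \<delta>\<close> admits the padding.\<close>

lemma hausdorff_content_le_nn_integral:
  fixes E :: "'i \<Rightarrow> 'a::metric_space set"
  assumes I: "countable I" and cover: "A \<subseteq> (\<Union>i\<in>I. E i)"
    and E: "\<And>i. i \<in> I \<Longrightarrow> bounded (E i)" "\<And>i. i \<in> I \<Longrightarrow> diameter (E i) \<le> \<delta>" and "0 \<le> \<delta>"
  shows "hausdorff_content d \<delta> A \<le> (\<integral>\<^sup>+i. piece_weight d (E i) \<partial>count_space I)"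
proof -
  let ?J = "to_nat_on I ` I"
  define F where "F k = (if k \<in> ?J then E (from_nat_into I k) else {})" for k
  have F_eq: "F (to_nat_on I i) = E i" if "i \<in> I" for i using that I by (simp add: F_def)
  have "A \<subseteq> (\<Union>k. F k)" using cover F_eq by blast
  moreover have "bounded (F k) \<and> diameter (F k) \<le> \<delta>" for k
    using E I \<open>0 \<le> \<delta>\<close> by (cases "k \<in> ?J") (auto simp: F_def)
  ultimately have "hausdorff_content d \<delta> A \<le> (\<Sum>k. piece_weight d (F k))"
    unfolding hausdorff_content_def piece_weight_def by (intro INF_lower) auto
  also have "\<dots> = (\<integral>\<^sup>+k. piece_weight d (F k) \<partial>count_space UNIV)"
    by (simp add: nn_integral_count_space_nat)
  also have "\<dots> = (\<integral>\<^sup>+k. piece_weight d (F k) * indicator ?J k \<partial>count_space UNIV)"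
    by (intro nn_integral_cong) (auto simp: F_def indicator_def)
  also have "\<dots> = (\<integral>\<^sup>+k. piece_weight d (F k) \<partial>count_space ?J)"
    by (simp add: nn_integral_count_space_indicator)
  also have "\<dots> = (\<integral>\<^sup>+i. piece_weight d (F (to_nat_on I i)) \<partial>count_space I)"
    by (subst nn_integral_bij_count_space[symmetric, where g = "to_nat_on I" and A = I])
      (auto simp: I bij_betw_def)
  also have "\<dots> = (\<integral>\<^sup>+i. piece_weight d (E i) \<partial>count_space I)"
    by (intro nn_integral_cong) (simp add: F_eq)
  finally show ?thesis .
qed

lemma hausdorff_content_lessE:
  assumes "hausdorff_content d \<delta> A < c"
  obtains E :: "nat \<Rightarrow> 'a::metric_space set" where "A \<subseteq> (\<Union>k. E k)"
    "\<And>k. bounded (E k)" "\<And>k. diameter (E k) \<le> \<delta>" "(\<Sum>k. piece_weight d (E k)) < c"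
  using assms unfolding hausdorff_content_def piece_weight_def INF_less_iff by auto

lemma le_hausdorff_contentI:
  fixes A :: "'a::metric_space set"
  assumes "\<And>E :: nat \<Rightarrow> 'a set. A \<subseteq> (\<Union>k. E k) \<Longrightarrow> (\<And>k. bounded (E k)) \<Longrightarrow>
      (\<And>k. diameter (E k) \<le> \<delta>) \<Longrightarrow> c \<le> (\<Sum>k. piece_weight d (E k))"
  shows "c \<le> hausdorff_content d \<delta> A"
proof (rule ccontr)
  assume "\<not> ?thesis"
  then have "hausdorff_content d \<delta> A < c" by simp
  then show False by (rule hausdorff_content_lessE) (use assms in \<open>simp add: leD\<close>)
qed

lemma hausdorff_content_mono:
  "A \<subseteq> B \<Longrightarrow> hausdorff_content d \<delta> A \<le> hausdorff_content d \<delta> B"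
  unfolding hausdorff_content_def by (intro INF_superset_mono) auto

text \<open>Two nearly optimal covers, each within e / 2 of the infimum, are merged into one family
  indexed by \<open>bool \<times> nat\<close>.\<close>

lemma hausdorff_content_Un:
  fixes A B :: "'a::metric_space set"
  assumes "0 \<le> \<delta>"
  shows "hausdorff_content d \<delta> (A \<union> B) \<le> hausdorff_content d \<delta> A + hausdorff_content d \<delta> B"
proof (rule ennreal_le_epsilon)
  fix e :: real
  assume fin: "hausdorff_content d \<delta> A + hausdorff_content d \<delta> B < top" and e: "0 < e"
  \<comment> \<open>The strict inequality fails at \<open>top\<close>; the finiteness supplied by
    \<open>ennreal_le_epsilon\<close> excludes that case.\<close>
  have half: "c < c + ennreal (e / 2)" if "c < top" for c :: ennreal
    using that e by (cases c) (auto simp: ennreal_plus[symmetric] ennreal_less_iff simp del: ennreal_plus)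
  have "hausdorff_content d \<delta> A < hausdorff_content d \<delta> A + ennreal (e / 2)"
    "hausdorff_content d \<delta> B < hausdorff_content d \<delta> B + ennreal (e / 2)"
    using fin e by (auto intro!: half)
  then obtain E F where E: "A \<subseteq> (\<Union>k. E k)" "\<And>k. bounded (E k)" "\<And>k. diameter (E k) \<le> \<delta>"
      "(\<Sum>k. piece_weight d (E k)) < hausdorff_content d \<delta> A + ennreal (e / 2)"
    and F: "B \<subseteq> (\<Union>k. F k)" "\<And>k. bounded (F k)" "\<And>k. diameter (F k) \<le> \<delta>"
      "(\<Sum>k. piece_weight d (F k)) < hausdorff_content d \<delta> B + ennreal (e / 2)"
    by (elim hausdorff_content_lessE) auto
  define G where "G i = (if fst i then E (snd i) else F (snd i))" for i :: "bool \<times> nat"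
  have "hausdorff_content d \<delta> (A \<union> B) \<le> (\<integral>\<^sup>+i. piece_weight d (G i) \<partial>count_space UNIV)"
  proof (rule hausdorff_content_le_nn_integral)
    have "E k \<subseteq> (\<Union>i. G i)" "F k \<subseteq> (\<Union>i. G i)" for k
      using UN_upper[of "(True, k)" UNIV G] UN_upper[of "(False, k)" UNIV G] by (simp_all add: G_def)
    then show "A \<union> B \<subseteq> (\<Union>i. G i)"
      by (intro Un_least order_trans[OF E(1) UN_least] order_trans[OF F(1) UN_least])
  qed (auto simp: G_def E F assms)
  also have "\<dots> = (\<integral>\<^sup>+b. \<integral>\<^sup>+k. piece_weight d (G (b, k)) \<partial>count_space UNIV \<partial>count_space UNIV)"
    by (rule nn_integral_fst_count_space[symmetric])
  also have "\<dots> = (\<Sum>k. piece_weight d (E k)) + (\<Sum>k. piece_weight d (F k))"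
    by (simp add: G_def nn_integral_count_space_finite UNIV_bool nn_integral_count_space_nat add.commute)
  also have "\<dots> \<le> (hausdorff_content d \<delta> A + ennreal (e / 2)) + (hausdorff_content d \<delta> B + ennreal (e / 2))"
    by (intro add_mono less_imp_le E F)
  also have "\<dots> = hausdorff_content d \<delta> A + hausdorff_content d \<delta> B + (ennreal (e / 2) + ennreal (e / 2))"
    by (simp add: algebra_simps)
  also have "ennreal (e / 2) + ennreal (e / 2) = ennreal e"
    using e by (simp add: ennreal_plus[symmetric] del: ennreal_plus)
  finally show "hausdorff_content d \<delta> (A \<union> B) \<le> hausdorff_content d \<delta> A + hausdorff_content d \<delta> B + ennreal e" .
qed

text \<open>The images of the traces \<open>E k \<inter> A\<close> of a cover again form a cover,
  with diameters multiplied by at most \<open>L\<close>. Taking traces is needed because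
  \<open>f\<close> is Lipschitz only on \<open>A\<close>.\<close>

lemma hausdorff_content_lipschitz_image:
  fixes f :: "'a::metric_space \<Rightarrow> 'b::metric_space"
  assumes L: "0 < L" and \<delta>: "0 \<le> \<delta>"
    and lip: "\<And>x y. x \<in> A \<Longrightarrow> y \<in> A \<Longrightarrow> dist (f x) (f y) \<le> L * dist x y"
  shows "hausdorff_content d (L * \<delta>) (f ` A) \<le> ennreal (L ^ d) * hausdorff_content d \<delta> A"
proof -
  \<comment> \<open>The factor is moved to the left so that the claim becomes a lower bound for the
    content of \<open>A\<close>, which can be checked cover by cover.\<close>
  have "inverse (ennreal (L ^ d)) * hausdorff_content d (L * \<delta>) (f ` A) \<le> hausdorff_content d \<delta> A"
  proof (rule le_hausdorff_contentI)
    fix E :: "nat \<Rightarrow> 'a set"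
    assume E: "A \<subseteq> (\<Union>k. E k)" "\<And>k. bounded (E k)" "\<And>k. diameter (E k) \<le> \<delta>"
    have le: "dist (f x) (f y) \<le> L * diameter (E k)" if "x \<in> E k \<inter> A" "y \<in> E k \<inter> A" for x y k
    proof -
      have "dist (f x) (f y) \<le> L * dist x y" using that lip by auto
      also have "\<dots> \<le> L * diameter (E k)"
        using that E(2) L by (auto intro!: mult_left_mono diameter_bounded_bound)
      finally show ?thesis .
    qed
    have ge: "0 \<le> L * diameter (E k)" for k using L E(2) by (simp add: diameter_ge_0)
    have *: "bounded (f ` (E k \<inter> A))" "diameter (f ` (E k \<inter> A)) \<le> L * diameter (E k)" for k
      using diameter_le_dist[of "L * diameter (E k)" "f ` (E k \<inter> A)"] le ge by auto
    have "hausdorff_content d (L * \<delta>) (f ` A) \<le> (\<integral>\<^sup>+k. piece_weight d (f ` (E k \<inter> A)) \<partial>count_space UNIV)"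
    proof (rule hausdorff_content_le_nn_integral)
      show "f ` A \<subseteq> (\<Union>k. f ` (E k \<inter> A))" using E(1) by blast
      show "diameter (f ` (E k \<inter> A)) \<le> L * \<delta>" for k
        using *(2)[of k] E(3)[of k] L by (smt (verit) mult_left_mono)
    qed (use * L \<delta> in auto)
    also have "\<dots> \<le> (\<integral>\<^sup>+k. ennreal (L ^ d) * piece_weight d (E k) \<partial>count_space UNIV)"
    proof (rule nn_integral_mono)
      fix k
      have "piece_weight d (f ` (E k \<inter> A)) \<le> ennreal (L ^ d) * piece_weight d (E k)"
      proof (cases "E k = {}")
        case False
        have "piece_weight d (f ` (E k \<inter> A)) \<le> ennreal (unit_ball_vol (real d) * (L * diameter (E k) / 2) ^ d)"
          using le ge by (intro piece_weight_le) auto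
        also have "\<dots> = ennreal (L ^ d) * piece_weight d (E k)" using False L E(2)
          by (simp add: piece_weight_def ennreal_mult[symmetric] diameter_ge_0 power_mult_distrib power_divide mult_ac)
        finally show ?thesis .
      qed simp
      then show "piece_weight d (f ` (E k \<inter> A)) \<le> ennreal (L ^ d) * piece_weight d (E k)" .
    qed
    also have "\<dots> = ennreal (L ^ d) * (\<Sum>k. piece_weight d (E k))"
      by (simp add: nn_integral_cmult nn_integral_count_space_nat)
    finally have "inverse (ennreal (L ^ d)) * hausdorff_content d (L * \<delta>) (f ` A)
        \<le> inverse (ennreal (L ^ d)) * (ennreal (L ^ d) * (\<Sum>k. piece_weight d (E k)))"
      by (rule mult_left_mono) simp
    also have "\<dots> = (\<Sum>k. piece_weight d (E k))"
      using L by (simp add: mult.assoc[symmetric] inverse_ennreal ennreal_mult[symmetric])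
    finally show "inverse (ennreal (L ^ d)) * hausdorff_content d (L * \<delta>) (f ` A) \<le> (\<Sum>k. piece_weight d (E k))" .
  qed
  then have "ennreal (L ^ d) * (inverse (ennreal (L ^ d)) * hausdorff_content d (L * \<delta>) (f ` A))
      \<le> ennreal (L ^ d) * hausdorff_content d \<delta> A"
    by (rule mult_left_mono) simp
  then show ?thesis
    using L by (simp add: mult.assoc[symmetric] inverse_ennreal ennreal_mult[symmetric])
qed

lemma hausdorff_measure_mono: "A \<subseteq> B \<Longrightarrow> hausdorff_measure d A \<le> hausdorff_measure d B"
  unfolding hausdorff_measure_def by (intro SUP_mono bexI) (auto intro: hausdorff_content_mono)

lemma hausdorff_content_le_measure: "0 < \<delta> \<Longrightarrow> hausdorff_content d \<delta> A \<le> hausdorff_measure d A"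
  unfolding hausdorff_measure_def by (intro SUP_upper) auto

lemma hausdorff_measure_Un:
  fixes A B :: "'a::metric_space set"
  shows "hausdorff_measure d (A \<union> B) \<le> hausdorff_measure d A + hausdorff_measure d B"
  unfolding hausdorff_measure_def[of d "A \<union> B"]
  by (intro SUP_least order_trans[OF hausdorff_content_Un] add_mono hausdorff_content_le_measure) auto

lemma hausdorff_measure_empty [simp]: "hausdorff_measure d ({} :: 'a::metric_space set) = 0"
proof -
  have "hausdorff_content d \<delta> ({} :: 'a set) \<le> 0" if "0 < \<delta>" for \<delta>
    using hausdorff_content_le_nn_integral[of "{}" "{} :: 'a set" "\<lambda>_::nat. {}" \<delta> d] that
    by (simp add: nn_integral_empty)
  then have "hausdorff_measure d ({} :: 'a set) \<le> 0"
    unfolding hausdorff_measure_def by (intro SUP_least) auto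
  then show ?thesis by simp
qed

lemma hausdorff_measure_UN:
  fixes A :: "'i \<Rightarrow> 'a::metric_space set"
  assumes "finite I"
  shows "hausdorff_measure d (\<Union>i\<in>I. A i) \<le> (\<Sum>i\<in>I. hausdorff_measure d (A i))"
  using assms
proof induction
  case (insert i I)
  then show ?case by (auto intro: order_trans[OF hausdorff_measure_Un] add_left_mono)
qed simp

lemma hausdorff_measure_lipschitz_image:
  fixes f :: "'a::metric_space \<Rightarrow> 'b::metric_space"
  assumes L: "0 < L" and lip: "\<And>x y. x \<in> A \<Longrightarrow> y \<in> A \<Longrightarrow> dist (f x) (f y) \<le> L * dist x y"
  shows "hausdorff_measure d (f ` A) \<le> ennreal (L ^ d) * hausdorff_measure d A"
  unfolding hausdorff_measure_def[of d "f ` A"]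
proof (rule SUP_least)
  fix \<delta> :: real assume "\<delta> \<in> {0<..}"
  then have "hausdorff_content d (L * (\<delta> / L)) (f ` A) \<le> ennreal (L ^ d) * hausdorff_content d (\<delta> / L) A"
    using L lip by (intro hausdorff_content_lipschitz_image) auto
  also have "\<dots> \<le> ennreal (L ^ d) * hausdorff_measure d A"
    using L \<open>\<delta> \<in> _\<close> by (intro mult_left_mono hausdorff_content_le_measure) auto
  finally show "hausdorff_content d \<delta> (f ` A) \<le> ennreal (L ^ d) * hausdorff_measure d A"
    using L by simp
qed

section \<open>The isodiametric inequality\<close>

text \<open>One-dimensional core of Steiner symmetrization. A length is at most
  \<open>Sup - Inf\<close>, and pairing \<open>Sup S\<close> with \<open>Inf T\<close> and
  \<open>Sup T\<close> with \<open>Inf S\<close> bounds the sum of both lengths by cross distances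
  alone.\<close>

lemma measure_sum_le_cross_distance:
  fixes S T :: "real set"
  assumes "S \<noteq> {}" "T \<noteq> {}" and q: "\<And>y z. y \<in> S \<Longrightarrow> z \<in> T \<Longrightarrow> \<bar>y - z\<bar> \<le> q"
  shows "enn2real (emeasure lborel S) + enn2real (emeasure lborel T) \<le> 2 * q"
proof -
  obtain s t where s: "s \<in> S" and t: "t \<in> T" using assms by blast
  have near: "t - q \<le> y \<and> y \<le> t + q" if "y \<in> S" for y using q[OF that t] by (auto simp: abs_le_iff)
  have near': "s - q \<le> y \<and> y \<le> s + q" if "y \<in> T" for y using q[OF s that] by (auto simp: abs_le_iff)
  have bdd: "bdd_above S" "bdd_below S" "bdd_above T" "bdd_below T"
    by (rule bdd_aboveI[of _ "t + q"] bdd_belowI[of _ "t - q"]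
        bdd_aboveI[of _ "s + q"] bdd_belowI[of _ "s - q"]; simp add: near near')+
  have len: "enn2real (emeasure lborel X) \<le> Sup X - Inf X"
    if "bdd_above X" "bdd_below X" "x \<in> X" for X :: "real set" and x
  proof -
    have le: "Inf X \<le> Sup X" using that by (meson cInf_lower cSup_upper order_trans)
    have "X \<subseteq> {Inf X..Sup X}" using that by (auto intro: cInf_lower cSup_upper)
    then have "emeasure lborel X \<le> emeasure lborel {Inf X..Sup X}" by (intro emeasure_mono) auto
    also have "\<dots> = ennreal (Sup X - Inf X)" using le by simp
    finally show ?thesis using le by (intro enn2real_leI) auto
  qed
  have "Sup S \<le> q + Inf T"
  proof (intro cSup_least)
    fix y assume "y \<in> S"
    then have "y - q \<le> Inf T" using q by (intro cInf_greatest assms) (force simp: abs_le_iff)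
    then show "y \<le> q + Inf T" by simp
  qed (rule assms)
  moreover have "Sup T \<le> q + Inf S"
  proof (intro cSup_least)
    fix y assume "y \<in> T"
    then have "y - q \<le> Inf S" using q by (intro cInf_greatest assms) (force simp: abs_le_iff)
    then show "y \<le> q + Inf S" by simp
  qed (rule assms)
  ultimately show ?thesis using len[OF bdd(1,2) s] len[OF bdd(3,4) t] by linarith
qed

text \<open>Each fibre of \<open>A\<close> in direction \<open>i\<close> is replaced by the centred
  interval of the same length. Fubini preserves the measure,
  \<open>measure_sum_le_cross_distance\<close> preserves the diameter bound, and reflections in the
  coordinates of \<open>J\<close> survive because they permute the fibres.\<close>

lemma steiner_symmetrization:
  fixes A :: "('i \<Rightarrow> real) set"
  assumes K: "finite K" "i \<notin> K"
    and A: "A \<in> sets (Pi\<^sub>M (insert i K) (\<lambda>_. lborel))"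
    and D: "0 \<le> D" "\<And>x y. x \<in> A \<Longrightarrow> y \<in> A \<Longrightarrow> (\<Sum>j\<in>insert i K. (x j - y j)\<^sup>2) \<le> D\<^sup>2"
    and J: "J \<subseteq> K" "\<And>j x. j \<in> J \<Longrightarrow> x \<in> A \<Longrightarrow> x(j := - x j) \<in> A"
  obtains B where "B \<in> sets (Pi\<^sub>M (insert i K) (\<lambda>_. lborel))"
    "emeasure (Pi\<^sub>M (insert i K) (\<lambda>_. lborel)) B = emeasure (Pi\<^sub>M (insert i K) (\<lambda>_. lborel)) A"
    "\<And>x y. x \<in> B \<Longrightarrow> y \<in> B \<Longrightarrow> (\<Sum>j\<in>insert i K. (x j - y j)\<^sup>2) \<le> D\<^sup>2"
    "\<And>j x. j \<in> insert i J \<Longrightarrow> x \<in> B \<Longrightarrow> x(j := - x j) \<in> B"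
proof -
  interpret product_sigma_finite "\<lambda>_::'i. lborel :: real measure" ..
  let ?MK = "Pi\<^sub>M K (\<lambda>_. lborel :: real measure)" and ?MI = "Pi\<^sub>M (insert i K) (\<lambda>_. lborel :: real measure)"
  define S where "S x = {y. x(i := y) \<in> A}" for x
  define m where "m x = enn2real (emeasure lborel (S x))" for x
  have upd: "(\<lambda>y. x(i := y)) \<in> lborel \<rightarrow>\<^sub>M ?MI" if "x \<in> space ?MK" for x
    using measurable_component_update[OF that K(2)] by simp
  have S_sets: "S x \<in> sets borel" if "x \<in> space ?MK" for x
    using measurable_sets[OF upd[OF that] A] by (simp add: S_def vimage_def)
  have S_diam: "\<bar>y - z\<bar> \<le> D" if "y \<in> S x" "z \<in> S x" for x y z
  proof -
    have "(y - z)\<^sup>2 = (\<Sum>j\<in>insert i K. ((x(i := y)) j - (x(i := z)) j)\<^sup>2)"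
      using K by (auto simp: intro!: sum.neutral)
    also have "\<dots> \<le> D\<^sup>2" using that by (intro D(2)[of "x(i := y)" "x(i := z)"]) (simp_all add: S_def)
    finally show ?thesis using D(1) by (metis abs_le_square_iff abs_of_nonneg)
  qed
  have S_fin: "emeasure lborel (S x) < \<infinity>" for x
  proof (cases "S x = {}")
    case False
    then obtain y where "y \<in> S x" by blast
    then have "S x \<subseteq> {y - D..y + D}" using S_diam[of y x] by (force simp: abs_le_iff)
    then have "emeasure lborel (S x) \<le> emeasure lborel {y - D..y + D}" by (intro emeasure_mono) auto
    also have "\<dots> < \<infinity>" using D(1) by simp
    finally show ?thesis .
  qed simp
  have m_nonneg: "0 \<le> m x" for x by (simp add: m_def)
  have add_dim: "(\<lambda>(f, y). f(i := y)) \<in> ?MK \<Otimes>\<^sub>M lborel \<rightarrow>\<^sub>M ?MI" by (rule measurable_add_dim)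
  have S_eq: "emeasure lborel (S x) = (\<integral>\<^sup>+y. indicator A (x(i := y)) \<partial>lborel)" if "x \<in> space ?MK" for x
  proof -
    have "(\<integral>\<^sup>+y. indicator A (x(i := y)) \<partial>lborel) = (\<integral>\<^sup>+y. indicator (S x) y \<partial>lborel)"
      by (intro nn_integral_cong) (simp add: S_def indicator_def)
    then show ?thesis using S_sets[OF that] by simp
  qed
  have "(\<lambda>x. \<integral>\<^sup>+y. indicator A (x(i := y)) \<partial>lborel) \<in> borel_measurable ?MK"
  proof (rule lborel.borel_measurable_nn_integral)
    have "indicator A \<circ> (\<lambda>(f, y). f(i := y)) \<in> borel_measurable (?MK \<Otimes>\<^sub>M lborel)"
      by (rule measurable_comp[OF add_dim borel_measurable_indicator[OF A]])
    then show "(\<lambda>(x, y). indicator A (x(i := y)) :: ennreal) \<in> borel_measurable (?MK \<Otimes>\<^sub>M lborel)"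
      by (simp add: comp_def case_prod_unfold)
  qed
  then have "(\<lambda>x. emeasure lborel (S x)) \<in> borel_measurable ?MK" by (subst measurable_cong[OF S_eq])
  then have m_meas: "m \<in> borel_measurable ?MK" unfolding m_def by simp
  have restr: "(\<lambda>f. restrict f K) \<in> ?MI \<rightarrow>\<^sub>M ?MK" by (rule measurable_restrict_subset) auto
  \<comment> \<open>Fibres of length 0 are dropped. Otherwise the centre would be added over base
    points whose fibre in \<open>A\<close> is empty, and the diameter bound would be lost.\<close>
  define B where "B = {f \<in> space ?MI. 0 < m (restrict f K) \<and> \<bar>f i\<bar> \<le> m (restrict f K) / 2}"
  have B_sets: "B \<in> sets ?MI"
  proof -
    have meas: "{f \<in> space M. 0 < g f \<and> \<bar>h f\<bar> \<le> g f / 2} \<in> sets M"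
      if "g \<in> borel_measurable M" "h \<in> borel_measurable M"
      for M :: "('i \<Rightarrow> real) measure" and g h :: "_ \<Rightarrow> real"
      by (intro sets.sets_Collect_conj borel_measurable_less borel_measurable_le borel_measurable_abs
          borel_measurable_divide that borel_measurable_const)
    have "(\<lambda>f. f i) \<in> ?MI \<rightarrow>\<^sub>M lborel" by (rule measurable_component_singleton) simp
    then show ?thesis unfolding B_def by (intro meas measurable_compose[OF restr m_meas]) simp
  qed
  have fib: "(\<integral>\<^sup>+y. indicator B (x(i := y)) \<partial>lborel) = (\<integral>\<^sup>+y. indicator A (x(i := y)) \<partial>lborel)"
    if x: "x \<in> space ?MK" for x
  proof -
    have "restrict (x(i := y)) K = x" for y
      using x K by (auto simp: space_PiM PiE_def extensional_def)
    moreover have "x(i := y) \<in> space ?MI" for y using measurable_space[OF upd[OF x]] by simp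
    ultimately have "(\<integral>\<^sup>+y. indicator B (x(i := y)) \<partial>lborel) = (\<integral>\<^sup>+y. indicator (if 0 < m x then {- (m x / 2)..m x / 2} else {}) y \<partial>lborel)"
      by (intro nn_integral_cong) (auto simp: B_def indicator_def)
    also have "\<dots> = ennreal (m x)" using m_nonneg[of x] by (cases "m x = 0") auto
    also have "\<dots> = emeasure lborel (S x)" using S_fin[of x] by (simp add: m_def)
    also note S_eq[OF x]
    finally show ?thesis .
  qed
  have "emeasure ?MI B = (\<integral>\<^sup>+f. indicator B f \<partial>?MI)" using B_sets by simp
  also have "\<dots> = (\<integral>\<^sup>+x. (\<integral>\<^sup>+y. indicator B (x(i := y)) \<partial>lborel) \<partial>?MK)"
    by (rule product_nn_integral_insert[OF K borel_measurable_indicator[OF B_sets]])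
  also have "\<dots> = (\<integral>\<^sup>+x. (\<integral>\<^sup>+y. indicator A (x(i := y)) \<partial>lborel) \<partial>?MK)"
    by (intro nn_integral_cong fib)
  also have "\<dots> = (\<integral>\<^sup>+f. indicator A f \<partial>?MI)"
    by (rule product_nn_integral_insert[OF K borel_measurable_indicator[OF A], symmetric])
  also have "\<dots> = emeasure ?MI A" using A by simp
  finally have B_emeasure: "emeasure ?MI B = emeasure ?MI A" .
  have B_diam: "(\<Sum>j\<in>insert i K. (x j - y j)\<^sup>2) \<le> D\<^sup>2" if x: "x \<in> B" and y: "y \<in> B" for x y
  proof -
    let ?x = "restrict x K" and ?y = "restrict y K"
    define Q where "Q = (\<Sum>j\<in>K. (x j - y j)\<^sup>2)"
    have ne: "S ?x \<noteq> {}" "S ?y \<noteq> {}" using x y by (auto simp: B_def m_def)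
    have dist: "(u - v)\<^sup>2 + Q \<le> D\<^sup>2" if "u \<in> S ?x" "v \<in> S ?y" for u v
    proof -
      have "(u - v)\<^sup>2 + Q = (\<Sum>j\<in>insert i K. ((?x(i := u)) j - (?y(i := v)) j)\<^sup>2)"
        using K by (auto simp: Q_def intro!: sum.cong)
      also have "\<dots> \<le> D\<^sup>2"
        using that by (intro D(2)[of "?x(i := u)" "?y(i := v)"]) (simp_all add: S_def)
      finally show ?thesis .
    qed
    obtain u v where "u \<in> S ?x" "v \<in> S ?y" using ne by blast
    then have Q: "Q \<le> D\<^sup>2" using dist[of u v] by (smt (verit) zero_le_power2)
    \<comment> \<open>In \<open>B\<close> the coordinates \<open>x i\<close> and \<open>y i\<close>
      differ by at most half the sum of the two fibre lengths; in \<open>A\<close> the fibres over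
      the same base points have cross distance at most sqrt (D^2 - Q).\<close>
    have "m ?x + m ?y \<le> 2 * sqrt (D\<^sup>2 - Q)" unfolding m_def
    proof (intro measure_sum_le_cross_distance ne)
      fix u v assume "u \<in> S ?x" "v \<in> S ?y"
      then have "(u - v)\<^sup>2 \<le> D\<^sup>2 - Q" using dist[of u v] by simp
      then show "\<bar>u - v\<bar> \<le> sqrt (D\<^sup>2 - Q)" by (metis real_sqrt_abs real_sqrt_le_iff)
    qed
    then have "\<bar>x i - y i\<bar> \<le> sqrt (D\<^sup>2 - Q)" using x y by (auto simp: B_def)
    then have "(x i - y i)\<^sup>2 \<le> D\<^sup>2 - Q"
      by (metis Q abs_ge_zero diff_ge_0_iff_ge power2_abs power_mono real_sqrt_pow2)
    then show ?thesis using K by (simp add: Q_def)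
  qed
  have B_sym: "x(j := - x j) \<in> B" if j: "j \<in> insert i J" and x: "x \<in> B" for j x
  proof (cases "j = i")
    case True
    moreover have "restrict (x(i := - x i)) K = restrict x K" using K by (auto simp: restrict_def)
    ultimately show ?thesis using x by (auto simp: B_def space_PiM PiE_def extensional_def)
  next
    case False
    then have jJ: "j \<in> J" "j \<in> K" using j J by auto
    have mem: "z(j := - z j) \<in> A \<longleftrightarrow> z \<in> A" for z
      using J(2)[OF jJ(1), of z] J(2)[OF jJ(1), of "z(j := - z j)"] by auto
    \<comment> \<open>\<open>A\<close> is invariant under reflection in coordinate \<open>j\<close>,
      so base points that are mirror images carry the same fibre.\<close>
    have "S (restrict (x(j := - x j)) K) = S (restrict x K)"
    proof -
      have "(restrict (x(j := - x j)) K)(i := y) = ((restrict x K)(i := y))(j := - ((restrict x K)(i := y)) j)" for y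
        using False jJ by (auto simp: restrict_def)
      then show ?thesis unfolding S_def by (simp only: mem)
    qed
    then show ?thesis using x False jJ by (auto simp: B_def m_def space_PiM PiE_def extensional_def)
  qed
  show thesis by (rule that[OF B_sets B_emeasure B_diam B_sym])
qed

text \<open>After symmetrization in every coordinate the set contains -x along with x. Their
  distance 2 |x| is at most \<open>D\<close>, so the set lies in the centred ball of radius
  \<open>D / 2\<close>.\<close>

lemma isodiametric_PiM:
  fixes A :: "('i \<Rightarrow> real) set"
  assumes I: "finite I" and A: "A \<in> sets (Pi\<^sub>M I (\<lambda>_. lborel))" and D: "0 < D"
    and diam: "\<And>x y. x \<in> A \<Longrightarrow> y \<in> A \<Longrightarrow> (\<Sum>j\<in>I. (x j - y j)\<^sup>2) \<le> D\<^sup>2"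
  shows "emeasure (Pi\<^sub>M I (\<lambda>_. lborel)) A \<le> ennreal (unit_ball_vol (real (card I)) * (D / 2) ^ card I)"
proof -
  let ?M = "Pi\<^sub>M I (\<lambda>_. lborel :: real measure)"
  define P where "P J B \<longleftrightarrow> B \<in> sets ?M \<and> emeasure ?M B = emeasure ?M A \<and>
      (\<forall>x\<in>B. \<forall>y\<in>B. (\<Sum>j\<in>I. (x j - y j)\<^sup>2) \<le> D\<^sup>2) \<and>
      (\<forall>j\<in>J. \<forall>x\<in>B. x(j := - x j) \<in> B)" for J B
  have PD: "B \<in> sets ?M" "emeasure ?M B = emeasure ?M A"
      "\<And>x y. x \<in> B \<Longrightarrow> y \<in> B \<Longrightarrow> (\<Sum>j\<in>I. (x j - y j)\<^sup>2) \<le> D\<^sup>2"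
      "\<And>j x. j \<in> J \<Longrightarrow> x \<in> B \<Longrightarrow> x(j := - x j) \<in> B" if "P J B" for J B
    using that unfolding P_def by blast+
  \<comment> \<open>One coordinate is treated at a time; \<open>P J B\<close> records the symmetries
    already gained, so that later steps can keep them.\<close>
  have "\<exists>B. P J B" if "finite J" "J \<subseteq> I" for J using that
  proof (induction J)
    case empty
    then show ?case using A diam by (intro exI[of _ A]) (auto simp: P_def)
  next
    case (insert i J)
    then obtain B where B: "P J B" by blast
    have "i \<in> I" using insert.prems by simp
    define K where "K = I - {i}"
    have K: "finite K" "i \<notin> K" "I = insert i K" "J \<subseteq> K"
      using I insert.prems insert.hyps by (auto simp: K_def)
    show ?case
    proof (rule steiner_symmetrization[OF K(1,2) PD(1)[OF B, unfolded K(3)] less_imp_le[OF D]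
          PD(3)[OF B, unfolded K(3)] K(4) PD(4)[OF B]])
      fix B' assume "B' \<in> sets (Pi\<^sub>M (insert i K) (\<lambda>_. lborel))"
        "emeasure (Pi\<^sub>M (insert i K) (\<lambda>_. lborel)) B' = emeasure (Pi\<^sub>M (insert i K) (\<lambda>_. lborel)) B"
        "\<And>x y. x \<in> B' \<Longrightarrow> y \<in> B' \<Longrightarrow> (\<Sum>j\<in>insert i K. (x j - y j)\<^sup>2) \<le> D\<^sup>2"
        "\<And>j x. j \<in> insert i J \<Longrightarrow> x \<in> B' \<Longrightarrow> x(j := - x j) \<in> B'"
      then have "P (insert i J) B'" unfolding P_def K(3)[symmetric] using PD(2)[OF B] by simp
      then show ?thesis by blast
    qed
  qed
  from this[OF I order_refl] obtain B where "P I B" by blast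
  note B = PD[OF this]
  \<comment> \<open>The point reflection x to -x is composed of the coordinate reflections.\<close>
  have refl: "(\<lambda>j. if j \<in> J then - x j else x j) \<in> B" if "finite J" "J \<subseteq> I" "x \<in> B" for J x
    using that
  proof (induction J)
    case (insert i J)
    let ?y = "\<lambda>j. if j \<in> J then - x j else x j"
    have "?y(i := - ?y i) = (\<lambda>j. if j \<in> insert i J then - x j else x j)"
      using insert.hyps by (intro ext) simp
    then show ?case using B(4)[of i ?y] insert.prems insert.IH by simp
  qed simp
  have "B \<subseteq> {f. sqrt (\<Sum>i\<in>I. (f i)\<^sup>2) \<le> D / 2} \<inter> space ?M"
  proof
    fix x assume x: "x \<in> B"
    have "(\<Sum>j\<in>I. (x j - (if j \<in> I then - x j else x j))\<^sup>2) \<le> D\<^sup>2"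
      using I by (intro B(3) refl x) simp_all
    also have "(\<Sum>j\<in>I. (x j - (if j \<in> I then - x j else x j))\<^sup>2) = 4 * (\<Sum>j\<in>I. (x j)\<^sup>2)"
      unfolding sum_distrib_left by (intro sum.cong) (auto simp: power2_eq_square)
    finally have "(\<Sum>j\<in>I. (x j)\<^sup>2) \<le> (D / 2)\<^sup>2" by (simp add: power_divide)
    then have "sqrt (\<Sum>j\<in>I. (x j)\<^sup>2) \<le> D / 2"
      using D by (intro real_le_lsqrt) (auto intro: sum_nonneg)
    then show "x \<in> {f. sqrt (\<Sum>i\<in>I. (f i)\<^sup>2) \<le> D / 2} \<inter> space ?M"
      using sets.sets_into_space[OF B(1)] x by auto
  qed
  then have "emeasure ?M B \<le> emeasure ?M ({f. sqrt (\<Sum>i\<in>I. (f i)\<^sup>2) \<le> D / 2} \<inter> space ?M)"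
  proof (rule emeasure_mono)
    have "{f \<in> space ?M. sqrt (\<Sum>i\<in>I. (f i)\<^sup>2) \<le> D / 2} \<in> sets ?M" by measurable
    then show "{f. sqrt (\<Sum>i\<in>I. (f i)\<^sup>2) \<le> D / 2} \<inter> space ?M \<in> sets ?M"
      by (simp add: Int_def conj_commute)
  qed
  also have "\<dots> = ennreal (unit_ball_vol (real (card I)) * (D / 2) ^ card I)"
    using D I by (intro emeasure_cball_aux) auto
  finally show ?thesis using B(2) by simp
qed

theorem isodiametric_inequality:
  fixes A :: "'a::euclidean_space set"
  assumes A: "A \<in> sets borel" and D: "0 < D" and diam: "\<And>x y. x \<in> A \<Longrightarrow> y \<in> A \<Longrightarrow> dist x y \<le> D"
  shows "emeasure lborel A \<le> ennreal (unit_ball_vol (real DIM('a)) * (D / 2) ^ DIM('a))"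
proof -
  let ?M = "Pi\<^sub>M (Basis :: 'a set) (\<lambda>_. lborel :: real measure)" and ?T = "\<lambda>f. \<Sum>b\<in>(Basis :: 'a set). f b *\<^sub>R b"
  have T [measurable]: "?T \<in> ?M \<rightarrow>\<^sub>M borel" by measurable
  have "emeasure lborel A = emeasure ?M (?T -` A \<inter> space ?M)"
    using A by (subst lborel_eq) (simp add: emeasure_distr)
  also have "\<dots> \<le> ennreal (unit_ball_vol (real DIM('a)) * (D / 2) ^ DIM('a))"
  proof (rule isodiametric_PiM)
    show "?T -` A \<inter> space ?M \<in> sets ?M" using A by measurable
    fix f g assume fg: "f \<in> ?T -` A \<inter> space ?M" "g \<in> ?T -` A \<inter> space ?M"
    have "(\<Sum>j\<in>Basis. (f j - g j)\<^sup>2) = (dist (?T f) (?T g))\<^sup>2"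
      by (subst euclidean_dist_l2) (simp add: L2_set_def sum_nonneg dist_real_def)
    also have "\<dots> \<le> D\<^sup>2" using fg diam by (intro power_mono) auto
    finally show "(\<Sum>j\<in>Basis. (f j - g j)\<^sup>2) \<le> D\<^sup>2" .
  qed (use D in auto)
  finally show ?thesis .
qed

section \<open>Hausdorff measure and Lebesgue measure\<close>

text \<open>This is the purpose of the normalising constant in the weights: a ball used as a
  covering set costs no more than its volume.\<close>

lemma piece_weight_cball_le:
  fixes x :: "'a::euclidean_space"
  assumes "0 \<le> \<rho>"
  shows "piece_weight DIM('a) (cball x \<rho>) \<le> emeasure lborel (cball x \<rho>)"
proof -
  have "piece_weight DIM('a) (cball x \<rho>) \<le> ennreal (unit_ball_vol (real DIM('a)) * ((2 * \<rho>) / 2) ^ DIM('a))"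
  proof (rule piece_weight_le)
    fix y z assume "y \<in> cball x \<rho>" "z \<in> cball x \<rho>"
    then show "dist y z \<le> 2 * \<rho>"
      using dist_triangle_le[of y x z "2 * \<rho>"] by (simp add: dist_commute)
  qed (use assms in simp)
  then show ?thesis using assms by (simp add: emeasure_cball)
qed

lemma nn_integral_disjoint_cballs_le:
  fixes U :: "'a::euclidean_space set"
  assumes C: "countable C" "pairwise (\<lambda>i j. disjnt (cball (a i) (\<rho> i)) (cball (a j) (\<rho> j))) C"
    and U: "\<And>i. i \<in> C \<Longrightarrow> cball (a i) (\<rho> i) \<subseteq> U" "U \<in> sets borel"
  shows "(\<integral>\<^sup>+i. emeasure lborel (cball (a i) (\<rho> i)) \<partial>count_space C) \<le> emeasure lborel U"
proof -
  have "(\<integral>\<^sup>+i. emeasure lborel (cball (a i) (\<rho> i)) \<partial>count_space C) = emeasure lborel (\<Union>i\<in>C. cball (a i) (\<rho> i))"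
    using C by (intro emeasure_UN_countable[symmetric])
      (auto simp: disjoint_family_on_def pairwise_def disjnt_def)
  also have "\<dots> \<le> emeasure lborel U" using U by (intro emeasure_mono) auto
  finally show ?thesis .
qed

text \<open>The set has an open neighbourhood of arbitrarily small volume. By the Vitali covering
  lemma, disjoint balls inside it cover the set once enlarged five times, which costs only the
  factor 5^d.\<close>

lemma hausdorff_content_negligible:
  fixes N :: "'a::euclidean_space set"
  assumes N: "negligible N" and \<delta>: "0 < \<delta>"
  shows "hausdorff_content DIM('a) \<delta> N = 0"
proof -
  let ?d = "DIM('a)"
  have le: "hausdorff_content ?d \<delta> N \<le> ennreal (5 ^ ?d) * ennreal e" if e: "0 < e" for e :: real
  proof -
    have N': "N \<in> null_sets lebesgue" using N by (simp add: negligible_iff_null_sets)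
    obtain U where U: "open U" "N \<subseteq> U" "emeasure lebesgue (U - N) < ennreal e"
      by (rule sets_lebesgue_outer_open[OF null_setsD2[OF N'] e])
    have "emeasure lborel U = emeasure lebesgue (U - N)"
      using U(1) N' by (subst emeasure_Diff_null_set) auto
    then have vU: "emeasure lborel U \<le> ennreal e" using U(3) by simp
    \<comment> \<open>A ball of radius \<delta> / 10, enlarged five times, has diameter at most
      \<delta>.\<close>
    define K where "K = {(x, \<rho>). 0 < \<rho> \<and> \<rho> \<le> \<delta> / 10 \<and> cball x \<rho> \<subseteq> U}"
    have NK: "N \<subseteq> (\<Union>i\<in>K. cball (fst i) (snd i))"
    proof
      fix x assume "x \<in> N"
      then obtain \<rho> where "0 < \<rho>" "cball x \<rho> \<subseteq> U" using U(1,2) open_contains_cball by blast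
      then have "cball x (min \<rho> (\<delta> / 10)) \<subseteq> U" "0 < min \<rho> (\<delta> / 10)"
        using \<delta> by (auto simp: subset_iff)
      then have "(x, min \<rho> (\<delta> / 10)) \<in> K" by (simp add: K_def)
      moreover have "x \<in> cball (fst (x, min \<rho> (\<delta> / 10))) (snd (x, min \<rho> (\<delta> / 10)))"
        using \<open>0 < min \<rho> (\<delta> / 10)\<close> by simp
      ultimately show "x \<in> (\<Union>i\<in>K. cball (fst i) (snd i))" by blast
    qed
    obtain C where C: "countable C" "C \<subseteq> K"
      "pairwise (\<lambda>i j. disjnt (cball (fst i) (snd i)) (cball (fst j) (snd j))) C"
      "N \<subseteq> (\<Union>i\<in>C. cball (fst i) (5 * snd i))"
    proof (rule Vitali_covering_lemma_cballs[OF NK, of "\<delta> / 10"])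
      show "0 < snd i \<and> snd i \<le> \<delta> / 10" if "i \<in> K" for i
        using that by (simp add: K_def case_prod_unfold)
    qed
    have CK: "0 < snd i" "snd i \<le> \<delta> / 10" "cball (fst i) (snd i) \<subseteq> U" if "i \<in> C" for i
      using subsetD[OF C(2) that] by (simp_all add: K_def case_prod_unfold)
    have "hausdorff_content ?d \<delta> N \<le> (\<integral>\<^sup>+i. piece_weight ?d (cball (fst i) (5 * snd i)) \<partial>count_space C)"
      using C(1,4) CK(1,2) \<delta> by (intro hausdorff_content_le_nn_integral) (force simp: less_imp_le)+
    also have "\<dots> \<le> (\<integral>\<^sup>+i. ennreal (5 ^ ?d) * emeasure lborel (cball (fst i) (snd i)) \<partial>count_space C)"
    proof (rule nn_integral_mono)
      fix i assume "i \<in> space (count_space C)"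
      then have "0 < snd i" using CK by simp
      then have "piece_weight ?d (cball (fst i) (5 * snd i)) \<le> emeasure lborel (cball (fst i) (5 * snd i))"
        by (intro piece_weight_cball_le) simp
      also have "\<dots> = ennreal (5 ^ ?d) * emeasure lborel (cball (fst i) (snd i))"
        using \<open>0 < snd i\<close> by (simp add: emeasure_cball ennreal_mult[symmetric] power_mult_distrib mult_ac)
      finally show "piece_weight ?d (cball (fst i) (5 * snd i)) \<le> \<dots>" .
    qed
    also have "\<dots> = ennreal (5 ^ ?d) * (\<integral>\<^sup>+i. emeasure lborel (cball (fst i) (snd i)) \<partial>count_space C)"
      by (rule nn_integral_cmult) simp
    also have "\<dots> \<le> ennreal (5 ^ ?d) * emeasure lborel U"
      using C CK U by (intro mult_left_mono nn_integral_disjoint_cballs_le) auto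
    also have "\<dots> \<le> ennreal (5 ^ ?d) * ennreal e" using vU by (rule mult_left_mono) simp
    finally show ?thesis .
  qed
  have "hausdorff_content ?d \<delta> N \<le> 0"
  proof (rule ennreal_le_epsilon)
    fix e :: real assume "0 < e"
    then have "hausdorff_content ?d \<delta> N \<le> ennreal (5 ^ ?d) * ennreal (e / 5 ^ ?d)"
      by (intro le) simp
    also have "\<dots> = 0 + ennreal e" using \<open>0 < e\<close> by (simp add: ennreal_mult[symmetric])
    finally show "hausdorff_content ?d \<delta> N \<le> 0 + ennreal e" .
  qed
  then show ?thesis by simp
qed

text \<open>All balls inside \<open>U\<close> of radius at most \<open>\<delta>\<close> form a fine
  cover of \<open>U\<close>, since arbitrarily small ones occur around each point.\<close>

lemma Vitali_covering_open:
  fixes U :: "'a::euclidean_space set"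
  assumes "open U" and \<delta>: "0 < \<delta>"
  obtains C where "countable C" "\<And>x \<rho>. (x, \<rho>) \<in> C \<Longrightarrow> 0 < \<rho> \<and> \<rho> \<le> \<delta> \<and> cball x \<rho> \<subseteq> U"
    "pairwise (\<lambda>i j. disjnt (cball (fst i) (snd i)) (cball (fst j) (snd j))) C"
    "negligible (U - (\<Union>i\<in>C. cball (fst i) (snd i)))"
proof -
  define K where "K = {(x, \<rho>). 0 < \<rho> \<and> \<rho> \<le> \<delta> \<and> cball x \<rho> \<subseteq> U}"
  obtain C where C: "countable C" "C \<subseteq> K"
      "pairwise (\<lambda>i j. disjnt (cball (fst i) (snd i)) (cball (fst j) (snd j))) C"
      "negligible (U - (\<Union>i\<in>C. cball (fst i) (snd i)))"
  proof (rule Vitali_covering_theorem_cballs[of K snd U fst])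
    show "0 < snd i" if "i \<in> K" for i using that by (auto simp: K_def)
    show "\<exists>i. i \<in> K \<and> x \<in> cball (fst i) (snd i) \<and> snd i < t" if "x \<in> U" "0 < t" for x t
    proof -
      obtain \<rho> where \<rho>: "0 < \<rho>" "cball x \<rho> \<subseteq> U" using \<open>open U\<close> \<open>x \<in> U\<close> open_contains_cball by blast
      define s where "s = min \<rho> (min \<delta> (t / 2))"
      have "0 < s" "s \<le> \<delta>" "s < t" "s \<le> \<rho>" using \<rho> \<delta> \<open>0 < t\<close> by (auto simp: s_def)
      then have "(x, s) \<in> K" using \<rho>(2) by (auto simp: K_def subset_iff)
      then show ?thesis using \<open>0 < s\<close> \<open>s < t\<close> by (intro exI[of _ "(x, s)"]) simp
    qed
  qed
  show thesis by (rule that[OF C(1) _ C(3,4)]) (use C(2) in \<open>auto simp: K_def\<close>)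
qed

text \<open>An open set slightly larger than \<open>F\<close> is filled with disjoint small balls up
  to a null set. The balls cost their total volume, and the rest has content 0 by
  \<open>hausdorff_content_negligible\<close>.\<close>

lemma hausdorff_measure_le_lborel:
  fixes F :: "'a::euclidean_space set"
  assumes F: "F \<in> sets borel"
  shows "hausdorff_measure DIM('a) F \<le> emeasure lborel F"
  unfolding hausdorff_measure_def
proof (rule SUP_least)
  let ?d = "DIM('a)"
  fix \<delta> :: real assume "\<delta> \<in> {0<..}"
  then have \<delta>: "0 < \<delta>" by simp
  show "hausdorff_content ?d \<delta> F \<le> emeasure lborel F"
  proof (rule ennreal_le_epsilon)
    fix e :: real assume e: "0 < e"
    obtain U where U: "open U" "F \<subseteq> U" "emeasure lborel (U - F) < ennreal e"
      using outer_regular_lborel[OF F e] by auto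
    obtain C where C: "countable C" "\<And>x \<rho>. (x, \<rho>) \<in> C \<Longrightarrow> 0 < \<rho> \<and> \<rho> \<le> \<delta> / 2 \<and> cball x \<rho> \<subseteq> U"
      "pairwise (\<lambda>i j. disjnt (cball (fst i) (snd i)) (cball (fst j) (snd j))) C"
      "negligible (U - (\<Union>i\<in>C. cball (fst i) (snd i)))"
      by (rule Vitali_covering_open[OF U(1), of "\<delta> / 2"]) (use \<delta> in auto)
    have CK: "0 < snd i" "snd i \<le> \<delta> / 2" "cball (fst i) (snd i) \<subseteq> U" if "i \<in> C" for i
      using C(2)[of "fst i" "snd i"] that by auto
    let ?W = "\<Union>i\<in>C. cball (fst i) (snd i)"
    have "hausdorff_content ?d \<delta> ?W \<le> (\<integral>\<^sup>+i. piece_weight ?d (cball (fst i) (snd i)) \<partial>count_space C)"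
      using C(1) CK(1,2) \<delta> by (intro hausdorff_content_le_nn_integral) (force simp: less_imp_le)+
    also have "\<dots> \<le> (\<integral>\<^sup>+i. emeasure lborel (cball (fst i) (snd i)) \<partial>count_space C)"
      using CK(1) by (intro nn_integral_mono piece_weight_cball_le) (simp add: less_imp_le)
    also have "\<dots> \<le> emeasure lborel U" using C CK U by (intro nn_integral_disjoint_cballs_le) auto
    also have "\<dots> = emeasure lborel (U - F) + emeasure lborel F"
      using U F by (subst plus_emeasure) (auto simp: Un_absorb2)
    also have "\<dots> \<le> ennreal e + emeasure lborel F" using U(3) by (intro add_right_mono less_imp_le)
    finally have W: "hausdorff_content ?d \<delta> ?W \<le> ennreal e + emeasure lborel F" .
    have "hausdorff_content ?d \<delta> F \<le> hausdorff_content ?d \<delta> (?W \<union> (U - ?W))"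
      using U(2) by (intro hausdorff_content_mono) auto
    also have "\<dots> \<le> hausdorff_content ?d \<delta> ?W + hausdorff_content ?d \<delta> (U - ?W)"
      using \<delta> by (intro hausdorff_content_Un) simp
    also have "\<dots> = hausdorff_content ?d \<delta> ?W" using hausdorff_content_negligible[OF C(4) \<delta>] by simp
    also note W
    finally show "hausdorff_content ?d \<delta> F \<le> emeasure lborel F + ennreal e"
      by (simp add: add.commute)
  qed
qed

text \<open>Domain and codomain are different types of equal dimension, so no determinant is used:
  \<open>U\<close> is filled with disjoint balls up to a null set, an isometry maps balls to
  disjoint balls, and the volume of a ball depends only on radius and dimension.\<close>

lemma emeasure_isometry_vimage_ge:
  fixes f :: "'a::euclidean_space \<Rightarrow> 'b::euclidean_space"
  assumes dim: "DIM('a) = DIM('b)"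
    and f: "\<And>x y. dist (f x) (f y) = dist x y" and gf: "\<And>x. g (f x) = x" and fg: "\<And>y. f (g y) = y"
    and U: "open U"
  shows "emeasure lborel U \<le> emeasure lborel (g -` U)"
proof -
  have g: "dist (g x) (g y) = dist x y" for x y by (metis f fg)
  obtain C where C: "countable C" "\<And>x \<rho>. (x, \<rho>) \<in> C \<Longrightarrow> 0 < \<rho> \<and> \<rho> \<le> 1 \<and> cball x \<rho> \<subseteq> U"
    "pairwise (\<lambda>i j. disjnt (cball (fst i) (snd i)) (cball (fst j) (snd j))) C"
    "negligible (U - (\<Union>i\<in>C. cball (fst i) (snd i)))" by (rule Vitali_covering_open[OF U, of 1]) auto
  let ?W = "\<Union>i\<in>C. cball (fst i) (snd i)"
  have C': "0 < snd i" "cball (fst i) (snd i) \<subseteq> U" if "i \<in> C" for i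
    using C(2)[of "fst i" "snd i"] that by auto
  have vim: "cball (f x) \<rho> = g -` cball x \<rho>" for x \<rho> using g[of "f x"] by (auto simp: gf)
  have W: "?W \<in> sets borel" "?W \<subseteq> U"
    using C(1) by (intro sets.countable_UN'') (simp_all add: UN_least[OF C'(2)])
  have "g \<in> borel_measurable borel"
  proof (intro borel_measurable_continuous_onI)
    show "continuous_on UNIV g" by (rule continuous_onI) (use g in auto)
  qed
  then have gU: "g -` U \<in> sets borel" using U measurable_sets_borel[of g borel U] by simp
  have "emeasure lborel U = emeasure lebesgue (?W \<union> (U - ?W))" using U W by (simp add: Un_absorb1)
  also have "\<dots> \<le> emeasure lebesgue ?W + emeasure lebesgue (U - ?W)"
    using U W by (intro emeasure_subadditive) auto
  also have "emeasure lebesgue (U - ?W) = 0"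
    using C(4) by (simp add: negligible_iff_null_sets null_setsD1)
  also have "emeasure lebesgue ?W + 0 = emeasure lborel ?W" using W by simp
  also have "\<dots> = (\<integral>\<^sup>+i. emeasure lborel (cball (fst i) (snd i)) \<partial>count_space C)"
    using C by (intro emeasure_UN_countable) (auto simp: disjoint_family_on_def pairwise_def disjnt_def)
  also have "\<dots> = (\<integral>\<^sup>+i. emeasure lborel (cball (f (fst i)) (snd i)) \<partial>count_space C)"
    using C' dim by (intro nn_integral_cong) (simp add: emeasure_cball less_imp_le)
  also have "\<dots> \<le> emeasure lborel (g -` U)"
  proof (rule nn_integral_disjoint_cballs_le[OF C(1)])
    show "pairwise (\<lambda>i j. disjnt (cball (f (fst i)) (snd i)) (cball (f (fst j)) (snd j))) C"
      using C(3) unfolding vim pairwise_def disjnt_def by blast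
    show "cball (f (fst i)) (snd i) \<subseteq> g -` U" if "i \<in> C" for i
      unfolding vim by (intro vimage_mono C'(2) that)
  qed (rule gU)
  finally show ?thesis .
qed

text \<open>The one-sided estimate is applied to \<open>f\<close> and to its inverse
  \<open>g\<close>, which gives equality on boxes; these determine Lebesgue measure.\<close>

lemma lborel_distr_isometry:
  fixes f :: "'a::euclidean_space \<Rightarrow> 'b::euclidean_space"
  assumes dim: "DIM('a) = DIM('b)"
    and f: "\<And>x y. dist (f x) (f y) = dist x y" and gf: "\<And>x. g (f x) = x" and fg: "\<And>y. f (g y) = y"
  shows "distr lborel borel f = lborel"
proof (rule lborel_eqI[symmetric])
  have g: "dist (g x) (g y) = dist x y" for x y by (metis f fg)
  have cont: "continuous_on UNIV f" by (rule continuous_onI) (use f in auto)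
  then have fm: "f \<in> borel_measurable lborel" using borel_measurable_continuous_onI by simp
  fix l u :: 'b assume le: "\<And>b. b \<in> Basis \<Longrightarrow> l \<bullet> b \<le> u \<bullet> b"
  have op: "open (f -` box l u)" using cont by (intro open_vimage) auto
  have "emeasure lborel (f -` box l u) \<le> emeasure lborel (g -` (f -` box l u))"
    by (rule emeasure_isometry_vimage_ge[OF dim f gf fg op])
  moreover have "g -` (f -` box l u) = box l u" by (auto simp: fg)
  moreover have "emeasure lborel (box l u) \<le> emeasure lborel (f -` box l u)"
    by (rule emeasure_isometry_vimage_ge[OF dim[symmetric] g fg gf open_box])
  ultimately have "emeasure lborel (f -` box l u) = emeasure lborel (box l u)" by simp
  then show "emeasure (distr lborel borel f) (box l u) = (\<Prod>b\<in>Basis. (u - l) \<bullet> b)"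
    using le fm by (simp add: emeasure_distr emeasure_lborel_box)
qed simp

section \<open>Cones over subsets of the unit sphere\<close>

lemma emeasure_affine_vimage:
  fixes A :: "'a::euclidean_space set"
  assumes A: "A \<in> sets borel" and c: "c \<noteq> 0"
  shows "emeasure lborel A = ennreal (\<bar>c\<bar> ^ DIM('a)) * emeasure lborel ((\<lambda>x. t + c *\<^sub>R x) -` A)"
proof -
  have "emeasure lborel A = emeasure (density (distr lborel borel (\<lambda>x. t + c *\<^sub>R x)) (\<lambda>_. ennreal (\<bar>c\<bar> ^ DIM('a)))) A"
    using lborel_affine[OF c, of t] by simp
  also have "\<dots> = ennreal (\<bar>c\<bar> ^ DIM('a)) * emeasure (distr lborel borel (\<lambda>x. t + c *\<^sub>R x)) A"
    using A by (intro emeasure_density_const) simp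
  also have "emeasure (distr lborel borel (\<lambda>x. t + c *\<^sub>R x)) A = emeasure lborel ((\<lambda>x. t + c *\<^sub>R x) -` A)"
    using A by (subst emeasure_distr) auto
  finally show ?thesis .
qed

definition cone_over :: "'a::euclidean_space set \<Rightarrow> 'a set" where
  "cone_over A = {y. 0 < norm y \<and> norm y \<le> 1 \<and> sgn y \<in> A}"

text \<open>A solid cone with apex at the centre has 1/n of the volume of its spherical base, so for
  subsets of the unit sphere this is the usual surface measure.\<close>

definition sphere_measure :: "'a::euclidean_space set \<Rightarrow> ennreal" where
  "sphere_measure A = of_nat DIM('a) * emeasure lborel (cone_over A)"

lemma cone_over_sets [measurable]:
  fixes A :: "'a::euclidean_space set"
  assumes [measurable]: "A \<in> sets borel"
  shows "cone_over A \<in> sets borel"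
proof -
  have [measurable]: "(sgn :: 'a \<Rightarrow> 'a) \<in> borel_measurable borel"
    unfolding sgn_div_norm by measurable
  show ?thesis unfolding cone_over_def by measurable
qed

text \<open>\<open>Z\<close> is the cone with apex at the origin over \<open>F\<close> placed at
  height 1. Its slice at height \<tau> is \<tau> F, of volume \<tau>^d times that of
  \<open>F\<close>, and \<tau>^d integrates to 1 / (d + 1) over the unit interval.\<close>

lemma emeasure_flat_cone:
  fixes F :: "'v::euclidean_space set"
  assumes F: "F \<in> sets borel"
  defines "Z \<equiv> {(w, \<tau>). 0 < \<tau> \<and> \<tau> \<le> 1 \<and> w /\<^sub>R \<tau> \<in> F}"
  shows "Z \<in> sets borel" "of_nat (Suc DIM('v)) * emeasure lborel Z = emeasure lborel F"
proof -
  let ?d = "DIM('v)"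
  note [measurable] = F
  have "{x \<in> space (borel \<Otimes>\<^sub>M borel :: ('v \<times> real) measure). 0 < snd x \<and> snd x \<le> 1 \<and> fst x /\<^sub>R snd x \<in> F} \<in> sets (borel \<Otimes>\<^sub>M borel)"
    by measurable
  then show Z: "Z \<in> sets borel"
    by (simp add: Z_def case_prod_unfold borel_prod[where 'a = 'v and 'b = real, symmetric] space_pair_measure)
  have fib: "emeasure lborel ((\<lambda>w. (w, \<tau>)) -` Z) = ennreal (\<tau> ^ ?d) * indicator {0..1} \<tau> * emeasure lborel F"
    if "\<tau> \<noteq> 0" for \<tau> :: real
  proof (cases "0 < \<tau> \<and> \<tau> \<le> 1")
    case True
    have "emeasure lborel F = ennreal (\<bar>inverse \<tau>\<bar> ^ ?d) * emeasure lborel ((\<lambda>x. 0 + inverse \<tau> *\<^sub>R x) -` F)"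
      using True F by (intro emeasure_affine_vimage) auto
    also have "(\<lambda>x. 0 + inverse \<tau> *\<^sub>R x) -` F = (\<lambda>w. (w, \<tau>)) -` Z" using True by (auto simp: Z_def)
    finally have "ennreal (\<tau> ^ ?d) * emeasure lborel F = ennreal (\<tau> ^ ?d) * (ennreal (\<bar>inverse \<tau>\<bar> ^ ?d) * emeasure lborel ((\<lambda>w. (w, \<tau>)) -` Z))"
      by simp
    also have "\<dots> = ennreal (\<tau> ^ ?d * \<bar>inverse \<tau>\<bar> ^ ?d) * emeasure lborel ((\<lambda>w. (w, \<tau>)) -` Z)"
      using True by (simp add: mult.assoc[symmetric] ennreal_mult)
    also have "\<tau> ^ ?d * \<bar>inverse \<tau>\<bar> ^ ?d = 1"
      using True by (simp add: power_mult_distrib[symmetric])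
    finally show ?thesis using True by (simp add: indicator_def)
  next
    case False
    then have "(\<lambda>w. (w, \<tau>)) -` Z = {}" by (auto simp: Z_def)
    then show ?thesis using False that by (simp add: indicator_def)
  qed
  have AE: "AE \<tau> in lborel. (\<tau>::real) \<noteq> 0" by (rule AE_lborel_singleton)
  have "emeasure lborel Z = emeasure (lborel \<Otimes>\<^sub>M lborel) Z" by (simp add: lborel_prod)
  also have "\<dots> = (\<integral>\<^sup>+\<tau>. emeasure lborel ((\<lambda>w. (w, \<tau>)) -` Z) \<partial>lborel)"
    using Z by (intro lborel_pair.emeasure_pair_measure_alt2) (simp only: lborel_prod sets_lborel)
  also have "\<dots> = (\<integral>\<^sup>+\<tau>. ennreal (\<tau> ^ ?d) * indicator {0..1} \<tau> * emeasure lborel F \<partial>lborel)"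
    by (rule nn_integral_cong_AE) (use AE fib in auto)
  also have "\<dots> = (\<integral>\<^sup>+\<tau>. ennreal (\<tau> ^ ?d) * indicator {0..1} \<tau> \<partial>lborel) * emeasure lborel F"
    by (rule nn_integral_multc) simp
  also have "(\<integral>\<^sup>+\<tau>. ennreal (\<tau> ^ ?d) * indicator {0..1} \<tau> \<partial>lborel) = ennreal (1 ^ Suc ?d / Suc ?d - 0 ^ Suc ?d / Suc ?d)"
  proof (rule nn_integral_FTC_Icc)
    fix \<tau> :: real
    show "((\<lambda>\<tau>. \<tau> ^ Suc ?d / Suc ?d) has_real_derivative \<tau> ^ ?d) (at \<tau>)"
      by (rule DERIV_cong[OF DERIV_cdivide[OF DERIV_pow]]) (simp_all add: field_simps del: of_nat_Suc)
  qed simp_all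
  finally have "emeasure lborel Z = ennreal (1 / Suc ?d) * emeasure lborel F" by simp
  then have "of_nat (Suc ?d) * emeasure lborel Z = (ennreal (Suc ?d) * ennreal (1 / Suc ?d)) * emeasure lborel F"
    by (simp only: ennreal_of_nat_eq_real_of_nat mult.assoc)
  also have "ennreal (Suc ?d) * ennreal (1 / Suc ?d) = 1"
    by (simp add: ennreal_mult[symmetric] del: of_nat_Suc ennreal_of_nat_eq_real_of_nat)
  finally show "of_nat (Suc ?d) * emeasure lborel Z = emeasure lborel F" by simp
qed

text \<open>With norms \<alpha>, \<beta> and cosine c of the angle, the difference of the squared
  distances is (\<alpha> - \<beta>)^2 + 2 (1 - c) (\<alpha> \<beta> - 1), a sum of nonnegative terms
  outside the open unit ball.\<close>

lemma dist_sgn_le: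
  fixes a b :: "'a::euclidean_space"
  assumes "1 \<le> norm a" "1 \<le> norm b"
  shows "dist (sgn a) (sgn b) \<le> dist a b"
proof -
  let ?\<alpha> = "norm a" and ?\<beta> = "norm b"
  have "(norm (a - b))\<^sup>2 = ?\<alpha>\<^sup>2 + ?\<beta>\<^sup>2 - 2 * (a \<bullet> b)"
    by (simp add: power2_norm_eq_inner inner_diff algebra_simps inner_commute)
  moreover have "(norm (sgn a - sgn b))\<^sup>2 = 2 - 2 * (a \<bullet> b) / (?\<alpha> * ?\<beta>)"
  proof -
    have "(norm (sgn a - sgn b))\<^sup>2 = (norm (sgn a))\<^sup>2 + (norm (sgn b))\<^sup>2 - 2 * (sgn a \<bullet> sgn b)"
      by (simp add: power2_norm_eq_inner inner_diff algebra_simps inner_commute)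
    moreover have "norm (sgn a) = 1" "norm (sgn b) = 1" using assms by (auto simp: norm_sgn)
    ultimately show ?thesis by (simp add: sgn_div_norm divide_inverse mult_ac)
  qed
  moreover have "2 - 2 * (a \<bullet> b) / (?\<alpha> * ?\<beta>) \<le> ?\<alpha>\<^sup>2 + ?\<beta>\<^sup>2 - 2 * (a \<bullet> b)"
  proof -
    define c where "c = (a \<bullet> b) / (?\<alpha> * ?\<beta>)"
    have pos: "0 < ?\<alpha>" "0 < ?\<beta>" using assms by linarith+
    then have ab: "a \<bullet> b = c * (?\<alpha> * ?\<beta>)" unfolding c_def by simp
    have "c \<le> 1" using norm_cauchy_schwarz[of a b] pos by (simp add: c_def field_simps)
    moreover have "1 \<le> ?\<alpha> * ?\<beta>" using mult_mono[of 1 ?\<alpha> 1 ?\<beta>] assms by simp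
    ultimately have "0 \<le> (1 - c) * (?\<alpha> * ?\<beta> - 1)" by simp
    moreover have "0 \<le> (?\<alpha> - ?\<beta>)\<^sup>2" by simp
    moreover have "(2 * (a \<bullet> b) / (?\<alpha> * ?\<beta>)) = 2 * c" by (simp add: c_def)
    ultimately show ?thesis unfolding ab by (simp add: power2_eq_square algebra_simps)
  qed
  ultimately have "(dist (sgn a) (sgn b))\<^sup>2 \<le> (dist a b)\<^sup>2" by (simp add: dist_norm)
  then show ?thesis by (rule power2_le_imp_le) simp
qed

text \<open>Any linear isometry \<open>f\<close> onto the space is corrected by a Householder
  reflection that sends the image of the axis to \<open>u\<close>.\<close>

lemma isometry_onto_with_axis:
  fixes u :: "'a::euclidean_space"
  assumes dim: "DIM('a) = Suc DIM('v::euclidean_space)" and u: "norm u = 1"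
  obtains L :: "'v::euclidean_space \<times> real \<Rightarrow> 'a" and M where "linear L" "\<And>x. norm (L x) = norm x"
    "\<And>x. M (L x) = x" "\<And>y. L (M y) = y" "L (0, 1) = u"
proof -
  have "DIM('v \<times> real) = DIM('a)" using dim by simp
  then obtain f :: "'v \<times> real \<Rightarrow> 'a" and g where f: "linear f" "linear g"
    "\<And>x. norm (f x) = norm x" "\<And>y. norm (g y) = norm y" "\<And>x. g (f x) = x" "\<And>y. f (g y) = y"
    by (rule isomorphisms_UNIV_UNIV) auto
  define a where "a = f (0, 1)"
  \<comment> \<open>\<open>R\<close> is the reflection in the hyperplane bisecting \<open>a\<close>
    and \<open>u\<close>; if they coincide, \<open>w\<close> is 0 and \<open>R\<close> is the
    identity.\<close>
  define w where "w = sgn (a - u)"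
  define R where "R x = x - (2 * (x \<bullet> w)) *\<^sub>R w" for x
  have na: "norm a = 1" by (simp add: a_def f norm_Pair)
  have R_lin: "linear R"
    unfolding R_def by (rule linearI) (auto simp: algebra_simps inner_add_left scaleR_add_left)
  have ww: "w = 0 \<or> w \<bullet> w = 1" by (cases "a = u") (auto simp: w_def norm_sgn simp flip: norm_eq_1)
  have R_norm: "norm (R x) = norm x" for x
  proof -
    have "R x \<bullet> R x = x \<bullet> x" using ww by (auto simp: R_def inner_diff algebra_simps inner_commute)
    then show ?thesis by (simp add: norm_eq)
  qed
  have RR: "R (R x) = x" for x
  proof (cases "w = 0")
    case False
    then have "R x \<bullet> w = - (x \<bullet> w)" using ww by (simp add: R_def inner_diff)
    then have "R (R x) = R x + (2 * (x \<bullet> w)) *\<^sub>R w" by (simp add: R_def[of "R x"])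
    then show ?thesis by (simp add: R_def)
  qed (simp add: R_def)
  have Ra: "R a = u"
  proof (cases "a = u")
    case True
    then show ?thesis by (simp add: R_def w_def)
  next
    case False
    have aa: "a \<bullet> a = 1" "u \<bullet> u = 1" using na u by (simp_all flip: norm_eq_1)
    have D: "(norm (a - u))\<^sup>2 = 2 - 2 * (a \<bullet> u)"
      by (simp add: power2_norm_eq_inner inner_diff aa algebra_simps inner_commute)
    have "2 * (a \<bullet> w) = norm (a - u)"
    proof -
      have "2 * (a \<bullet> (a - u)) = (norm (a - u))\<^sup>2" unfolding D by (simp add: inner_diff aa)
      moreover have "a \<bullet> w = (a \<bullet> (a - u)) / norm (a - u)"
        by (simp only: w_def sgn_div_norm inner_scaleR_right divide_inverse mult.commute)
      ultimately have "2 * (a \<bullet> w) * norm (a - u) = norm (a - u) * norm (a - u)"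
        using False by (simp add: power2_eq_square del: inner_diff_right)
      then show ?thesis using False by (simp del: inner_diff_right)
    qed
    then have "R a = a - norm (a - u) *\<^sub>R w" by (simp add: R_def)
    also have "norm (a - u) *\<^sub>R w = a - u" using False by (simp add: w_def sgn_div_norm)
    finally show ?thesis by simp
  qed
  show thesis
  proof (rule that[of "R \<circ> f" "g \<circ> R"])
    show "linear (R \<circ> f)" by (rule linear_compose[OF f(1) R_lin])
  qed (auto simp: R_norm RR f Ra[unfolded a_def])
qed

text \<open>The tangent hyperplane at \<open>u\<close> is mapped to the sphere by radial projection,
  which is 1-Lipschitz by \<open>dist_sgn_le\<close>; its inverse divides by the inner product with
  \<open>u\<close>. In the coordinates of \<open>L\<close>, the solid cone over \<open>A\<close>
  lies between \<kappa> Z and \<open>Z\<close>, where \<open>Z\<close> is the flat cone over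
  \<open>F\<close>, so both volumes agree up to the factor \<kappa>^n.\<close>

lemma gnomonic_chart:
  fixes u :: "'a::euclidean_space"
  assumes dim: "DIM('a) = Suc DIM('v::euclidean_space)" and u: "norm u = 1"
    and A: "A \<in> sets borel" "A \<subseteq> sphere 0 1" and \<kappa>: "0 < \<kappa>" "\<And>x. x \<in> A \<Longrightarrow> \<kappa> \<le> x \<bullet> u"
  obtains F :: "'v::euclidean_space set" and \<phi> where "F \<in> sets borel" "\<phi> ` F = A"
    "\<And>v w. dist (\<phi> v) (\<phi> w) \<le> dist v w"
    "\<And>v w. v \<in> F \<Longrightarrow> w \<in> F \<Longrightarrow> dist v w = dist (\<phi> v /\<^sub>R (\<phi> v \<bullet> u)) (\<phi> w /\<^sub>R (\<phi> w \<bullet> u))"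
    "sphere_measure A \<le> emeasure lborel F"
    "ennreal (\<kappa> ^ DIM('a)) * emeasure lborel F \<le> sphere_measure A"
proof -
  obtain L :: "'v \<times> real \<Rightarrow> 'a" and M where L: "linear L" "\<And>x. norm (L x) = norm x"
    "\<And>x. M (L x) = x" "\<And>y. L (M y) = y" "L (0, 1) = u"
    using isometry_onto_with_axis[OF dim u] by blast
  have L_dist: "dist (L x) (L y) = dist x y" for x y
    using L(2)[of "x - y"] linear_diff[OF L(1)] by (simp add: dist_norm)
  have L_inner: "L x \<bullet> L y = x \<bullet> y" for x y
    using L(2)[of "x + y"] L(2)[of x] L(2)[of y] linear_add[OF L(1), of x y]
    by (simp add: norm_eq inner_add inner_commute)
  have axis: "L (w, \<tau>) \<bullet> u = \<tau>" for w \<tau> using L_inner[of "(w, \<tau>)" "(0, 1)"] by (simp add: L(5))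
  have L_scale: "L (c *\<^sub>R x) = c *\<^sub>R L x" for c x by (rule linear_scale[OF L(1)])
  have norm_ge: "1 \<le> norm (L (v, 1))" for v
    using norm_cauchy_schwarz[of "L (v, 1)" u] u by (simp add: axis)
  define \<phi> where "\<phi> v = sgn (L (v, 1))" for v
  define F where "F = \<phi> -` A"
  have lip: "dist (\<phi> v) (\<phi> w) \<le> dist v w" for v w
    using dist_sgn_le[OF norm_ge norm_ge, of v w] by (simp add: \<phi>_def L_dist dist_Pair_Pair)
  have "continuous_on UNIV \<phi>"
    by (rule continuous_onI) (use lip in \<open>meson le_less_trans less_imp_le\<close>)
  then have \<phi>_meas: "\<phi> \<in> borel_measurable borel" by (rule borel_measurable_continuous_onI)
  have F: "F \<in> sets borel" using measurable_sets_borel[OF \<phi>_meas A(1)] by (simp add: F_def)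
  have \<phi>_recover: "\<phi> v /\<^sub>R (\<phi> v \<bullet> u) = L (v, 1)" for v
  proof -
    have "norm (L (v, 1)) \<noteq> 0" using norm_ge[of v] by linarith
    then show ?thesis by (simp add: \<phi>_def sgn_div_norm axis)
  qed
  have sgn_scale: "\<phi> (w /\<^sub>R \<tau>) = sgn (L (w, \<tau>))" if "0 < \<tau>" for w \<tau>
  proof -
    have "L (w /\<^sub>R \<tau>, 1) = L (w, \<tau>) /\<^sub>R \<tau>" using that by (simp flip: L_scale)
    then show ?thesis using that by (simp add: \<phi>_def sgn_scaleR)
  qed
  have img: "\<phi> ` F = A"
  proof
    show "\<phi> ` F \<subseteq> A" by (auto simp: F_def)
    show "A \<subseteq> \<phi> ` F"
    proof
      fix x assume x: "x \<in> A"
      obtain w \<tau> where wt: "M x = (w, \<tau>)" by (cases "M x")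
      then have Lx: "L (w, \<tau>) = x" by (metis L(4))
      then have "0 < \<tau>" using \<kappa>(2)[OF x] \<kappa>(1) axis[of w \<tau>] by simp
      then have "\<phi> (w /\<^sub>R \<tau>) = x" using x A(2) by (auto simp: sgn_scale Lx sgn_div_norm)
      then show "x \<in> \<phi> ` F" using x by (force simp: F_def)
    qed
  qed
  define Z where "Z = {(w :: 'v, \<tau> :: real). 0 < \<tau> \<and> \<tau> \<le> 1 \<and> w /\<^sub>R \<tau> \<in> F}"
  have Z: "Z \<in> sets borel" "of_nat (Suc DIM('v)) * emeasure lborel Z = emeasure lborel F"
    using emeasure_flat_cone[OF F] unfolding Z_def by auto
  have L_meas: "L \<in> borel_measurable lborel"
    using borel_measurable_continuous_onI[of L] linear_continuous_on[of L UNIV] L(1)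
    by (simp add: linear_conv_bounded_linear)
  have L_emeasure: "emeasure lborel X = emeasure lborel (L -` X)" if "X \<in> sets borel" for X
  proof -
    have "distr lborel borel L = lborel"
      using dim by (intro lborel_distr_isometry[OF _ L_dist L(3,4)]) simp
    then have "emeasure lborel X = emeasure (distr lborel borel L) X" by simp
    also have "\<dots> = emeasure lborel (L -` X)" using that L_meas by (subst emeasure_distr) auto
    finally show ?thesis .
  qed
  have cone: "cone_over A \<in> sets borel" using A by simp
  \<comment> \<open>The height over the origin is the inner product with \<open>u\<close>, hence at
    most the norm, and it is positive because directions in \<open>A\<close> satisfy the bound
    \<kappa>.\<close>
  have sub: "L -` cone_over A \<subseteq> Z"
  proof
    fix y assume y: "y \<in> L -` cone_over A"
    obtain w \<tau> where yw: "y = (w, \<tau>)" by (cases y)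
    have c: "0 < norm (L y)" "norm (L y) \<le> 1" "sgn (L y) \<in> A" using y by (auto simp: cone_over_def)
    have "\<kappa> * norm (L y) \<le> L y \<bullet> u" using \<kappa>(2)[OF c(3)] c(1) by (simp add: sgn_div_norm field_simps)
    then have "\<kappa> * norm (L y) \<le> \<tau>" by (simp add: yw axis)
    moreover have "0 < \<kappa> * norm (L y)" using c(1) \<kappa>(1) by simp
    ultimately have t: "0 < \<tau>" by linarith
    have "\<tau> \<le> norm (L y)" using norm_cauchy_schwarz[of "L y" u] u by (simp add: yw axis)
    then show "y \<in> Z" using t c sgn_scale[OF t, of w] by (simp add: Z_def yw F_def)
  qed
  have "emeasure lborel (cone_over A) \<le> emeasure lborel Z"
    using L_emeasure[OF cone] emeasure_mono[OF sub] Z(1) by simp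
  then have up: "sphere_measure A \<le> emeasure lborel F"
    unfolding sphere_measure_def Z(2)[symmetric] dim by (rule mult_left_mono) simp
  \<comment> \<open>A point of height at most 1 whose direction lies in \<open>A\<close> has norm at
    most 1 / \<kappa>, so shrinking it by \<kappa> brings it into the unit ball.\<close>
  have sub': "Z \<subseteq> (\<lambda>x. 0 + \<kappa> *\<^sub>R x) -` (L -` cone_over A)"
  proof
    fix y assume y: "y \<in> Z"
    obtain w \<tau> where yw: "y = (w, \<tau>)" by (cases y)
    have z: "0 < \<tau>" "\<tau> \<le> 1" "sgn (L y) \<in> A" using y sgn_scale[of \<tau> w] by (auto simp: Z_def yw F_def)
    have "L y \<noteq> 0" using axis[of w \<tau>] z(1) by (auto simp: yw)
    then have "\<kappa> * norm (L y) \<le> L y \<bullet> u" using \<kappa>(2)[OF z(3)] by (simp add: sgn_div_norm field_simps)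
    then have "\<kappa> * norm (L y) \<le> 1" using z(2) by (simp add: yw axis)
    then show "y \<in> (\<lambda>x. 0 + \<kappa> *\<^sub>R x) -` (L -` cone_over A)"
      using \<kappa>(1) \<open>L y \<noteq> 0\<close> z(3) by (simp add: cone_over_def L_scale sgn_scaleR)
  qed
  have LC: "L -` cone_over A \<in> sets borel" using measurable_sets[OF L_meas cone] by simp
  have "ennreal (\<kappa> ^ DIM('a)) * emeasure lborel Z \<le> ennreal (\<kappa> ^ DIM('a)) * emeasure lborel ((\<lambda>x. 0 + \<kappa> *\<^sub>R x) -` (L -` cone_over A))"
  proof (intro mult_left_mono emeasure_mono sub')
    show "(\<lambda>x. 0 + \<kappa> *\<^sub>R x) -` (L -` cone_over A) \<in> sets lborel"
      using measurable_sets_borel[OF _ LC, of "\<lambda>x. 0 + \<kappa> *\<^sub>R x"] by simp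
  qed simp
  also have "\<dots> = emeasure lborel (L -` cone_over A)"
    using emeasure_affine_vimage[OF LC, of \<kappa> 0] \<kappa>(1) dim by simp
  also have "\<dots> = emeasure lborel (cone_over A)" using L_emeasure[OF cone] by simp
  finally have "of_nat DIM('a) * (ennreal (\<kappa> ^ DIM('a)) * emeasure lborel Z) \<le> sphere_measure A"
    unfolding sphere_measure_def by (rule mult_left_mono) simp
  then have low: "ennreal (\<kappa> ^ DIM('a)) * emeasure lborel F \<le> sphere_measure A"
    unfolding Z(2)[symmetric] by (simp add: dim mult_ac)
  show thesis
  proof (rule that[OF F img lip _ up low])
    fix v w
    show "dist v w = dist (\<phi> v /\<^sub>R (\<phi> v \<bullet> u)) (\<phi> w /\<^sub>R (\<phi> w \<bullet> u))"
      unfolding \<phi>_recover by (simp add: L_dist dist_Pair_Pair)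
  qed
qed

section \<open>Hausdorff measure on the unit sphere\<close>

text \<open>
  The type \<open>real ^ 'a cobasis\<close> is a Euclidean space of dimension \<open>DIM('a) - 1\<close>, the home of the
  tangent hyperplanes; in dimension one the carrier is \<open>Basis\<close> only to keep the type nonempty.
\<close>

typedef (overloaded) ('a::euclidean_space) cobasis =
  "if 2 \<le> DIM('a) then Basis - {SOME b. b \<in> Basis} else (Basis :: 'a set)"
  morphisms Rep_cobasis Abs_cobasis
proof -
  have "Basis - {SOME b :: 'a. b \<in> Basis} \<noteq> {}" if "2 \<le> DIM('a)"
  proof
    assume "Basis - {SOME b :: 'a. b \<in> Basis} = {}"
    then have "(Basis :: 'a set) \<subseteq> {SOME b. b \<in> Basis}" by blast
    then have "DIM('a) \<le> card {SOME b :: 'a. b \<in> Basis}" by (rule card_mono[rotated]) simp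
    then show False using that by simp
  qed
  moreover have "(Basis :: 'a set) \<noteq> {}" by simp
  ultimately show ?thesis by (auto simp: ex_in_conv simp del: Diff_eq_empty_iff)
qed

instance cobasis :: (euclidean_space) finite
proof
  have "(UNIV :: 'a cobasis set) = Abs_cobasis ` (if 2 \<le> DIM('a) then Basis - {SOME b. b \<in> Basis} else Basis)"
    using type_definition.univ[OF type_definition_cobasis] .
  then show "finite (UNIV :: 'a cobasis set)" by (rule ssubst) (auto intro!: finite_imageI)
qed

lemma CARD_cobasis:
  assumes "2 \<le> DIM('a::euclidean_space)"
  shows "DIM('a) = Suc CARD('a cobasis)"
proof -
  have "CARD('a cobasis) = card (Basis - {SOME b :: 'a. b \<in> Basis})"
    using type_definition.card[OF type_definition_cobasis[where 'a = 'a]] assms by simp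
  moreover have "(SOME b :: 'a. b \<in> Basis) \<in> Basis" by (rule someI_ex) (simp add: ex_in_conv)
  ultimately show ?thesis using assms by (simp add: card_Diff_singleton)
qed

section \<open>Finiteness and additivity of cone volumes\<close>

lemma emeasure_bounded_finite:
  assumes "X \<subseteq> cball p R"
  shows "emeasure lborel X < \<infinity>"
  using emeasure_mono[OF assms, of lborel] emeasure_lborel_cball_finite[of p R] by (simp add: le_less_trans)

lemma cone_over_finite: "emeasure lborel (cone_over B) < \<infinity>"
  by (rule emeasure_bounded_finite[of _ 0 1]) (auto simp: cone_over_def)

lemma sphere_measure_finite: "sphere_measure A < \<infinity>" for A :: "'a::euclidean_space set"
  using cone_over_finite[of A] by (simp add: sphere_measure_def ennreal_mult_less_top of_nat_less_top)

lemma sphere_measure_UN_le: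
  fixes F :: "nat \<Rightarrow> 'a::euclidean_space set"
  assumes "\<And>k. F k \<in> sets borel"
  shows "sphere_measure (\<Union>k. F k) \<le> (\<Sum>k. sphere_measure (F k))"
proof -
  have "cone_over (\<Union>k. F k) = (\<Union>k. cone_over (F k))" by (auto simp: cone_over_def)
  then have "emeasure lborel (cone_over (\<Union>k. F k)) \<le> (\<Sum>k. emeasure lborel (cone_over (F k)))"
    using assms by (auto intro!: emeasure_subadditive_countably)
  then have "sphere_measure (\<Union>k. F k) \<le> of_nat DIM('a) * (\<Sum>k. emeasure lborel (cone_over (F k)))"
    unfolding sphere_measure_def by (rule mult_left_mono) simp
  then show ?thesis by (simp add: sphere_measure_def)
qed

lemma sphere_measure_UN_disjoint:
  fixes F :: "nat \<Rightarrow> 'a::euclidean_space set"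
  assumes "\<And>k. k < m \<Longrightarrow> F k \<in> sets borel" "disjoint_family_on F {..<m}"
  shows "sphere_measure (\<Union>k<m. F k) = (\<Sum>k<m. sphere_measure (F k))"
proof -
  have "cone_over (\<Union>k<m. F k) = (\<Union>k<m. cone_over (F k))" by (auto simp: cone_over_def)
  moreover have "disjoint_family_on (\<lambda>k. cone_over (F k)) {..<m}"
    using assms(2) unfolding disjoint_family_on_def cone_over_def by blast
  ultimately have "emeasure lborel (cone_over (\<Union>k<m. F k)) = (\<Sum>k<m. emeasure lborel (cone_over (F k)))"
    using assms(1) by (simp add: sum_emeasure image_subset_iff)
  then show ?thesis by (simp add: sphere_measure_def sum_distrib_left)
qed

text \<open>By compactness finitely many small caps cover the sphere. On each piece the chart is
  1-Lipschitz, so Hausdorff measure is at most the volume of the flat copy, which exceeds the sphere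
  measure by at most the factor \<kappa>^(-n).\<close>

lemma hausdorff_measure_sphere_le_aux:
  fixes A :: "'a::euclidean_space set"
  assumes dim: "2 \<le> DIM('a)" and A: "A \<in> sets borel" "A \<subseteq> sphere 0 1" and \<kappa>: "0 < \<kappa>" "\<kappa> < 1"
  shows "ennreal (\<kappa> ^ DIM('a)) * hausdorff_measure (DIM('a) - 1) A \<le> sphere_measure A"
proof -
  let ?d = "DIM('a) - 1"
  have dimv: "DIM('a) = Suc DIM(real ^ 'a cobasis)" using CARD_cobasis[OF dim] by simp
  then have d: "?d = DIM(real ^ 'a cobasis)" by simp
  \<comment> \<open>For unit vectors at distance \<eta> the inner product is 1 - \<eta>^2 / 2, which
    equals \<kappa> for this value.\<close>
  define \<eta> where "\<eta> = sqrt (2 * (1 - \<kappa>))"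
  have \<eta>: "0 < \<eta>" "\<eta>\<^sup>2 = 2 * (1 - \<kappa>)" using \<kappa> by (auto simp: \<eta>_def)
  have "compact (sphere (0::'a) 1)" by simp
  then obtain U where U: "U \<subseteq> sphere (0::'a) 1" "finite U" "sphere 0 1 \<subseteq> (\<Union>u\<in>U. ball u \<eta>)"
    by (rule compactE_image[of _ "sphere 0 1" "\<lambda>u. ball u \<eta>"]) (use \<eta>(1) in auto)
  obtain xs where xs: "set xs = U" using finite_list[OF U(2)] by blast
  define m where "m = length xs"
  define B where "B k = ball (xs ! k) \<eta>" for k
  \<comment> \<open>Disjoint pieces make the sphere measures add up exactly; overlapping caps would
    only give an inequality in the wrong direction.\<close>
  define P where "P k = A \<inter> disjointed B k" for k
  have UN: "(\<Union>k<m. disjointed B k) = (\<Union>k<m. B k)"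
    using finite_UN_disjointed_eq[of B m] by (simp add: atLeast0LessThan)
  have "A \<subseteq> (\<Union>k<m. B k)"
  proof
    fix x assume "x \<in> A"
    then obtain u where "u \<in> set xs" "x \<in> ball u \<eta>" using A(2) U(3) xs by blast
    then show "x \<in> (\<Union>k<m. B k)" by (auto simp: in_set_conv_nth m_def B_def)
  qed
  then have AP: "A = (\<Union>k<m. P k)" unfolding P_def using UN by blast
  have P_borel: "P k \<in> sets borel" for k unfolding P_def B_def disjointed_def using A(1) by auto
  have "disjoint_family P"
    using disjoint_family_disjointed[of B] unfolding P_def disjoint_family_on_def by blast
  then have \<sigma>: "sphere_measure A = (\<Sum>k<m. sphere_measure (P k))"
    by (subst AP, intro sphere_measure_UN_disjoint P_borel) (auto simp: disjoint_family_on_def)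
  have piece: "ennreal (\<kappa> ^ DIM('a)) * hausdorff_measure ?d (P k) \<le> sphere_measure (P k)" if "k < m" for k
  proof -
    have u: "norm (xs ! k) = 1" using that U(1) xs by (force simp: m_def)
    have "\<kappa> \<le> x \<bullet> (xs ! k)" if "x \<in> P k" for x
    proof -
      have x: "norm x = 1" "dist (xs ! k) x < \<eta>"
        using that A(2) disjointed_subset[of B k] by (auto simp: P_def B_def)
      have "(dist (xs ! k) x)\<^sup>2 = 2 - 2 * (x \<bullet> (xs ! k))"
        using x(1) u by (simp add: dist_norm power2_norm_eq_inner inner_diff inner_commute flip: norm_eq_1)
          (simp add: norm_eq_1)
      moreover have "(dist (xs ! k) x)\<^sup>2 \<le> \<eta>\<^sup>2" using x(2) by (intro power_mono) auto
      ultimately show ?thesis using \<eta>(2) by simp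
    qed
    then obtain F :: "(real ^ 'a cobasis) set" and \<phi> where F: "F \<in> sets borel" "\<phi> ` F = P k"
      "\<And>v w. dist (\<phi> v) (\<phi> w) \<le> dist v w"
      "ennreal (\<kappa> ^ DIM('a)) * emeasure lborel F \<le> sphere_measure (P k)"
      using gnomonic_chart[OF dimv u P_borel _ \<kappa>(1)] A(2) by (metis P_def le_infI1)
    have "hausdorff_measure ?d (P k) \<le> ennreal (1 ^ ?d) * hausdorff_measure ?d F"
      unfolding F(2)[symmetric] using F(3) by (intro hausdorff_measure_lipschitz_image) auto
    also have "\<dots> \<le> emeasure lborel F" using hausdorff_measure_le_lborel[OF F(1)] unfolding d by simp
    finally have "ennreal (\<kappa> ^ DIM('a)) * hausdorff_measure ?d (P k) \<le> ennreal (\<kappa> ^ DIM('a)) * emeasure lborel F"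
      by (rule mult_left_mono) simp
    then show ?thesis using F(4) by (rule order_trans)
  qed
  have "hausdorff_measure ?d A \<le> (\<Sum>k<m. hausdorff_measure ?d (P k))"
    by (subst AP, intro hausdorff_measure_UN) simp
  then have "ennreal (\<kappa> ^ DIM('a)) * hausdorff_measure ?d A \<le> ennreal (\<kappa> ^ DIM('a)) * (\<Sum>k<m. hausdorff_measure ?d (P k))"
    by (rule mult_left_mono) simp
  also have "\<dots> \<le> sphere_measure A" unfolding \<sigma> sum_distrib_left by (intro sum_mono piece) simp
  finally show ?thesis .
qed

lemma ennreal_le_mult_one_interval:
  fixes a b :: ennreal
  assumes "\<And>z. 0 < z \<Longrightarrow> z < 1 \<Longrightarrow> ennreal z * a \<le> b" and "b < \<infinity>"
  shows "a \<le> b"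
proof -
  obtain b' where b: "b = ennreal b'" "0 \<le> b'" using assms(2) by (cases b) auto
  \<comment> \<open>One instance of the hypothesis shows that \<open>a\<close> is finite; the rest
    is an argument about reals.\<close>
  have "ennreal (1/2) * a \<le> b" by (rule assms) auto
  then have "a \<noteq> \<infinity>" using assms(2) by (auto simp: ennreal_mult_top top_unique)
  then obtain a' where a: "a = ennreal a'" "0 \<le> a'" by (cases a) auto
  have "a' \<le> b'"
  proof (rule field_le_mult_one_interval)
    fix z :: real assume z: "0 < z" "z < 1"
    then have "ennreal (z * a') \<le> ennreal b'" using assms(1)[OF z] a b by (simp add: ennreal_mult)
    then show "z * a' \<le> b'" using b(2) by simp
  qed
  then show ?thesis by (simp add: a b ennreal_leI)
qed

lemma hausdorff_measure_sphere_le: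
  fixes A :: "'a::euclidean_space set"
  assumes dim: "2 \<le> DIM('a)" and A: "A \<in> sets borel" "A \<subseteq> sphere 0 1"
  shows "hausdorff_measure (DIM('a) - 1) A \<le> sphere_measure A"
proof (rule ennreal_le_mult_one_interval)
  fix z :: real assume z: "0 < z" "z < 1"
  have "ennreal (root DIM('a) z ^ DIM('a)) * hausdorff_measure (DIM('a) - 1) A \<le> sphere_measure A"
    using z dim by (intro hausdorff_measure_sphere_le_aux A) auto
  then show "ennreal z * hausdorff_measure (DIM('a) - 1) A \<le> sphere_measure A" using z by simp
qed (rule sphere_measure_finite)

text \<open>The Lipschitz constant must tend to 1 as \<delta> tends to 0, and the crude estimate of
  the two denominators by |x - y| would not give this. The gain of a further factor \<delta> comes
  from the orthogonality of x + y and x - y for unit vectors.\<close>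

lemma dist_central_projection_le:
  fixes x y u :: "'a::euclidean_space"
  assumes "norm x = 1" "norm y = 1" "norm u = 1" and \<kappa>: "0 < \<kappa>" "\<kappa> \<le> x \<bullet> u" "\<kappa> \<le> y \<bullet> u"
    and \<delta>: "dist x u \<le> \<delta>" "dist y u \<le> \<delta>"
  shows "dist (x /\<^sub>R (x \<bullet> u)) (y /\<^sub>R (y \<bullet> u)) \<le> (1 / \<kappa> + \<delta> / \<kappa>\<^sup>2) * dist x y"
proof -
  define a where "a = x \<bullet> u"
  define b where "b = y \<bullet> u"
  have ab: "\<kappa> \<le> a" "\<kappa> \<le> b" "0 < a" "0 < b" using \<kappa> by (auto simp: a_def b_def)
  have xy: "x \<bullet> x = 1" "y \<bullet> y = 1" using assms by (simp_all flip: norm_eq_1)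
  \<comment> \<open>Subtracting the midpoint from \<open>u\<close> changes nothing, since y - x is
    orthogonal to it, and the midpoint is within \<delta> of \<open>u\<close>.\<close>
  have "b - a = (y - x) \<bullet> (u - (1/2) *\<^sub>R (x + y))"
    using xy by (simp add: a_def b_def inner_diff inner_add inner_commute field_simps)
  also have "\<bar>\<dots>\<bar> \<le> norm (y - x) * norm (u - (1/2) *\<^sub>R (x + y))" by (rule Cauchy_Schwarz_ineq2)
  also have "norm (u - (1/2) *\<^sub>R (x + y)) \<le> \<delta>"
  proof -
    have "u - (1/2) *\<^sub>R (x + y) = (1/2) *\<^sub>R (u - x) + (1/2) *\<^sub>R (u - y)"
      by (simp add: algebra_simps flip: scaleR_add_left)
    also have "norm \<dots> \<le> (1/2) * norm (u - x) + (1/2) * norm (u - y)" by (rule norm_triangle_le) simp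
    also have "\<dots> \<le> \<delta>" using \<delta> by (simp add: dist_norm norm_minus_commute)
    finally show ?thesis .
  qed
  finally have diff: "\<bar>b - a\<bar> \<le> dist x y * \<delta>"
    by (simp add: dist_norm norm_minus_commute mult_left_mono)
  have "x /\<^sub>R a - y /\<^sub>R b = (x - y) /\<^sub>R a + ((b - a) / (a * b)) *\<^sub>R y"
    using ab by (simp add: algebra_simps divide_simps flip: scaleR_add_left)
  then have "dist (x /\<^sub>R a) (y /\<^sub>R b) \<le> norm ((x - y) /\<^sub>R a) + norm (((b - a) / (a * b)) *\<^sub>R y)"
    by (simp only: dist_norm norm_triangle_ineq)
  also have "\<dots> = dist x y / a + \<bar>b - a\<bar> / (a * b)"
    using ab assms(2) by (simp add: dist_norm divide_inverse abs_mult mult.commute)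
  also have "\<dots> \<le> dist x y / \<kappa> + (dist x y * \<delta>) / (\<kappa> * \<kappa>)"
    using ab \<kappa>(1) diff by (intro add_mono frac_le mult_mono) auto
  also have "\<dots> = (1 / \<kappa> + \<delta> / \<kappa>\<^sup>2) * dist x y" by (simp add: algebra_simps power2_eq_square)
  finally show ?thesis by (simp add: a_def b_def)
qed

text \<open>The chart is centred at a point of \<open>F\<close> itself. The flat copy then has
  diameter at most \<open>D\<close> times the constant of \<open>dist_central_projection_le\<close>,
  and the isodiametric inequality bounds its volume. The value of \<kappa> is the least inner
  product of unit vectors at distance at most \<delta>.\<close>

lemma sphere_measure_small_le:
  fixes F :: "'a::euclidean_space set"
  assumes dim: "2 \<le> DIM('a)" and F: "F \<in> sets borel" "F \<subseteq> sphere 0 1"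
    and D: "0 \<le> D" "D \<le> \<delta>" "\<And>x y. x \<in> F \<Longrightarrow> y \<in> F \<Longrightarrow> dist x y \<le> D"
    and \<delta>: "0 < \<delta>" "\<delta> < 1"
  defines "\<kappa> \<equiv> 1 - \<delta>\<^sup>2 / 2"
  shows "sphere_measure F \<le> ennreal (unit_ball_vol (real (DIM('a) - 1)) * ((1 / \<kappa> + \<delta> / \<kappa>\<^sup>2) * D / 2) ^ (DIM('a) - 1))"
proof (cases "F = {}")
  case True
  then show ?thesis by (simp add: sphere_measure_def cone_over_def)
next
  case False
  then obtain u where u: "u \<in> F" by blast
  have nF: "norm x = 1" if "x \<in> F" for x using F(2) that by auto
  have dimv: "DIM('a) = Suc DIM(real ^ 'a cobasis)" using CARD_cobasis[OF dim] by simp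
  then have d: "DIM('a) - 1 = DIM(real ^ 'a cobasis)" by simp
  have "\<delta>\<^sup>2 < 1" using \<delta> by (simp add: power_less_one_iff)
  then have \<kappa>: "0 < \<kappa>" by (simp add: \<kappa>_def)
  have inner: "\<kappa> \<le> x \<bullet> u" if "x \<in> F" for x
  proof -
    have "(dist x u)\<^sup>2 = x \<bullet> x + u \<bullet> u - 2 * (x \<bullet> u)"
      by (simp add: dist_norm power2_norm_eq_inner inner_diff inner_commute)
    moreover have "x \<bullet> x = 1" "u \<bullet> u = 1" using nF[OF that] nF[OF u] by (simp_all flip: norm_eq_1)
    moreover have "(dist x u)\<^sup>2 \<le> \<delta>\<^sup>2" using D(2) D(3)[OF that u] by (intro power_mono) auto
    ultimately show ?thesis by (simp add: \<kappa>_def)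
  qed
  obtain G :: "(real ^ 'a cobasis) set" and \<phi> where G: "G \<in> sets borel" "\<phi> ` G = F"
      "\<And>v w. v \<in> G \<Longrightarrow> w \<in> G \<Longrightarrow> dist v w = dist (\<phi> v /\<^sub>R (\<phi> v \<bullet> u)) (\<phi> w /\<^sub>R (\<phi> w \<bullet> u))"
      "sphere_measure F \<le> emeasure lborel G"
    using gnomonic_chart[OF dimv nF[OF u] F \<kappa> inner] by metis
  define c where "c = 1 / \<kappa> + \<delta> / \<kappa>\<^sup>2"
  have c: "0 < c" using \<kappa> \<delta> by (simp add: c_def add_pos_pos)
  have diam: "dist v w \<le> c * D" if "v \<in> G" "w \<in> G" for v w
  proof -
    have mem: "\<phi> v \<in> F" "\<phi> w \<in> F" using that G(2) by auto
    have "dist v w = dist (\<phi> v /\<^sub>R (\<phi> v \<bullet> u)) (\<phi> w /\<^sub>R (\<phi> w \<bullet> u))" by (rule G(3)[OF that])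
    also have "\<dots> \<le> c * dist (\<phi> v) (\<phi> w)" unfolding c_def using mem u D(2)
      by (intro dist_central_projection_le nF \<kappa> inner order_trans[OF D(3) D(2)])
    also have "\<dots> \<le> c * D" using D(3)[OF mem] c by simp
    finally show ?thesis .
  qed
  have "emeasure lborel G \<le> ennreal (unit_ball_vol (real DIM(real ^ 'a cobasis)) * (c * D / 2) ^ DIM(real ^ 'a cobasis))"
  \<comment> \<open>The isodiametric inequality is stated for positive diameter; for
    \<open>D = 0\<close> the flat copy is a single point and has volume 0.\<close>
  proof (cases "D = 0")
    case True
    obtain v where "v \<in> G" using u G(2) by blast
    then have "G \<subseteq> {v}" using diam True by (auto simp: subset_iff)
    then have "emeasure lborel G \<le> emeasure lborel {v}" by (intro emeasure_mono) auto
    then show ?thesis by simp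
  next
    case False
    then show ?thesis using c D(1) by (intro isodiametric_inequality G diam) auto
  qed
  then show ?thesis unfolding d using G(4) by (simp add: c_def)
qed

text \<open>Every cover by sets of diameter at most \<delta> has total weight at least the sphere
  measure divided by a power of \<open>?c \<delta>\<close>, by
  \<open>sphere_measure_small_le\<close> and countable subadditivity. The constant tends to 1 with
  \<delta>.\<close>

lemma sphere_measure_le_hausdorff_measure:
  fixes A :: "'a::euclidean_space set"
  assumes dim: "2 \<le> DIM('a)" and A: "closed A" "A \<subseteq> sphere 0 1"
  shows "sphere_measure A \<le> hausdorff_measure (DIM('a) - 1) A"
proof (cases "hausdorff_measure (DIM('a) - 1) A < \<infinity>")
  case fin: True
  let ?d = "DIM('a) - 1"
  let ?c = "\<lambda>\<delta>::real. 1 / (1 - \<delta>\<^sup>2 / 2) + \<delta> / (1 - \<delta>\<^sup>2 / 2)\<^sup>2"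
  have content: "ennreal (1 / ?c \<delta> ^ ?d) * sphere_measure A \<le> hausdorff_content ?d \<delta> A" if \<delta>: "0 < \<delta>" "\<delta> < 1" for \<delta>
  proof (rule le_hausdorff_contentI)
    fix E :: "nat \<Rightarrow> 'a set"
    assume E: "A \<subseteq> (\<Union>k. E k)" "\<And>k. bounded (E k)" "\<And>k. diameter (E k) \<le> \<delta>"
    have "\<delta>\<^sup>2 < 1" using \<delta> by (simp add: power_less_one_iff)
    then have c: "0 < ?c \<delta>" using \<delta> by (intro add_pos_pos divide_pos_pos) auto
    \<comment> \<open>Covering sets need not be Borel; passing to the closure makes them so without
      changing the diameter.\<close>
    have F: "closure (E k) \<inter> A \<in> sets borel" for k using A(1) by auto
    have piece: "sphere_measure (closure (E k) \<inter> A) \<le> ennreal (?c \<delta> ^ ?d) * piece_weight ?d (E k)" for k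
    proof (cases "E k = {}")
      case True
      then show ?thesis by (simp add: sphere_measure_def cone_over_def)
    next
      case False
      have "sphere_measure (closure (E k) \<inter> A) \<le> ennreal (unit_ball_vol (real ?d) * (?c \<delta> * diameter (E k) / 2) ^ ?d)"
      proof (rule sphere_measure_small_le[OF dim F _ _ E(3) _ \<delta>])
        show "dist x y \<le> diameter (E k)" if "x \<in> closure (E k) \<inter> A" "y \<in> closure (E k) \<inter> A" for x y
          using diameter_bounded_bound[of "closure (E k)" x y] that E(2)[of k]
          by (simp add: diameter_closure bounded_closure)
      qed (use A(2) E(2) in \<open>auto simp: diameter_ge_0\<close>)
      also have "unit_ball_vol (real ?d) * (?c \<delta> * diameter (E k) / 2) ^ ?d = ?c \<delta> ^ ?d * (unit_ball_vol (real ?d) * (diameter (E k) / 2) ^ ?d)"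
        by (simp add: power_mult_distrib power_divide)
      also have "ennreal \<dots> = ennreal (?c \<delta> ^ ?d) * piece_weight ?d (E k)"
        using False E(2)[of k] c by (simp add: piece_weight_def ennreal_mult diameter_ge_0 del: power_divide)
      finally show ?thesis .
    qed
    have UN_eq: "(\<Union>k. closure (E k) \<inter> A) = A" using E(1) closure_subset by blast
    have "sphere_measure A \<le> (\<Sum>k. sphere_measure (closure (E k) \<inter> A))"
      using sphere_measure_UN_le[of "\<lambda>k. closure (E k) \<inter> A", OF F] by (simp only: UN_eq)
    also have "\<dots> \<le> (\<Sum>k. ennreal (?c \<delta> ^ ?d) * piece_weight ?d (E k))"
      by (intro suminf_le piece) auto
    also have "\<dots> = ennreal (?c \<delta> ^ ?d) * (\<Sum>k. piece_weight ?d (E k))" by simp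
    finally have "ennreal (1 / ?c \<delta> ^ ?d) * sphere_measure A \<le> ennreal (1 / ?c \<delta> ^ ?d) * (ennreal (?c \<delta> ^ ?d) * (\<Sum>k. piece_weight ?d (E k)))"
      by (rule mult_left_mono) simp
    also have "\<dots> = ennreal (1 / ?c \<delta> ^ ?d * ?c \<delta> ^ ?d) * (\<Sum>k. piece_weight ?d (E k))"
      using c by (simp only: mult.assoc[symmetric] ennreal_mult[OF divide_nonneg_nonneg[OF zero_le_one zero_le_power[OF less_imp_le[OF c]]] zero_le_power[OF less_imp_le[OF c]]])
    also have "1 / ?c \<delta> ^ ?d * ?c \<delta> ^ ?d = 1" using c by simp
    finally show "ennreal (1 / ?c \<delta> ^ ?d) * sphere_measure A \<le> (\<Sum>k. piece_weight ?d (E k))" by simp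
  qed
  have lim: "((\<lambda>\<delta>. 1 / ?c \<delta> ^ ?d) \<longlongrightarrow> 1) (at_right 0)" by (auto intro!: tendsto_eq_intros)
  show ?thesis
  proof (rule ennreal_le_mult_one_interval[OF _ fin])
    fix z :: real assume z: "0 < z" "z < 1"
    have "eventually (\<lambda>\<delta>. z < 1 / ?c \<delta> ^ ?d) (at_right 0)" using lim z(2) by (rule order_tendstoD)
    moreover have "eventually (\<lambda>\<delta>. 0 < \<delta> \<and> \<delta> < (1::real)) (at_right 0)"
      by (intro eventually_conj eventually_at_right_less eventually_at_right_real[THEN eventually_mono]) auto
    ultimately have "eventually (\<lambda>\<delta>. z < 1 / ?c \<delta> ^ ?d \<and> 0 < \<delta> \<and> \<delta> < 1) (at_right 0)"
      by eventually_elim auto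
    then obtain \<delta> where \<delta>: "z < 1 / ?c \<delta> ^ ?d" "0 < \<delta>" "\<delta> < 1"
      using eventually_happens' trivial_limit_at_right_real by blast
    have "ennreal z * sphere_measure A \<le> ennreal (1 / ?c \<delta> ^ ?d) * sphere_measure A"
      using \<delta>(1) by (intro mult_right_mono ennreal_leI) auto
    also have "\<dots> \<le> hausdorff_content ?d \<delta> A" by (rule content[OF \<delta>(2,3)])
    also have "\<dots> \<le> hausdorff_measure ?d A" by (rule hausdorff_content_le_measure[OF \<delta>(2)])
    finally show "ennreal z * sphere_measure A \<le> hausdorff_measure ?d A" .
  qed
qed (simp add: not_less top_unique)

theorem hausdorff_measure_unit_sphere:
  fixes A :: "'a::euclidean_space set"
  assumes "2 \<le> DIM('a)" "closed A" "A \<subseteq> sphere 0 1"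
  shows "hausdorff_measure (DIM('a) - 1) A = sphere_measure A"
  using assms by (intro antisym hausdorff_measure_sphere_le sphere_measure_le_hausdorff_measure) auto

section \<open>Volume of thin shells\<close>

lemma closed_directions:
  fixes p :: "'a::euclidean_space"
  assumes "closed C"
  shows "closed {u \<in> sphere 0 1. p + r *\<^sub>R u \<in> C}"
proof -
  have "{u \<in> sphere 0 1. p + r *\<^sub>R u \<in> C} = (\<lambda>u. p + r *\<^sub>R u) -` C \<inter> sphere 0 1" by auto
  then show ?thesis using assms by (auto intro!: closed_Int closed_vimage continuous_intros)
qed

text \<open>The similarity onto the unit sphere and its inverse are Lipschitz with constants 1 / r
  and r, so the scaling estimate holds in both directions.\<close>

lemma hausdorff_measure_sphere:
  fixes p :: "'a::euclidean_space"
  assumes dim: "2 \<le> DIM('a)" and r: "0 < r" and C: "closed C"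
  shows "hausdorff_measure (DIM('a) - 1) (sphere p r \<inter> C)
    = ennreal (r ^ (DIM('a) - 1)) * sphere_measure {u \<in> sphere 0 1. p + r *\<^sub>R u \<in> C}"
proof -
  let ?d = "DIM('a) - 1" and ?A = "{u \<in> sphere 0 1. p + r *\<^sub>R u \<in> C}"
  let ?f = "\<lambda>u. p + r *\<^sub>R u" and ?g = "\<lambda>x. (x - p) /\<^sub>R r"
  have A: "closed ?A" using C by (rule closed_directions)
  have f: "?f ` ?A = sphere p r \<inter> C"
  proof
    show "?f ` ?A \<subseteq> sphere p r \<inter> C" using r by (auto simp: dist_norm)
    show "sphere p r \<inter> C \<subseteq> ?f ` ?A"
    proof
      fix x assume x: "x \<in> sphere p r \<inter> C"
      then have "?g x \<in> ?A" "x = ?f (?g x)" using r by (auto simp: dist_norm norm_minus_commute)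
      then show "x \<in> ?f ` ?A" by (rule rev_image_eqI)
    qed
  qed
  have g: "?g ` (sphere p r \<inter> C) = ?A" unfolding f[symmetric] using r by (force simp: image_image)
  have H: "hausdorff_measure ?d ?A = sphere_measure ?A"
    by (rule hausdorff_measure_unit_sphere[OF dim A]) auto
  have "hausdorff_measure ?d (sphere p r \<inter> C) \<le> ennreal (r ^ ?d) * sphere_measure ?A"
    unfolding f[symmetric] H[symmetric] using r by (intro hausdorff_measure_lipschitz_image)
      (auto simp: dist_norm simp flip: scaleR_diff_right)
  moreover have "ennreal (r ^ ?d) * sphere_measure ?A \<le> hausdorff_measure ?d (sphere p r \<inter> C)"
  proof -
    have "hausdorff_measure ?d (?g ` (sphere p r \<inter> C)) \<le> ennreal ((1 / r) ^ ?d) * hausdorff_measure ?d (sphere p r \<inter> C)"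
      using r by (intro hausdorff_measure_lipschitz_image)
        (auto simp: dist_norm divide_inverse simp flip: scaleR_diff_right)
    then have "ennreal (r ^ ?d) * sphere_measure ?A \<le> ennreal (r ^ ?d) * (ennreal ((1 / r) ^ ?d) * hausdorff_measure ?d (sphere p r \<inter> C))"
      unfolding g H by (rule mult_left_mono) simp
    also have "\<dots> = ennreal (r ^ ?d * (1 / r) ^ ?d) * hausdorff_measure ?d (sphere p r \<inter> C)"
      using r by (subst ennreal_mult) (auto simp: mult.assoc)
    also have "r ^ ?d * (1 / r) ^ ?d = 1" using r by (simp add: power_divide)
    finally show ?thesis by simp
  qed
  ultimately show ?thesis by (rule antisym)
qed

lemma emeasure_cone_scaled:
  fixes B :: "'a::euclidean_space set" and p :: 'a
  assumes B: "B \<in> sets borel" and R: "0 < R"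
  defines "S \<equiv> {x. 0 < dist p x \<and> dist p x \<le> R \<and> sgn (x - p) \<in> B}"
  shows "S \<in> sets borel" "emeasure lborel S = ennreal (R ^ DIM('a)) * emeasure lborel (cone_over B)"
proof -
  have [measurable]: "(sgn :: 'a \<Rightarrow> 'a) \<in> borel_measurable borel"
    unfolding sgn_div_norm by measurable
  note [measurable] = B
  show S: "S \<in> sets borel" unfolding S_def by measurable
  have "(\<lambda>x. p + R *\<^sub>R x) -` S = cone_over B"
    using R by (auto simp: S_def cone_over_def dist_norm sgn_scaleR)
  then show "emeasure lborel S = ennreal (R ^ DIM('a)) * emeasure lborel (cone_over B)"
    using emeasure_affine_vimage[OF S, where c = R and t = p] R by simp
qed

text \<open>The sector of a shell is the difference of two scaled copies of the same solid cone,
  hence its volume is known exactly.\<close>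

lemma measure_shell_cone:
  fixes B :: "'a::euclidean_space set" and p :: 'a
  assumes B: "B \<in> sets borel" and r: "0 < r" and h: "0 < h"
  defines "S \<equiv> {x. r < dist p x \<and> dist p x \<le> r + h \<and> sgn (x - p) \<in> B}"
  shows "S \<in> sets borel" "measure lborel S = ((r + h) ^ DIM('a) - r ^ DIM('a)) * measure lborel (cone_over B)"
proof -
  define Q where "Q R = {x. 0 < dist p x \<and> dist p x \<le> R \<and> sgn (x - p) \<in> B}" for R
  have Q: "Q R \<in> sets borel" "emeasure lborel (Q R) = ennreal (R ^ DIM('a)) * emeasure lborel (cone_over B)"
    if "0 < R" for R
    using emeasure_cone_scaled[OF B that, where p = p] by (simp_all add: Q_def)
  have m: "measure lborel (Q R) = R ^ DIM('a) * measure lborel (cone_over B)" if "0 < R" for R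
    using Q(2)[OF that] that by (simp add: measure_def enn2real_mult)
  have fin: "emeasure lborel (Q R) \<noteq> \<infinity>" if "0 < R" for R
    using Q(2)[OF that] cone_over_finite[of B] by (simp add: ennreal_mult_eq_top_iff)
  have S_eq: "S = Q (r + h) - Q r" using r by (auto simp: S_def Q_def)
  show "S \<in> sets borel" unfolding S_eq using Q r h by (intro sets.Diff) auto
  have "Q r \<subseteq> Q (r + h)" using h by (auto simp: Q_def)
  then have "measure lborel S = measure lborel (Q (r + h)) - measure lborel (Q r)"
    unfolding S_eq using Q(1) fin r h by (intro measure_Diff) auto
  then show "measure lborel S = ((r + h) ^ DIM('a) - r ^ DIM('a)) * measure lborel (cone_over B)"
    using m r h by (simp add: left_diff_distrib)
qed

text \<open>The sector over \<open>A\<close> need not contain the part of \<open>C\<close> in a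
  shell, because \<open>C\<close> may bend away from the radial direction. It is replaced by the
  sectors over slightly larger sets of directions, whose cone volumes decrease to that of
  \<open>A\<close>.\<close>

lemma measure_closed_shell_le:
  fixes C :: "'a::euclidean_space set" and p :: 'a
  assumes C: "closed C" and r: "0 < r" and e: "0 < e"
  defines "A \<equiv> {u \<in> sphere 0 1. p + r *\<^sub>R u \<in> C}"
  shows "\<forall>\<^sub>F h in at_right 0. measure lborel (C \<inter> (cball p (r + h) - cball p r))
    \<le> ((r + h) ^ DIM('a) - r ^ DIM('a)) * (measure lborel (cone_over A) + e)"
proof -
  \<comment> \<open>\<open>B k\<close> collects the directions whose ray meets \<open>C\<close> at
    some radius between r and r + 1 / (k + 1). It is the projection of a compact set, and closedness
    of \<open>C\<close> makes the intersection over all \<open>k\<close> equal to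
    \<open>A\<close>.\<close>
  define B where "B k = {u \<in> sphere 0 1. \<exists>\<rho>\<in>{r..r + 1 / real (Suc k)}. p + \<rho> *\<^sub>R u \<in> C}" for k
  have B_compact: "compact (B k)" for k
  proof -
    let ?K = "(sphere (0::'a) 1 \<times> {r..r + 1 / real (Suc k)}) \<inter> (\<lambda>z. p + snd z *\<^sub>R fst z) -` C"
    have "closed ((\<lambda>z. p + snd z *\<^sub>R fst z) -` C)"
      using C by (intro closed_vimage continuous_intros) auto
    then have "compact ?K" by (intro compact_Int_closed compact_Times) auto
    then have "compact (fst ` ?K)"
      by (intro compact_continuous_image) (auto intro!: continuous_intros)
    moreover have "fst ` ?K = B k" unfolding B_def by force
    ultimately show ?thesis by simp
  qed
  then have B_borel: "B k \<in> sets borel" for k by (simp add: borel_closed compact_imp_closed)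
  have B_anti: "B k \<subseteq> B j" if "j \<le> k" for j k
  proof -
    have "1 / real (Suc k) \<le> 1 / real (Suc j)" using that by (simp add: frac_le)
    then show ?thesis unfolding B_def by fastforce
  qed
  have B_Inter: "(\<Inter>k. B k) = A"
  proof
    show "A \<subseteq> (\<Inter>k. B k)" unfolding A_def B_def by force
    show "(\<Inter>k. B k) \<subseteq> A"
    proof
      fix u assume u: "u \<in> (\<Inter>k. B k)"
      then have "\<forall>k. \<exists>\<rho>. \<rho> \<in> {r..r + 1 / real (Suc k)} \<and> p + \<rho> *\<^sub>R u \<in> C" unfolding B_def by blast
      then obtain \<rho> where \<rho>: "\<And>k. \<rho> k \<in> {r..r + 1 / real (Suc k)}" "\<And>k. p + \<rho> k *\<^sub>R u \<in> C" by metis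
      have "\<rho> \<longlonglongrightarrow> r"
      proof (rule tendsto_sandwich[of "\<lambda>_. r" \<rho> sequentially "\<lambda>k. r + 1 / real (Suc k)"])
        show "(\<lambda>k. r + 1 / real (Suc k)) \<longlonglongrightarrow> r"
          using tendsto_add[OF tendsto_const[of r] LIMSEQ_inverse_real_of_nat] by (simp add: inverse_eq_divide)
      qed (use \<rho>(1) in auto)
      then have "(\<lambda>k. p + \<rho> k *\<^sub>R u) \<longlonglongrightarrow> p + r *\<^sub>R u" by (intro tendsto_intros)
      then have "p + r *\<^sub>R u \<in> C" using C \<rho>(2) by (rule closed_sequentially[rotated 2])
      moreover have "u \<in> sphere 0 1" using u unfolding B_def by blast
      ultimately show "u \<in> A" by (simp add: A_def)
    qed
  qed
  have "(\<lambda>k. measure lborel (cone_over (B k))) \<longlonglongrightarrow> measure lborel (\<Inter>k. cone_over (B k))"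
  proof (rule Lim_measure_decseq)
    show "range (\<lambda>k. cone_over (B k)) \<subseteq> sets lborel" using B_borel by auto
    show "decseq (\<lambda>k. cone_over (B k))" unfolding decseq_def cone_over_def using B_anti by blast
    show "emeasure lborel (cone_over (B k)) \<noteq> \<infinity>" for k using cone_over_finite[of "B k"] by simp
  qed
  moreover have "(\<Inter>k. cone_over (B k)) = cone_over A"
    unfolding B_Inter[symmetric] by (auto simp: cone_over_def)
  ultimately have "(\<lambda>k. measure lborel (cone_over (B k))) \<longlonglongrightarrow> measure lborel (cone_over A)" by simp
  then have "\<forall>\<^sub>F k in sequentially. measure lborel (cone_over (B k)) < measure lborel (cone_over A) + e"
    using e by (intro order_tendstoD) auto
  then obtain k where k: "measure lborel (cone_over (B k)) < measure lborel (cone_over A) + e"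
    using eventually_happens' sequentially_bot by blast
  have "\<forall>\<^sub>F h in at_right 0. 0 < h \<and> h < 1 / real (Suc k)"
    unfolding eventually_at_right_field by (intro exI[of _ "1 / real (Suc k)"]) auto
  then show ?thesis
  proof eventually_elim
    case (elim h)
    let ?S = "{x. r < dist p x \<and> dist p x \<le> r + h \<and> sgn (x - p) \<in> B k}"
    have sub: "C \<inter> (cball p (r + h) - cball p r) \<subseteq> ?S"
    proof
      fix x assume x: "x \<in> C \<inter> (cball p (r + h) - cball p r)"
      have n: "norm (x - p) = dist p x" by (simp add: dist_norm norm_minus_commute)
      have "p + dist p x *\<^sub>R sgn (x - p) = x"
      proof -
        have "dist p x \<noteq> 0" using x r by auto
        then show ?thesis by (simp add: sgn_div_norm n)
      qed
      moreover have "x \<noteq> p" using x r by auto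
      moreover have "dist p x \<in> {r..r + 1 / real (Suc k)}" using x elim by auto
      ultimately have "sgn (x - p) \<in> B k"
        using x unfolding B_def by (auto simp: norm_sgn intro!: bexI[of _ "dist p x"])
      then show "x \<in> ?S" using x by auto
    qed
    have S: "?S \<in> sets borel" "measure lborel ?S = ((r + h) ^ DIM('a) - r ^ DIM('a)) * measure lborel (cone_over (B k))"
      by (rule measure_shell_cone[OF B_borel[of k] r conjunct1[OF elim]])+
    have "emeasure lborel ?S < \<infinity>" by (rule emeasure_bounded_finite[of _ p "r + h"]) auto
    then have "?S \<in> fmeasurable lborel" using S(1) by (simp add: fmeasurable_def)
    then have "measure lborel (C \<inter> (cball p (r + h) - cball p r)) \<le> measure lborel ?S"
      using sub C by (intro measure_mono_fmeasurable) auto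
    also have "\<dots> \<le> ((r + h) ^ DIM('a) - r ^ DIM('a)) * (measure lborel (cone_over A) + e)"
      unfolding S(2) using k r elim by (intro mult_left_mono) (auto intro!: power_mono)
    finally show ?case .
  qed
qed

text \<open>
  Only upper bounds are needed: the lower bound for \<open>C\<close> is the upper bound for the complementary
  set \<open>D\<close>, because the measures of the whole shell are known exactly.
\<close>

lemma shell_measure_limit:
  fixes C D :: "'a::euclidean_space set" and p :: 'a
  assumes CD: "closed C" "closed D" "C \<union> D = UNIV" and r: "0 < r"
  defines "A \<equiv> (\<lambda>C. {u \<in> sphere 0 1. p + r *\<^sub>R u \<in> C})"
  assumes null: "emeasure lborel (C \<inter> D) = 0" "emeasure lborel (cone_over (A (C \<inter> D))) = 0"
  shows "((\<lambda>h. measure lborel (C \<inter> (cball p (r + h) - cball p r)) / h)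
    \<longlongrightarrow> real DIM('a) * r ^ (DIM('a) - 1) * measure lborel (cone_over (A C))) (at_right 0)"
proof -
  define m where "m X = measure lborel (cone_over (A X))" for X
  define f where "f X h = measure lborel (X \<inter> (cball p (r + h) - cball p r))" for X h
  define T where "T h = (r + h) ^ DIM('a) - r ^ DIM('a)" for h
  have A_closed: "closed (A X)" if "closed X" for X
    unfolding A_def using that by (rule closed_directions)
  have cone_meas: "cone_over (A X) \<in> fmeasurable lborel" if "closed X" for X
    using A_closed[OF that] cone_over_finite[of "A X"] by (simp add: fmeasurable_def borel_closed)
  have shell_meas: "X \<inter> (cball p (r + h) - cball p r) \<in> fmeasurable lborel" if "closed X" for X h
    using that emeasure_bounded_finite[of "X \<inter> (cball p (r + h) - cball p r)" p "r + h"]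
    by (auto simp: fmeasurable_def)
  have split: "measure lborel (X \<union> Y) = measure lborel X + measure lborel Y"
    if "X \<in> fmeasurable lborel" "Y \<in> fmeasurable lborel" "emeasure lborel (X \<inter> Y) = 0" for X Y :: "'a set"
  proof -
    have "measure lborel (X \<inter> Y) = 0" using that(3) by (simp add: measure_def)
    then show ?thesis using measure_Un3[OF that(1,2)] by simp
  qed
  have f_sum: "f C h + f D h = f UNIV h" for h
  proof -
    let ?S = "cball p (r + h) - cball p r"
    have "emeasure lborel (C \<inter> ?S \<inter> (D \<inter> ?S)) \<le> emeasure lborel (C \<inter> D)"
      using CD by (intro emeasure_mono) (auto simp: borel_closed)
    then have "emeasure lborel (C \<inter> ?S \<inter> (D \<inter> ?S)) = 0" using null(1) by simp
    then have "measure lborel (C \<inter> ?S \<union> D \<inter> ?S) = f C h + f D h"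
      unfolding f_def using CD by (intro split shell_meas)
    moreover have "C \<inter> ?S \<union> D \<inter> ?S = UNIV \<inter> ?S" using CD(3) by blast
    ultimately show ?thesis by (simp add: f_def)
  qed
  have m_sum: "m C + m D = m UNIV"
  proof -
    have "cone_over (A C) \<inter> cone_over (A D) = cone_over (A (C \<inter> D))"
      by (auto simp: cone_over_def A_def)
    then have "measure lborel (cone_over (A C) \<union> cone_over (A D)) = m C + m D"
      unfolding m_def using null(2) CD by (intro split cone_meas) auto
    moreover have "cone_over (A C) \<union> cone_over (A D) = cone_over (A UNIV)"
      unfolding CD(3)[symmetric] by (auto simp: cone_over_def A_def)
    ultimately show ?thesis by (simp add: m_def)
  qed
  have f_UNIV: "f UNIV h = T h * m UNIV" if "0 < h" for h
  proof -
    have "A UNIV = sphere 0 1" by (auto simp: A_def)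
    moreover have "{x. r < dist p x \<and> dist p x \<le> r + h \<and> sgn (x - p) \<in> sphere 0 1} = UNIV \<inter> (cball p (r + h) - cball p r)"
      using r by (auto simp: norm_sgn)
    ultimately show ?thesis
      using measure_shell_cone(2)[where B = "sphere 0 1" and p = p and r = r and h = h] r that by (simp add: f_def T_def m_def)
  qed
  have T_pos: "0 < T h" if "0 < h" for h using r that by (simp add: T_def power_strict_mono)
  have lim: "((\<lambda>h. f C h / T h) \<longlongrightarrow> m C) (at_right 0)"
  proof (rule tendstoI)
    fix e :: real assume e: "0 < e"
    have up: "\<forall>\<^sub>F h in at_right 0. f X h \<le> T h * (m X + e / 2)" if "closed X" for X
      using measure_closed_shell_le[OF that r, where p = p and e = "e / 2"] e by (simp add: f_def T_def m_def A_def)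
    show "\<forall>\<^sub>F h in at_right 0. dist (f C h / T h) (m C) < e"
      using up[OF CD(1)] up[OF CD(2)] eventually_at_right_less[of 0]
    proof eventually_elim
      case (elim h)
      have "f C h = T h * (m C + m D) - f D h" using f_sum[of h] f_UNIV[of h] m_sum elim by simp
      then have "T h * (m C - e / 2) \<le> f C h" using elim(2) by (simp add: algebra_simps)
      then have "m C - e / 2 \<le> f C h / T h" "f C h / T h \<le> m C + e / 2"
        using elim(1) T_pos[OF elim(3)] by (simp_all add: field_simps)
      then show ?case using e by (simp add: dist_real_def abs_if)
    qed
  qed
  have "((\<lambda>h. T h / h) \<longlongrightarrow> real DIM('a) * r ^ (DIM('a) - 1)) (at_right 0)"
  proof -
    have "((\<lambda>x. x ^ DIM('a)) has_real_derivative real DIM('a) * r ^ (DIM('a) - Suc 0)) (at r)"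
      by (rule DERIV_pow)
    then show ?thesis unfolding T_def DERIV_def by (rule filterlim_mono) (auto simp: at_le)
  qed
  then have "((\<lambda>h. T h / h * (f C h / T h)) \<longlongrightarrow> real DIM('a) * r ^ (DIM('a) - 1) * m C) (at_right 0)"
    using lim by (rule tendsto_mult)
  moreover have "\<forall>\<^sub>F h in at_right 0. T h / h * (f C h / T h) = f C h / h"
    using eventually_at_right_less[of "0::real"] by eventually_elim (use T_pos in force)
  ultimately show ?thesis unfolding m_def f_def by (rule Lim_transform_eventually)
qed

section \<open>Null sets arising from hyperplane sections of spheres\<close>

text \<open>For c > 0 the set lies in the frontier of the convex cone given by c |x| \<le> w . x,
  and frontiers of convex sets are negligible. Negative \<open>c\<close> is reduced to this by
  changing signs, and c = 0 gives a hyperplane.\<close>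

lemma negligible_circular_cone:
  fixes v :: "'a::euclidean_space"
  assumes dim: "2 \<le> DIM('a)" and v: "v \<noteq> 0"
  shows "negligible {x. v \<bullet> x = c * norm x}"
proof -
  have main: "negligible {x. w \<bullet> x = c * norm x}" if c: "0 < c" for c :: real and w :: 'a
  proof -
    let ?K = "{x. c * norm x \<le> w \<bullet> x}"
    have cont: "continuous_on UNIV (\<lambda>x. c * norm x)" "continuous_on UNIV (\<lambda>x. w \<bullet> x)"
      by (intro continuous_intros)+
    have "convex ?K"
    proof (rule convexI)
      fix x y :: 'a and s t :: real
      assume xy: "x \<in> ?K" "y \<in> ?K" and st: "0 \<le> s" "0 \<le> t" "s + t = 1"
      have "c * norm (s *\<^sub>R x + t *\<^sub>R y) \<le> c * (s * norm x + t * norm y)"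
        using c st by (intro mult_left_mono norm_triangle_le) auto
      also have "\<dots> = s * (c * norm x) + t * (c * norm y)" by (simp add: algebra_simps)
      also have "\<dots> \<le> s * (w \<bullet> x) + t * (w \<bullet> y)" using xy st by (intro add_mono mult_left_mono) auto
      finally show "s *\<^sub>R x + t *\<^sub>R y \<in> ?K" by (simp add: inner_add_right)
    qed
    then have "negligible (frontier ?K)" by (rule negligible_convex_frontier)
    moreover have "{x. w \<bullet> x = c * norm x} \<subseteq> frontier ?K"
    proof
      fix x assume "x \<in> {x. w \<bullet> x = c * norm x}"
      then have x: "w \<bullet> x = c * norm x" by simp
      have "x \<notin> interior ?K"
      proof
        assume "x \<in> interior ?K"
        then obtain \<epsilon> where \<epsilon>: "0 < \<epsilon>" "cball x \<epsilon> \<subseteq> ?K" using mem_interior_cball by blast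
        \<comment> \<open>A step orthogonal to \<open>x\<close>, available in dimension at least 2.
          If x + z and x - z both lay in the cone, their norms would add up to at most 2 |x|; by
          Pythagoras each exceeds |x|.\<close>
        obtain z where z: "norm z = \<epsilon>" "x \<bullet> z = 0"
        proof -
          obtain y where "y \<noteq> 0" "orthogonal x y" using orthogonal_to_vector_exists[OF dim] by blast
          then show thesis
            using \<epsilon>(1) by (intro that[of "(\<epsilon> / norm y) *\<^sub>R y"]) (auto simp: orthogonal_def)
        qed
        have "x + z \<in> ?K" "x - z \<in> ?K" using \<epsilon>(2) z(1) by (auto simp: subset_iff dist_norm)
        then have "c * (norm (x + z) + norm (x - z)) \<le> 2 * (w \<bullet> x)"
          by (simp add: inner_add_right inner_diff_right algebra_simps)
        also have "\<dots> = c * (2 * norm x)" by (simp add: x)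
        finally have le: "norm (x + z) + norm (x - z) \<le> 2 * norm x"
          using c by (simp only: mult_le_cancel_left_pos)
        have "(norm (x + z))\<^sup>2 = (norm x)\<^sup>2 + \<epsilon>\<^sup>2" "(norm (x - z))\<^sup>2 = (norm x)\<^sup>2 + \<epsilon>\<^sup>2"
          unfolding z(1)[symmetric]
          by (simp_all add: power2_norm_eq_inner inner_add inner_diff inner_commute[of z x] z(2))
        moreover have "norm x < norm y" if "(norm y)\<^sup>2 = (norm x)\<^sup>2 + \<epsilon>\<^sup>2" for y
          by (rule power2_less_imp_less) (use that \<epsilon>(1) in simp_all)
        ultimately have "norm x < norm (x + z)" "norm x < norm (x - z)" by blast+
        then show False using le by linarith
      qed
      moreover have "x \<in> closure ?K" using x by (intro subsetD[OF closure_subset]) simp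
      ultimately show "x \<in> frontier ?K" by (simp add: frontier_def)
    qed
    ultimately show ?thesis by (rule negligible_subset)
  qed
  consider "0 < c" | "c = 0" | "c < 0" by linarith
  then show ?thesis
  proof cases
    case 1 then show ?thesis by (rule main)
  next
    case 2 then show ?thesis using negligible_hyperplane[of v 0] v by simp
  next
    case 3
    have "{x. v \<bullet> x = c * norm x} = {x. (- v) \<bullet> x = (- c) * norm x}" by auto
    then show ?thesis using main[of "- c" "- v"] 3 by simp
  qed
qed

lemma negligible_imp_emeasure_lborel:
  "negligible S \<Longrightarrow> S \<in> sets borel \<Longrightarrow> emeasure lborel S = 0"
  by (simp add: negligible_iff_null_sets null_sets_def)

text \<open>Multiplying the equation of a hyperplane at the point of direction x / |x| by |x| shows
  that the solid cone over the section lies on a circular cone.\<close>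

lemma cone_over_hyperplane_null:
  fixes a :: "'j \<Rightarrow> 'a::euclidean_space" and b :: "'j \<Rightarrow> real" and p :: 'a
  assumes dim: "2 \<le> DIM('a)" and r: "0 < r" and "finite J" and a: "\<And>j. j \<in> J \<Longrightarrow> a j \<noteq> 0"
    and sub: "A \<subseteq> {u \<in> sphere 0 1. \<exists>j\<in>J. a j \<bullet> (p + r *\<^sub>R u) = b j}" and A: "A \<in> sets borel"
  shows "emeasure lborel (cone_over A) = 0"
proof -
  have "cone_over A \<subseteq> (\<Union>j\<in>J. {x. a j \<bullet> x = ((b j - a j \<bullet> p) / r) * norm x})"
  proof
    fix x assume x: "x \<in> cone_over A"
    then obtain j where "j \<in> J" "a j \<bullet> (p + r *\<^sub>R sgn x) = b j" "0 < norm x"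
      using sub by (auto simp: cone_over_def)
    then show "x \<in> (\<Union>j\<in>J. {x. a j \<bullet> x = ((b j - a j \<bullet> p) / r) * norm x})"
      using r by (auto simp: inner_add_right sgn_div_norm field_simps)
  qed
  moreover have "negligible (\<Union>j\<in>J. {x. a j \<bullet> x = ((b j - a j \<bullet> p) / r) * norm x})"
    by (intro negligible_Union finite_imageI \<open>finite J\<close>)
      (erule imageE, simp only: negligible_circular_cone[OF dim a])
  ultimately show ?thesis
    using A by (intro negligible_imp_emeasure_lborel) (auto intro: negligible_subset)
qed

lemma hausdorff_measure_sphere_hyperplanes:
  fixes a :: "'j \<Rightarrow> 'a::euclidean_space" and b :: "'j \<Rightarrow> real" and p :: 'a
  assumes dim: "2 \<le> DIM('a)" and r: "0 < r" and J: "finite J" "\<And>j. j \<in> J \<Longrightarrow> a j \<noteq> 0"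
  shows "hausdorff_measure (DIM('a) - 1) (sphere p r \<inter> {x. \<exists>j\<in>J. a j \<bullet> x = b j}) = 0"
proof -
  let ?P = "{x. \<exists>j\<in>J. a j \<bullet> x = b j}"
  have cl: "closed ?P"
  proof -
    have "?P = (\<Union>j\<in>J. {x. a j \<bullet> x = b j})" by auto
    then show ?thesis using J(1) by (simp add: closed_UN closed_hyperplane)
  qed
  let ?A = "{u \<in> sphere 0 1. p + r *\<^sub>R u \<in> ?P}"
  have "closed ?A" using cl by (rule closed_directions)
  then have "emeasure lborel (cone_over ?A) = 0"
    using cone_over_hyperplane_null[OF dim r J, where A = ?A and p = p and b = b] by (simp add: borel_closed)
  then show ?thesis unfolding hausdorff_measure_sphere[OF dim r cl] sphere_measure_def by simp
qed

text \<open>The substitution h = sqrt (r^2 + s) - r turns growth in s into thickness of a shell, and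
  h / s tends to 1 / (2 r). This is the source of the factor 1/2 and of the division by the
  radius.\<close>

lemma polyhedron_ball_derivative:
  fixes a :: "'j \<Rightarrow> 'a::euclidean_space" and b :: "'j \<Rightarrow> real" and p :: 'a
  assumes dim: "2 \<le> DIM('a)" and r: "0 < r" and J: "finite J" "\<And>j. j \<in> J \<Longrightarrow> a j \<noteq> 0"
  defines "C \<equiv> {x. \<forall>j\<in>J. a j \<bullet> x \<le> b j}"
  shows "((\<lambda>s. measure lborel (C \<inter> cball p (sqrt (r\<^sup>2 + s)))) has_real_derivative
    1/2 * (surface_volume (sphere p r \<inter> C) / r)) (at 0 within {0..})"
proof -
  let ?n = "DIM('a)"
  \<comment> \<open>The closed set complementary to \<open>C\<close> up to the bounding hyperplanes,
    as \<open>shell_measure_limit\<close> requires.\<close>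
  define D where "D = {x. \<exists>j\<in>J. b j \<le> a j \<bullet> x}"
  define A where "A = (\<lambda>C. {u \<in> sphere (0::'a) 1. p + r *\<^sub>R u \<in> C})"
  have C: "closed C"
  proof -
    have "C = (\<Inter>j\<in>J. {x. a j \<bullet> x \<le> b j})" by (auto simp: C_def)
    then show ?thesis by (auto intro!: closed_INT closed_halfspace_le)
  qed
  have D: "closed D"
  proof -
    have "D = (\<Union>j\<in>J. {x. a j \<bullet> x \<ge> b j})" by (auto simp: D_def)
    then show ?thesis using J(1) by (auto intro!: closed_UN closed_halfspace_ge)
  qed
  have CD: "C \<union> D = UNIV" by (auto simp: C_def D_def not_le intro: less_imp_le)
  have CD_sub: "C \<inter> D \<subseteq> {x. \<exists>j\<in>J. a j \<bullet> x = b j}" by (force simp: C_def D_def)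
  have null: "emeasure lborel (C \<inter> D) = 0"
  proof (rule negligible_imp_emeasure_lborel)
    have "negligible (\<Union>j\<in>J. {x. a j \<bullet> x = b j})"
      using J by (intro negligible_Union finite_imageI) (auto intro!: negligible_hyperplane)
    then show "negligible (C \<inter> D)" by (rule negligible_subset) (use CD_sub in auto)
    show "C \<inter> D \<in> sets borel" using C D by (simp add: borel_closed closed_Int)
  qed
  have A_closed: "closed (A X)" if "closed X" for X
    unfolding A_def using that by (rule closed_directions)
  have null_A: "emeasure lborel (cone_over (A (C \<inter> D))) = 0"
  proof (rule cone_over_hyperplane_null[OF dim r J])
    show "A (C \<inter> D) \<subseteq> {u \<in> sphere 0 1. \<exists>j\<in>J. a j \<bullet> (p + r *\<^sub>R u) = b j}"
      using CD_sub by (auto simp: A_def)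
    show "A (C \<inter> D) \<in> sets borel" using C D by (simp add: borel_closed closed_Int A_closed)
  qed
  define m where "m = measure lborel (cone_over (A C))"
  have lim: "((\<lambda>h. measure lborel (C \<inter> (cball p (r + h) - cball p r)) / h)
    \<longlongrightarrow> real ?n * r ^ (?n - 1) * m) (at_right 0)"
    unfolding m_def A_def by (rule shell_measure_limit[OF C D CD r null null_A[unfolded A_def]])
  have surf: "surface_volume (sphere p r \<inter> C) = real ?n * r ^ (?n - 1) * m"
    unfolding surface_volume_def hausdorff_measure_sphere[OF dim r C] sphere_measure_def m_def A_def measure_def
    using r by (simp add: enn2real_mult ennreal_of_nat_eq_real_of_nat)
  define \<eta> where "\<eta> s = sqrt (r\<^sup>2 + s) - r" for s
  have \<eta>_lim: "((\<lambda>s. \<eta> s / s) \<longlongrightarrow> 1 / (2 * r)) (at_right 0)"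
  proof -
    have "((\<lambda>s. sqrt (r\<^sup>2 + s)) has_real_derivative inverse (sqrt (r\<^sup>2 + 0)) / 2 * 1) (at 0)"
      by (rule DERIV_chain2[OF DERIV_real_sqrt]) (use r in \<open>auto intro!: derivative_eq_intros\<close>)
    then have "((\<lambda>s. (sqrt (r\<^sup>2 + (0 + s)) - sqrt (r\<^sup>2 + 0)) / s) \<longlongrightarrow> inverse (sqrt (r\<^sup>2 + 0)) / 2 * 1) (at_right 0)"
      unfolding DERIV_def by (rule tendsto_mono[OF at_le[OF subset_UNIV]])
    moreover have "inverse (sqrt (r\<^sup>2 + 0)) / 2 * 1 = 1 / (2 * r)" "sqrt (r\<^sup>2 + 0) = r"
      using r by (simp_all add: inverse_eq_divide)
    ultimately show ?thesis by (simp only: \<eta>_def add_0_left)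
  qed
  have \<eta>_pos: "0 < \<eta> s" if "0 < s" for s
    using r that real_less_rsqrt[of r "r\<^sup>2 + s"] by (simp add: \<eta>_def)
  have "filterlim \<eta> (at_right 0) (at_right 0)"
  proof (rule tendsto_imp_filterlim_at_right)
    have "isCont \<eta> 0" unfolding \<eta>_def by (intro continuous_intros)
    then show "(\<eta> \<longlongrightarrow> 0) (at_right 0)"
      using r unfolding isCont_def by (intro tendsto_mono[OF at_le, of "{0<..}" UNIV]) (auto simp: \<eta>_def)
    show "\<forall>\<^sub>F s in at_right 0. 0 < \<eta> s"
      using eventually_at_right_less[of "0::real"] by eventually_elim (rule \<eta>_pos)
  qed
  then have "((\<lambda>s. measure lborel (C \<inter> (cball p (r + \<eta> s) - cball p r)) / \<eta> s)
    \<longlongrightarrow> real ?n * r ^ (?n - 1) * m) (at_right 0)"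
    by (rule filterlim_compose[OF lim])
  from tendsto_mult[OF this \<eta>_lim]
  have lim2: "((\<lambda>s. measure lborel (C \<inter> (cball p (r + \<eta> s) - cball p r)) / \<eta> s * (\<eta> s / s))
    \<longlongrightarrow> 1/2 * (surface_volume (sphere p r \<inter> C) / r)) (at_right 0)"
    by (simp add: surf)
  have "((\<lambda>s. (measure lborel (C \<inter> cball p (sqrt (r\<^sup>2 + s))) - measure lborel (C \<inter> cball p (sqrt (r\<^sup>2 + 0)))) / (s - 0))
    \<longlongrightarrow> 1/2 * (surface_volume (sphere p r \<inter> C) / r)) (at_right 0)"
  proof (rule Lim_transform_eventually[OF lim2])
    show "\<forall>\<^sub>F s in at_right 0. measure lborel (C \<inter> (cball p (r + \<eta> s) - cball p r)) / \<eta> s * (\<eta> s / s)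
      = (measure lborel (C \<inter> cball p (sqrt (r\<^sup>2 + s))) - measure lborel (C \<inter> cball p (sqrt (r\<^sup>2 + 0)))) / (s - 0)"
      using eventually_at_right_less[of "0::real"]
    proof eventually_elim
      case (elim s)
      have fin: "emeasure lborel (C \<inter> cball p R) \<noteq> \<infinity>" for R
        using emeasure_bounded_finite[of "C \<inter> cball p R" p R] by simp
      have "C \<inter> (cball p (r + \<eta> s) - cball p r) = (C \<inter> cball p (r + \<eta> s)) - (C \<inter> cball p r)" by auto
      moreover have "measure lborel ((C \<inter> cball p (r + \<eta> s)) - (C \<inter> cball p r))
          = measure lborel (C \<inter> cball p (r + \<eta> s)) - measure lborel (C \<inter> cball p r)"
        using \<eta>_pos[OF elim] C by (intro measure_Diff fin) (auto simp: borel_closed)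
      moreover have "r + \<eta> s = sqrt (r\<^sup>2 + s)" by (simp add: \<eta>_def)
      ultimately show ?case using \<eta>_pos[OF elim] r by simp
    qed
  qed
  then show ?thesis unfolding has_field_derivative_iff at_within_Ici_at_right .
qed

section \<open>Derivative of the volume\<close>

text \<open>The power of a point with respect to a sphere. The cells compare powers, and for s \<ge>
  0 the ball of radius sqrt (r_i^2 + s) is the set where the power is at most
  \<open>s\<close>.\<close>

definition power_dist :: "(nat \<Rightarrow> 'a::euclidean_space) \<Rightarrow> (nat \<Rightarrow> real) \<Rightarrow> nat \<Rightarrow> 'a \<Rightarrow> real" where
  "power_dist p r i x = (dist x (p i))\<^sup>2 - (r i)\<^sup>2"

lemma mem_cball_shifted:
  assumes "0 \<le> s"
  shows "x \<in> cball (p i) (shifted_radii r s i) \<longleftrightarrow> power_dist p r i x \<le> s"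
proof -
  have "dist x (p i) \<le> sqrt ((r i)\<^sup>2 + s) \<longleftrightarrow> (dist x (p i))\<^sup>2 \<le> (r i)\<^sup>2 + s"
    using assms by (metis abs_of_nonneg real_sqrt_abs real_sqrt_le_iff zero_le_dist)
  then show ?thesis by (auto simp: shifted_radii_def power_dist_def dist_commute)
qed

text \<open>The term x . x cancels when two powers are compared, so each condition is a
  half-space.\<close>

lemma nearest_cell_polyhedron:
  "nearest_cell N p r i = {x. \<forall>j\<in>{1..N} - {i}. (2 *\<^sub>R (p j - p i)) \<bullet> x
    \<le> (p j \<bullet> p j - (r j)\<^sup>2) - (p i \<bullet> p i - (r i)\<^sup>2)}"
  unfolding nearest_cell_def
  by (simp add: dist_norm power2_norm_eq_inner inner_diff inner_commute algebra_simps)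

lemma farthest_cell_polyhedron:
  "farthest_cell N p r i = {x. \<forall>j\<in>{1..N} - {i}. (2 *\<^sub>R (p i - p j)) \<bullet> x
    \<le> (p i \<bullet> p i - (r i)\<^sup>2) - (p j \<bullet> p j - (r j)\<^sup>2)}"
  unfolding farthest_cell_def
  by (simp add: dist_norm power2_norm_eq_inner inner_diff inner_commute algebra_simps)

lemma power_dist_eq_hyperplane:
  "power_dist p r i x = power_dist p r j x \<longleftrightarrow>
    (2 *\<^sub>R (p j - p i)) \<bullet> x = (p j \<bullet> p j - (r j)\<^sup>2) - (p i \<bullet> p i - (r i)\<^sup>2)"
  unfolding power_dist_def
  by (simp add: dist_norm power2_norm_eq_inner inner_diff inner_commute algebra_simps)

lemma sum_cells_derivative:
  fixes p :: "nat \<Rightarrow> 'a::euclidean_space" and N :: nat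
  assumes X: "\<And>s. 0 \<le> s \<Longrightarrow> X s = (\<Union>i\<in>{1..N}. C i \<inter> cball (p i) (shifted_radii r s i))"
    and C: "\<And>i. i \<in> {1..N} \<Longrightarrow> closed (C i)"
    and null: "\<And>i j. i \<in> {1..N} \<Longrightarrow> j \<in> {1..N} \<Longrightarrow> i \<noteq> j \<Longrightarrow> negligible (C i \<inter> C j)"
    and deriv: "\<And>i. i \<in> {1..N} \<Longrightarrow> ((\<lambda>s. measure lborel (C i \<inter> cball (p i) (sqrt ((r i)\<^sup>2 + s))))
      has_real_derivative 1/2 * (K i / r i)) (at 0 within {0..})"
  shows "((\<lambda>s. measure lebesgue (X s)) has_real_derivative 1/2 * (\<Sum>i=1..N. K i / r i)) (at 0 within {0..})"
proof -
  have eq: "(\<Sum>i=1..N. measure lborel (C i \<inter> cball (p i) (sqrt ((r i)\<^sup>2 + s)))) = measure lebesgue (X s)"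
    if "0 \<le> s" for s
  proof -
    let ?f = "\<lambda>i. C i \<inter> cball (p i) (sqrt ((r i)\<^sup>2 + s))"
    have cl: "compact (?f i)" if "i \<in> {1..N}" for i
      using C[OF that] by (simp add: closed_Int_compact)
    have "measure lebesgue (\<Union>(?f ` {1..N})) = (\<Sum>i=1..N. measure lebesgue (?f i))"
    proof (rule measure_negligible_finite_Union_image)
      show "?f i \<in> lmeasurable" if "i \<in> {1..N}" for i
        using cl[OF that] by (rule lmeasurable_compact)
      show "pairwise (\<lambda>i j. negligible (?f i \<inter> ?f j)) {1..N}"
      proof (rule pairwiseI)
        fix i j assume "i \<in> {1..N}" "j \<in> {1..N}" "i \<noteq> j"
        then show "negligible (?f i \<inter> ?f j)" by (rule negligible_subset[OF null]) blast
      qed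
    qed simp
    moreover have "measure lebesgue (?f i) = measure lborel (?f i)" if "i \<in> {1..N}" for i
      using cl[OF that] by (intro measure_completion) (simp add: borel_compact)
    ultimately show ?thesis using X[OF that] by (simp add: shifted_radii_def)
  qed
  have "((\<lambda>s. \<Sum>i=1..N. measure lborel (C i \<inter> cball (p i) (sqrt ((r i)\<^sup>2 + s)))) has_real_derivative
      (\<Sum>i=1..N. 1/2 * (K i / r i))) (at 0 within {0..})"
    by (intro DERIV_sum deriv)
  then have "((\<lambda>s. measure lebesgue (X s)) has_real_derivative (\<Sum>i=1..N. 1/2 * (K i / r i))) (at 0 within {0..})"
    by (rule has_field_derivative_transform_within[where d = 1]) (use eq in auto)
  then show ?thesis by (simp add: sum_distrib_left)
qed

text \<open>Hyperplane sections of a sphere have surface volume 0. This is needed for unions: a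
  point common to several spheres may be interior to the union, so a face can miss part of the
  sphere inside its cell.\<close>

lemma surface_volume_mod_hyperplanes:
  fixes a :: "'j \<Rightarrow> 'a::euclidean_space" and p :: 'a
  assumes dim: "2 \<le> DIM('a)" and r: "0 < r" and J: "finite J" "\<And>j. j \<in> J \<Longrightarrow> a j \<noteq> 0"
    and sub: "F \<subseteq> sphere p r \<inter> C" "sphere p r \<inter> C - F \<subseteq> {x. \<exists>j\<in>J. a j \<bullet> x = b j}"
  shows "surface_volume F = surface_volume (sphere p r \<inter> C)"
proof -
  let ?H = "hausdorff_measure (DIM('a) - 1)" and ?P = "{x. \<exists>j\<in>J. a j \<bullet> x = b j}"
  have "?H (sphere p r \<inter> C) \<le> ?H (F \<union> (sphere p r \<inter> ?P))"
    using sub by (intro hausdorff_measure_mono) auto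
  also have "\<dots> \<le> ?H F + ?H (sphere p r \<inter> ?P)" by (rule hausdorff_measure_Un)
  also have "\<dots> = ?H F" using hausdorff_measure_sphere_hyperplanes[OF dim r J] by simp
  finally have "?H F = ?H (sphere p r \<inter> C)"
    using hausdorff_measure_mono[OF sub(1)] by (simp add: antisym)
  then show ?thesis by (simp add: surface_volume_def)
qed

lemma sphere_boundary_approx:
  fixes p :: "'a::euclidean_space"
  assumes "0 < r" "x \<in> sphere p r" "open U" "x \<in> U"
  obtains y where "y \<in> U" "y \<notin> cball p r"
proof -
  have "x \<notin> interior (cball p r)" using assms by simp
  then show thesis using that assms(3,4) interior_maximal[of U "cball p r"] by blast
qed

context
  fixes N :: nat and p :: "nat \<Rightarrow> 'a::euclidean_space" and r :: "nat \<Rightarrow> real"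
  assumes dim: "2 \<le> DIM('a)" and radii: "\<And>i. i \<in> {1..N} \<Longrightarrow> 0 < r i" and inj: "inj_on p {1..N}"
begin

lemma centre_diff_nonzero: "i \<in> {1..N} \<Longrightarrow> j \<in> {1..N} - {i} \<Longrightarrow> 2 *\<^sub>R (p j - p i) \<noteq> 0 \<and> 2 *\<^sub>R (p i - p j) \<noteq> 0"
  using inj_onD[OF inj, of i j] by force

lemma negligible_equal_power:
  assumes "i \<in> {1..N}" "j \<in> {1..N}" "i \<noteq> j"
  shows "negligible {x. power_dist p r i x = power_dist p r j x}"
  unfolding power_dist_eq_hyperplane using centre_diff_nonzero[of i j] assms
  by (intro negligible_hyperplane) blast

lemma closed_power_le: "closed {x. power_dist p r i x \<le> power_dist p r j x}"
  unfolding power_dist_def by (intro closed_Collect_le continuous_intros)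

lemma nearest_cell_alt: "nearest_cell N p r i = {x. \<forall>j\<in>{1..N} - {i}. power_dist p r i x \<le> power_dist p r j x}"
  by (simp add: nearest_cell_def power_dist_def)

lemma farthest_cell_alt: "farthest_cell N p r i = {x. \<forall>j\<in>{1..N} - {i}. power_dist p r j x \<le> power_dist p r i x}"
  by (simp add: farthest_cell_def power_dist_def)

lemma closed_cells: "closed (nearest_cell N p r i)" "closed (farthest_cell N p r i)"
proof -
  have "nearest_cell N p r i = (\<Inter>j\<in>{1..N} - {i}. {x. power_dist p r i x \<le> power_dist p r j x})"
    "farthest_cell N p r i = (\<Inter>j\<in>{1..N} - {i}. {x. power_dist p r j x \<le> power_dist p r i x})"
    by (auto simp: nearest_cell_alt farthest_cell_alt)
  then show "closed (nearest_cell N p r i)" "closed (farthest_cell N p r i)"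
    by (auto intro!: closed_INT closed_power_le)
qed

lemma shifted_radii_0: "i \<in> {1..N} \<Longrightarrow> shifted_radii r 0 i = r i"
  using radii[of i] by (simp add: shifted_radii_def)

lemma mem_cball_power: "i \<in> {1..N} \<Longrightarrow> x \<in> cball (p i) (r i) \<longleftrightarrow> power_dist p r i x \<le> 0"
  using mem_cball_shifted[of 0 x p i r] by (simp add: shifted_radii_0 del: mem_cball)

lemma mem_sphere_power: "i \<in> {1..N} \<Longrightarrow> x \<in> sphere (p i) (r i) \<longleftrightarrow> power_dist p r i x = 0"
  using radii[of i] by (auto simp: power_dist_def dist_commute power2_eq_iff_nonneg)

lemma power_dist_open: "open {x. power_dist p r i x < c}" "open {x. c < power_dist p r i x}"
  unfolding power_dist_def by (intro open_Collect_less continuous_intros)+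

text \<open>An index of least power at x serves for every \<open>s\<close>: if any ball contains x,
  the one with that index does. For intersections, below, an index of greatest power plays the same
  part.\<close>

lemma ball_union_cells:
  assumes "1 \<le> N" "0 \<le> s"
  shows "ball_union N p (shifted_radii r s) = (\<Union>i\<in>{1..N}. nearest_cell N p r i \<inter> cball (p i) (shifted_radii r s i))" (is "?L = ?R")
proof
  show "?L \<subseteq> ?R"
  proof
    fix x assume "x \<in> ?L"
    then obtain j where j: "j \<in> {1..N}" "power_dist p r j x \<le> s"
      unfolding ball_union_def UN_iff mem_cball_shifted[OF assms(2)] by blast
    obtain i where i: "i \<in> {1..N}" "\<And>k. k \<in> {1..N} \<Longrightarrow> power_dist p r i x \<le> power_dist p r k x"
      using ex_is_arg_min_if_finite[of "{1..N}" "\<lambda>i. power_dist p r i x"] assms(1)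
      by (auto simp: is_arg_min_linorder)
    then have "x \<in> nearest_cell N p r i \<inter> cball (p i) (shifted_radii r s i)"
      using mem_cball_shifted[OF assms(2), of x p i r] i(2)[OF j(1)] j(2) by (simp add: nearest_cell_alt del: mem_cball)
    then show "x \<in> ?R"
      using i(1) by blast
  qed
qed (auto simp: ball_union_def)

lemma ball_inter_cells:
  assumes "1 \<le> N" "0 \<le> s"
  shows "ball_inter N p (shifted_radii r s) = (\<Union>i\<in>{1..N}. farthest_cell N p r i \<inter> cball (p i) (shifted_radii r s i))" (is "?L = ?R")
proof
  show "?L \<subseteq> ?R"
  proof
    fix x assume x: "x \<in> ?L"
    obtain i where i: "i \<in> {1..N}" "\<And>k. k \<in> {1..N} \<Longrightarrow> - power_dist p r i x \<le> - power_dist p r k x"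
      using ex_is_arg_min_if_finite[of "{1..N}" "\<lambda>i. - power_dist p r i x"] assms(1)
      by (auto simp: is_arg_min_linorder)
    then have "x \<in> farthest_cell N p r i \<inter> cball (p i) (shifted_radii r s i)"
      using x by (auto simp: farthest_cell_alt ball_inter_def simp del: mem_cball)
    then show "x \<in> ?R"
      using i(1) by blast
  qed
  show "?R \<subseteq> ?L"
  proof clarify
    fix x i assume x: "x \<in> farthest_cell N p r i" "x \<in> cball (p i) (shifted_radii r s i)" and i: "i \<in> {1..N}"
    then have "power_dist p r i x \<le> s" using mem_cball_shifted[OF assms(2)] by blast
    then have "power_dist p r j x \<le> s" if "j \<in> {1..N}" for j
      using x(1) that by (cases "j = i") (auto simp: farthest_cell_alt intro: order_trans)
    then show "x \<in> ?L"
      unfolding ball_inter_def INT_iff mem_cball_shifted[OF assms(2)] by blast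
  qed
qed

text \<open>A frontier point in the cell has power 0, since negative power would make it interior.
  Conversely, a point of the sphere in the cell where no other power vanishes is a frontier point;
  the exceptions lie on the bisecting hyperplanes.\<close>

lemma union_face_volume_eq:
  assumes i: "i \<in> {1..N}"
  shows "union_face_volume N p r i = surface_volume (sphere (p i) (r i) \<inter> nearest_cell N p r i)"
  unfolding union_face_volume_def
proof (rule surface_volume_mod_hyperplanes[OF dim radii[OF i], where J = "{1..N} - {i}"
      and a = "\<lambda>j. 2 *\<^sub>R (p j - p i)" and b = "\<lambda>j. (p j \<bullet> p j - (r j)\<^sup>2) - (p i \<bullet> p i - (r i)\<^sup>2)"])
  let ?X = "ball_union N p r" and ?C = "nearest_cell N p r i"
    and ?H = "{x. \<exists>j\<in>{1..N} - {i}. (2 *\<^sub>R (p j - p i)) \<bullet> x = (p j \<bullet> p j - (r j)\<^sup>2) - (p i \<bullet> p i - (r i)\<^sup>2)}"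
  have X: "closed ?X" unfolding ball_union_def by (intro closed_UN) auto
  have X_iff: "x \<in> ?X \<longleftrightarrow> (\<exists>j\<in>{1..N}. power_dist p r j x \<le> 0)" for x
    using mem_cball_power by (auto simp: ball_union_def simp del: mem_cball)
  show "2 *\<^sub>R (p j - p i) \<noteq> 0" if "j \<in> {1..N} - {i}" for j
    using centre_diff_nonzero[OF i that] by blast
  show "frontier ?X \<inter> ?C \<subseteq> sphere (p i) (r i) \<inter> ?C"
  proof
    fix x assume x: "x \<in> frontier ?X \<inter> ?C"
    then obtain j where j: "j \<in> {1..N}" "power_dist p r j x \<le> 0"
      using X_iff frontier_subset_closed[OF X] by blast
    have "power_dist p r i x \<le> power_dist p r j x"
      using x j(1) by (cases "j = i") (auto simp: nearest_cell_alt)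
    moreover have "\<not> power_dist p r i x < 0"
    proof
      assume neg: "power_dist p r i x < 0"
      have "{x. power_dist p r i x < 0} \<subseteq> ?X" using X_iff i less_imp_le by blast
      then have "x \<in> interior ?X" using neg power_dist_open(1) by (intro interiorI) auto
      then show False using x by (simp add: frontier_def)
    qed
    ultimately have "power_dist p r i x = 0" using j(2) by linarith
    then show "x \<in> sphere (p i) (r i) \<inter> ?C" using mem_sphere_power[OF i] x by blast
  qed
  show "sphere (p i) (r i) \<inter> ?C - frontier ?X \<inter> ?C
      \<subseteq> ?H"
  proof (rule subsetI, rule ccontr)
    fix x assume x: "x \<in> sphere (p i) (r i) \<inter> ?C - frontier ?X \<inter> ?C"
      and "x \<notin> ?H"
    then have ne: "power_dist p r i x \<noteq> power_dist p r j x" if "j \<in> {1..N} - {i}" for j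
      using that unfolding power_dist_eq_hyperplane by blast
    have x0: "power_dist p r i x = 0" using x mem_sphere_power[OF i] by blast
    have pos: "0 < power_dist p r j x" if "j \<in> {1..N} - {i}" for j
      using x that ne[OF that] x0 by (force simp: nearest_cell_alt)
    have "x \<in> ?X" using X_iff i x0 by force
    then have int: "x \<in> interior ?X" using x closure_subset[of ?X] by (auto simp: frontier_def)
    \<comment> \<open>A neighbourhood inside the union that avoids every ball except the one with
      index \<open>i\<close>. The sphere point has points outside that ball arbitrarily near, which
      gives the contradiction.\<close>
    define U where "U = interior ?X \<inter> (\<Inter>j\<in>{1..N} - {i}. {x. 0 < power_dist p r j x})"
    have "open U" unfolding U_def by (intro open_Int open_interior open_INT ballI power_dist_open) simp
    moreover have "x \<in> U" using int pos by (simp add: U_def)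
    moreover have "x \<in> sphere (p i) (r i)" using x by blast
    ultimately obtain y where y: "y \<in> U" "y \<notin> cball (p i) (r i)"
      using sphere_boundary_approx[OF radii[OF i]] by blast
    then have "y \<in> ?X" using interior_subset unfolding U_def by blast
    then obtain j where j: "j \<in> {1..N}" "power_dist p r j y \<le> 0" using X_iff by blast
    show False
    proof (cases "j = i")
      case True
      then show ?thesis using j y(2) mem_cball_power[OF i] by blast
    next
      case False
      then have "0 < power_dist p r j y" using y(1) j(1) by (simp add: U_def)
      then show ?thesis using j(2) by simp
    qed
  qed
qed simp

text \<open>Here the two sets coincide without exceptions: in the farthest cell the power with index
  \<open>i\<close> is the largest, so its vanishing puts the point in the intersection, and leaving
  ball \<open>i\<close> means leaving the intersection.\<close>

lemma inter_face_volume_eq: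
  assumes i: "i \<in> {1..N}"
  shows "inter_face_volume N p r i = surface_volume (sphere (p i) (r i) \<inter> farthest_cell N p r i)"
proof -
  let ?X = "ball_inter N p r" and ?C = "farthest_cell N p r i"
  have X: "closed ?X" unfolding ball_inter_def by (intro closed_INT) auto
  have X_iff: "x \<in> ?X \<longleftrightarrow> (\<forall>j\<in>{1..N}. power_dist p r j x \<le> 0)" for x
    using mem_cball_power by (auto simp: ball_inter_def simp del: mem_cball)
  have le: "power_dist p r j x \<le> power_dist p r i x" if "x \<in> ?C" "j \<in> {1..N}" for j x
    using that by (cases "j = i") (auto simp: farthest_cell_alt)
  have "frontier ?X \<inter> ?C = sphere (p i) (r i) \<inter> ?C"
  proof (intro equalityI subsetI)
    fix x assume x: "x \<in> frontier ?X \<inter> ?C"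
    then have "power_dist p r i x \<le> 0" using X_iff frontier_subset_closed[OF X] i by blast
    moreover have "\<not> power_dist p r i x < 0"
    proof
      assume neg: "power_dist p r i x < 0"
      have "open (\<Inter>j\<in>{1..N}. {x. power_dist p r j x < 0})"
        by (intro open_INT ballI power_dist_open) simp
      moreover have "x \<in> (\<Inter>j\<in>{1..N}. {x. power_dist p r j x < 0})"
        using le[of x] x neg le_less_trans by blast
      moreover have "(\<Inter>j\<in>{1..N}. {x. power_dist p r j x < 0}) \<subseteq> ?X" using X_iff less_imp_le by blast
      ultimately have "x \<in> interior ?X" by (rule interiorI)
      then show False using x by (simp add: frontier_def)
    qed
    ultimately have "power_dist p r i x = 0" by linarith
    then show "x \<in> sphere (p i) (r i) \<inter> ?C" using mem_sphere_power[OF i] x by blast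
  next
    fix x assume x: "x \<in> sphere (p i) (r i) \<inter> ?C"
    then have "power_dist p r i x = 0" using mem_sphere_power[OF i] by blast
    then have "x \<in> ?X" using X_iff le x by (metis IntD2)
    moreover have "x \<notin> interior ?X"
    proof
      assume "x \<in> interior ?X"
      then obtain y where "y \<in> interior ?X" "y \<notin> cball (p i) (r i)"
        using sphere_boundary_approx[OF radii[OF i] _ open_interior] x by blast
      then show False using interior_subset[of ?X] i unfolding ball_inter_def by blast
    qed
    ultimately show "x \<in> frontier ?X \<inter> ?C"
      using x closure_subset[of ?X] by (auto simp: frontier_def)
  qed
  then show ?thesis by (simp add: inter_face_volume_def)
qed

theorem union_volume_derivative:
  assumes N: "1 \<le> N"
  shows "((\<lambda>s. measure lebesgue (ball_union N p (shifted_radii r s)))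
    has_real_derivative 1/2 * (\<Sum>i=1..N. union_face_volume N p r i / r i)) (at 0 within {0..})"
proof (rule sum_cells_derivative[OF ball_union_cells[OF N] closed_cells(1)])
  show "negligible (nearest_cell N p r i \<inter> nearest_cell N p r j)"
    if "i \<in> {1..N}" "j \<in> {1..N}" "i \<noteq> j" for i j
  proof (rule negligible_subset[OF negligible_equal_power[OF that]])
    show "nearest_cell N p r i \<inter> nearest_cell N p r j \<subseteq> {x. power_dist p r i x = power_dist p r j x}"
      using that by (auto simp: nearest_cell_alt intro: antisym)
  qed
  show "((\<lambda>s. measure lborel (nearest_cell N p r i \<inter> cball (p i) (sqrt ((r i)\<^sup>2 + s))))
      has_real_derivative 1/2 * (union_face_volume N p r i / r i)) (at 0 within {0..})"
    if i: "i \<in> {1..N}" for i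
    unfolding union_face_volume_eq[OF i] nearest_cell_polyhedron
    by (rule polyhedron_ball_derivative[OF dim radii[OF i]]) (use centre_diff_nonzero[OF i] in auto)
qed

theorem inter_volume_derivative:
  assumes N: "1 \<le> N"
  shows "((\<lambda>s. measure lebesgue (ball_inter N p (shifted_radii r s)))
    has_real_derivative 1/2 * (\<Sum>i=1..N. inter_face_volume N p r i / r i)) (at 0 within {0..})"
proof (rule sum_cells_derivative[OF ball_inter_cells[OF N] closed_cells(2)])
  show "negligible (farthest_cell N p r i \<inter> farthest_cell N p r j)"
    if "i \<in> {1..N}" "j \<in> {1..N}" "i \<noteq> j" for i j
  proof (rule negligible_subset[OF negligible_equal_power[OF that]])
    show "farthest_cell N p r i \<inter> farthest_cell N p r j \<subseteq> {x. power_dist p r i x = power_dist p r j x}"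
      using that by (auto simp: farthest_cell_alt intro: antisym)
  qed
  show "((\<lambda>s. measure lborel (farthest_cell N p r i \<inter> cball (p i) (sqrt ((r i)\<^sup>2 + s))))
      has_real_derivative 1/2 * (inter_face_volume N p r i / r i)) (at 0 within {0..})"
    if i: "i \<in> {1..N}" for i
    unfolding inter_face_volume_eq[OF i] farthest_cell_polyhedron
    by (rule polyhedron_ball_derivative[OF dim radii[OF i]]) (use centre_diff_nonzero[OF i] in auto)
qed

end

section \<open>Gaussian integrals\<close>

text \<open>The \<open>itself\<close> argument carries the dimension. The value is never evaluated:
  it enters only as a factor independent of s and t.\<close>

definition gauss_mass :: "'a::euclidean_space itself \<Rightarrow> real \<Rightarrow> real" where
  "gauss_mass _ A = (\<integral>x. exp (- A * (norm (x :: 'a))\<^sup>2) \<partial>lborel)"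

lemma integrable_gauss_real:
  assumes "0 < A"
  shows "integrable lborel (\<lambda>t::real. exp (- A * t\<^sup>2))"
proof -
  \<comment> \<open>The standard deviation for which the normal density is a multiple of the given
    Gaussian.\<close>
  define \<sigma> where "\<sigma> = sqrt (1 / (2 * A))"
  have \<sigma>: "0 < \<sigma>" "2 * \<sigma>\<^sup>2 = 1 / A" using assms by (auto simp: \<sigma>_def)
  have "integrable lborel (\<lambda>t. sqrt (2 * pi * \<sigma>\<^sup>2) * normal_density 0 \<sigma> t)"
    using \<sigma>(1) by (intro integrable_mult_right integrable_normal_density)
  moreover have "sqrt (2 * pi * \<sigma>\<^sup>2) * normal_density 0 \<sigma> t = exp (- A * t\<^sup>2)" for t
    using \<sigma> assms by (simp add: normal_density_def)
  ultimately show ?thesis by simp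
qed

lemma integrable_gauss:
  assumes A: "0 < A"
  shows "integrable lborel (\<lambda>x::'a::euclidean_space. exp (- A * (norm x)\<^sup>2))"
proof (rule integrableI_nonneg)
  have prod: "ennreal (exp (- A * (norm x)\<^sup>2)) = (\<Prod>b\<in>Basis. ennreal (exp (- A * (x \<bullet> b)\<^sup>2)))" for x :: 'a
  proof -
    have "(norm x)\<^sup>2 = (\<Sum>b\<in>Basis. (x \<bullet> b)\<^sup>2)"
      unfolding power2_norm_eq_inner by (subst euclidean_inner) (simp add: power2_eq_square)
    then have "exp (- A * (norm x)\<^sup>2) = (\<Prod>b\<in>Basis. exp (- A * (x \<bullet> b)\<^sup>2))"
      by (simp add: sum_distrib_left exp_sum sum_negf[symmetric])
    then show ?thesis by (simp add: prod_ennreal)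
  qed
  have "(\<integral>\<^sup>+t. ennreal (exp (- A * t\<^sup>2)) \<partial>lborel) < \<infinity>"
    using integrable_gauss_real[OF A] by (simp add: integrable_iff_bounded)
  then have "(\<Prod>b\<in>(Basis :: 'a set). \<integral>\<^sup>+t. ennreal (exp (- A * t\<^sup>2)) \<partial>lborel) < \<infinity>"
    by (simp add: power_less_top_ennreal)
  then show "(\<integral>\<^sup>+x. ennreal (exp (- A * (norm (x :: 'a))\<^sup>2)) \<partial>lborel) < \<infinity>"
    unfolding prod by (subst nn_integral_lborel_prod) auto
qed auto

text \<open>The parallel axis identity: the weighted moment about x is that about the centroid plus
  \<open>A\<close> times the squared distance to it, and the moment about the centroid depends only
  on mutual distances. The double sum runs over ordered pairs, hence the 2 in the
  denominator.\<close>

lemma weighted_square_distances: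
  fixes p :: "'i \<Rightarrow> 'a::euclidean_space" and g :: "'i \<Rightarrow> real" and I :: "'i set"
  defines "A \<equiv> sum g I"
  assumes A: "A \<noteq> 0"
  shows "(\<Sum>i\<in>I. g i * (dist x (p i))\<^sup>2) = A * (norm (x - (\<Sum>i\<in>I. g i *\<^sub>R p i) /\<^sub>R A))\<^sup>2
    + (\<Sum>i\<in>I. \<Sum>j\<in>I. g i * g j * (dist (p i) (p j))\<^sup>2) / (2 * A)"
proof -
  define S where "S = (\<Sum>i\<in>I. g i *\<^sub>R p i)"
  define T where "T = (\<Sum>i\<in>I. g i * (p i \<bullet> p i))"
  have sq: "(dist u v)\<^sup>2 = u \<bullet> u - 2 * (u \<bullet> v) + v \<bullet> v" for u v :: 'a
    by (simp add: dist_norm power2_norm_eq_inner inner_diff inner_commute)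
  have lin: "(\<Sum>i\<in>I. g i * (y \<bullet> p i)) = y \<bullet> S" for y by (simp add: S_def inner_sum_right)
  \<comment> \<open>Used twice: for the moment about \<open>x\<close>, and with y = p i inside the
    double sum.\<close>
  have one: "(\<Sum>i\<in>I. g i * (dist y (p i))\<^sup>2) = A * (y \<bullet> y) - 2 * (y \<bullet> S) + T" for y
  proof -
    have "(\<Sum>i\<in>I. g i * (dist y (p i))\<^sup>2) = (\<Sum>i\<in>I. g i * (y \<bullet> y) - 2 * (g i * (y \<bullet> p i)) + g i * (p i \<bullet> p i))"
      by (simp add: sq algebra_simps)
    also have "\<dots> = A * (y \<bullet> y) - 2 * (y \<bullet> S) + T"
      by (simp add: sum.distrib sum_subtractf A_def T_def sum_distrib_right flip: sum_distrib_left lin)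
    finally show ?thesis .
  qed
  have "(\<Sum>i\<in>I. \<Sum>j\<in>I. g i * g j * (dist (p i) (p j))\<^sup>2) = (\<Sum>i\<in>I. g i * (\<Sum>j\<in>I. g j * (dist (p i) (p j))\<^sup>2))"
    by (simp add: sum_distrib_left mult.assoc)
  also have "\<dots> = (\<Sum>i\<in>I. A * (g i * (p i \<bullet> p i)) - 2 * (g i * (p i \<bullet> S)) + g i * T)"
    by (simp add: one algebra_simps)
  also have "\<dots> = A * T - 2 * (S \<bullet> S) + A * T"
  proof -
    have "(\<Sum>i\<in>I. g i * (p i \<bullet> S)) = S \<bullet> S" using lin[of S] by (simp add: inner_commute)
    moreover have "(\<Sum>i\<in>I. g i * T) = A * T" by (simp add: A_def sum_distrib_right)
    moreover have "(\<Sum>i\<in>I. A * (g i * (p i \<bullet> p i))) = A * T" by (simp add: T_def sum_distrib_left)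
    ultimately show ?thesis by (simp add: sum.distrib sum_subtractf flip: sum_distrib_left)
  qed
  finally have two: "(\<Sum>i\<in>I. \<Sum>j\<in>I. g i * g j * (dist (p i) (p j))\<^sup>2) = 2 * A * T - 2 * (S \<bullet> S)" by simp
  have "A * (norm (x - S /\<^sub>R A))\<^sup>2 = A * (x \<bullet> x) - 2 * (x \<bullet> S) + (S \<bullet> S) / A"
    using A by (simp add: power2_norm_eq_inner inner_diff inner_commute field_simps)
  then show ?thesis unfolding one two S_def[symmetric] using A by (simp add: diff_divide_distrib)
qed

text \<open>Completing the square makes the integrand a Gaussian about the weighted centroid times a
  constant; translation invariance removes the centroid.\<close>

lemma gauss_mixture_integral:
  fixes p :: "'i \<Rightarrow> 'a::euclidean_space" and g :: "'i \<Rightarrow> real"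
  assumes A: "0 < sum g I"
  shows "has_bochner_integral lborel (\<lambda>x. exp (- (\<Sum>i\<in>I. g i * (dist x (p i))\<^sup>2)))
    (gauss_mass TYPE('a) (sum g I) * exp (- (\<Sum>i\<in>I. \<Sum>j\<in>I. g i * g j * (dist (p i) (p j))\<^sup>2) / (2 * sum g I)))"
proof -
  let ?A = "sum g I"
  define c where "c = (\<Sum>i\<in>I. g i *\<^sub>R p i) /\<^sub>R ?A"
  define e where "e = exp (- (\<Sum>i\<in>I. \<Sum>j\<in>I. g i * g j * (dist (p i) (p j))\<^sup>2) / (2 * ?A))"
  define f where "f x = exp (- ?A * (norm x)\<^sup>2)" for x :: 'a
  have f: "f \<in> borel_measurable borel" unfolding f_def by measurable
  have int: "integrable lborel f" unfolding f_def by (rule integrable_gauss[OF A])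
  have "integrable (distr lborel borel ((+) (- c))) f" "(\<integral>x. f x \<partial>distr lborel borel ((+) (- c))) = (\<integral>x. f x \<partial>lborel)"
    using int by (simp_all add: lborel_distr_plus)
  then have "has_bochner_integral lborel (\<lambda>x. f (- c + x)) (\<integral>x. f x \<partial>lborel)"
    using f by (simp add: has_bochner_integral_iff integrable_distr_eq integral_distr)
  then have "has_bochner_integral lborel (\<lambda>x::'a. exp (- ?A * (norm (- c + x))\<^sup>2)) (gauss_mass TYPE('a) ?A)"
    by (simp add: f_def gauss_mass_def)
  then have "has_bochner_integral lborel (\<lambda>x::'a. exp (- ?A * (norm (- c + x))\<^sup>2) * e) (gauss_mass TYPE('a) ?A * e)"
    by (rule has_bochner_integral_mult_left)
  moreover have "exp (- ?A * (norm (- c + x))\<^sup>2) * e = exp (- (\<Sum>i\<in>I. g i * (dist x (p i))\<^sup>2))" for x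
    unfolding weighted_square_distances[OF less_imp_neq[OF A, symmetric]] e_def c_def
    by (simp add: exp_add[symmetric])
  ultimately show ?thesis by (simp add: e_def)
qed

lemma poly_sum_atMost: "degree q \<le> m \<Longrightarrow> poly q z = (\<Sum>k\<le>m. coeff q k * z ^ k)"
  for q :: "real poly"
  unfolding poly_altdef by (rule sum.mono_neutral_left) (auto simp: coeff_eq_0)

text \<open>The polynomials may vary with the index because two factors will later be replaced by z
  Q'(z). The common factor \<open>c\<close> stands for e^s and collects the total degree.\<close>

lemma prod_poly_expand:
  fixes R :: "'i \<Rightarrow> real poly"
  assumes I: "finite I" and deg: "\<And>i. i \<in> I \<Longrightarrow> degree (R i) \<le> m"
  shows "(\<Prod>i\<in>I. poly (R i) (c * w i * exp (- d i)))
    = (\<Sum>g\<in>PiE I (\<lambda>_. {..m}). (\<Prod>i\<in>I. coeff (R i) (g i) * w i ^ g i) * c ^ sum g I * exp (- (\<Sum>i\<in>I. real (g i) * d i)))"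
proof -
  have "(\<Prod>i\<in>I. poly (R i) (c * w i * exp (- d i)))
      = (\<Prod>i\<in>I. \<Sum>k\<le>m. coeff (R i) k * (c * w i * exp (- d i)) ^ k)"
    by (intro prod.cong poly_sum_atMost deg) auto
  also have "\<dots> = (\<Sum>g\<in>PiE I (\<lambda>_. {..m}). \<Prod>i\<in>I. coeff (R i) (g i) * (c * w i * exp (- d i)) ^ g i)"
    using I by (intro prod_sum_PiE) auto
  also have "\<dots> = (\<Sum>g\<in>PiE I (\<lambda>_. {..m}). (\<Prod>i\<in>I. coeff (R i) (g i) * w i ^ g i) * c ^ sum g I * exp (- (\<Sum>i\<in>I. real (g i) * d i)))"
  proof (rule sum.cong[OF refl])
    fix g :: "'i \<Rightarrow> nat"
    have "(\<Prod>i\<in>I. coeff (R i) (g i) * (c * w i * exp (- d i)) ^ g i)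
        = (\<Prod>i\<in>I. (coeff (R i) (g i) * w i ^ g i) * (c ^ g i * exp (- (real (g i) * d i))))"
      by (intro prod.cong refl) (simp add: power_mult_distrib exp_of_nat_mult[symmetric] mult_ac)
    also have "\<dots> = (\<Prod>i\<in>I. coeff (R i) (g i) * w i ^ g i) * (c ^ sum g I * exp (- (\<Sum>i\<in>I. real (g i) * d i)))"
      using I by (simp add: prod.distrib power_sum exp_sum sum_negf[symmetric])
    finally show "(\<Prod>i\<in>I. coeff (R i) (g i) * (c * w i * exp (- d i)) ^ g i)
        = (\<Prod>i\<in>I. coeff (R i) (g i) * w i ^ g i) * c ^ sum g I * exp (- (\<Sum>i\<in>I. real (g i) * d i))"
      by (simp add: mult.assoc)
  qed
  finally show ?thesis .
qed

section \<open>Gaussian mixtures with polynomial coefficients and their mixed derivative\<close>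

text \<open>The zero multi-index is left out because its monomial is constant, hence not integrable
  over the space.\<close>

definition mix_index :: "'i set \<Rightarrow> nat \<Rightarrow> ('i \<Rightarrow> nat) set" where
  "mix_index I m = {g \<in> PiE I (\<lambda>_. {..m}). 0 < sum g I}"

definition mix_coeff :: "'i set \<Rightarrow> real poly \<Rightarrow> ('i \<Rightarrow> real) \<Rightarrow> ('i \<Rightarrow> nat) \<Rightarrow> real" where
  "mix_coeff I Q w g = (\<Prod>i\<in>I. coeff Q (g i) * w i ^ g i)"

definition mix_gauss :: "'i set \<Rightarrow> ('i \<Rightarrow> 'a::euclidean_space) \<Rightarrow> ('i \<Rightarrow> nat) \<Rightarrow> real" where
  "mix_gauss I q g = gauss_mass TYPE('a) (real (sum g I)) *
     exp (- (\<Sum>i\<in>I. \<Sum>j\<in>I. real (g i) * real (g j) * (dist (q i) (q j))\<^sup>2) / (2 * real (sum g I)))"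

definition mix_integral :: "'i set \<Rightarrow> real poly \<Rightarrow> ('i \<Rightarrow> real) \<Rightarrow> ('i \<Rightarrow> 'a::euclidean_space) \<Rightarrow> real \<Rightarrow> real" where
  "mix_integral I Q w q s = (\<Sum>g\<in>mix_index I (degree Q). mix_coeff I Q w g * exp s ^ sum g I * mix_gauss I q g)"

text \<open>The s-derivative of \<open>mix_integral\<close>; the factor
  \<open>real (sum g I)\<close> will cancel the denominator in the exponent of
  \<open>mix_gauss\<close>.\<close>

definition mix_rate :: "'i set \<Rightarrow> real poly \<Rightarrow> ('i \<Rightarrow> real) \<Rightarrow> ('i \<Rightarrow> 'a::euclidean_space) \<Rightarrow> real \<Rightarrow> real" where
  "mix_rate I Q w q s = (\<Sum>g\<in>mix_index I (degree Q). mix_coeff I Q w g * (real (sum g I) * exp s ^ sum g I) * mix_gauss I q g)"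

lemma finite_mix_index: "finite I \<Longrightarrow> finite (mix_index I m)"
  unfolding mix_index_def by (intro finite_subset[OF _ finite_PiE[of I "\<lambda>_. {..m}"]]) auto

lemma mix_gauss_integral:
  fixes q :: "'i \<Rightarrow> 'a::euclidean_space"
  assumes "0 < sum g I"
  shows "has_bochner_integral lborel (\<lambda>x. exp (- (\<Sum>i\<in>I. real (g i) * (dist x (q i))\<^sup>2))) (mix_gauss I q g)"
  using gauss_mixture_integral[of "\<lambda>i. real (g i)" I q] assms
  by (simp add: mix_gauss_def flip: of_nat_sum)

lemma PiE_eq_insert_mix_index:
  assumes "finite I"
  shows "PiE I (\<lambda>_. {..m}) = insert (\<lambda>i\<in>I. 0) (mix_index I m)" "(\<lambda>i\<in>I. 0) \<notin> mix_index I m"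
proof -
  show "(\<lambda>i\<in>I. 0) \<notin> mix_index I m" by (simp add: mix_index_def)
  show "PiE I (\<lambda>_. {..m}) = insert (\<lambda>i\<in>I. 0) (mix_index I m)"
  proof (intro equalityI subsetI)
    fix g assume g: "g \<in> PiE I (\<lambda>_. {..m})"
    show "g \<in> insert (\<lambda>i\<in>I. 0) (mix_index I m)"
    proof (cases "sum g I = 0")
      case True
      then have "\<And>i. i \<in> I \<Longrightarrow> g i = 0" using assms by simp
      then have "g = (\<lambda>i\<in>I. 0)" using g by (intro ext) (auto simp: PiE_def extensional_def restrict_def)
      then show ?thesis by simp
    qed (use g in \<open>simp add: mix_index_def\<close>)
  qed (auto simp: mix_index_def)
qed

text \<open>The subtracted constant is the term of the zero multi-index, which contributes Q(0) once
  for each index.\<close>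

lemma mix_integral_has_integral:
  fixes q :: "'i \<Rightarrow> 'a::euclidean_space"
  assumes I: "finite I"
  shows "has_bochner_integral lborel
    (\<lambda>x. (\<Prod>i\<in>I. poly Q (exp s * w i * exp (- (dist x (q i))\<^sup>2))) - coeff Q 0 ^ card I) (mix_integral I Q w q s)"
proof -
  have eq: "(\<Prod>i\<in>I. poly Q (exp s * w i * exp (- (dist x (q i))\<^sup>2))) - coeff Q 0 ^ card I
      = (\<Sum>g\<in>mix_index I (degree Q). mix_coeff I Q w g * exp s ^ sum g I * exp (- (\<Sum>i\<in>I. real (g i) * (dist x (q i))\<^sup>2)))" for x
    using I prod_poly_expand[OF I, of "\<lambda>_. Q" "degree Q" "exp s" w "\<lambda>i. (dist x (q i))\<^sup>2"]
    by (simp add: PiE_eq_insert_mix_index finite_mix_index mix_coeff_def)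
  show ?thesis unfolding eq mix_integral_def
    by (intro has_bochner_integral_sum has_bochner_integral_mult_right mix_gauss_integral) (simp add: mix_index_def)
qed

lemma mix_integral_deriv:
  assumes "finite I"
  shows "(mix_integral I Q w q has_real_derivative mix_rate I Q w q s) (at s)"
proof -
  have "((\<lambda>s. exp s ^ k) has_real_derivative real k * exp s ^ k) (at s)" for k :: nat
    unfolding exp_of_nat_mult[symmetric] by (auto intro!: derivative_eq_intros)
  then show ?thesis unfolding mix_integral_def[abs_def] mix_rate_def
    by (intro DERIV_sum DERIV_cmult_right DERIV_cmult)
qed

text \<open>The Euler operator z d/dz multiplies the coefficient of z^k by k; this is how the
  factors g_i are realised by polynomials.\<close>

lemma coeff_X_pderiv: "coeff (pCons 0 (pderiv Q)) k = real k * coeff Q k" for Q :: "real poly"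
  by (cases k) (simp_all add: coeff_pderiv)

text \<open>The product of two derivative values expresses that the derivative keeps its sign,
  covering increasing and decreasing polynomials at once.\<close>

definition monotone_poly_on :: "real \<Rightarrow> real poly \<Rightarrow> bool" where
  "monotone_poly_on M Q \<longleftrightarrow> (\<forall>z\<in>{0..M}. 0 \<le> poly Q z) \<and>
     (\<forall>y\<in>{0..M}. \<forall>z\<in>{0..M}. 0 \<le> poly (pderiv Q) y * poly (pderiv Q) z)"

text \<open>The sum is the integral of a nonnegative function: the product of the levels'
  polynomials with the Euler operator applied at the two indices \<open>i\<close> and
  \<open>j\<close>.\<close>

lemma mix_second_difference_nonneg:
  fixes q :: "'i \<Rightarrow> 'a::euclidean_space"
  assumes I: "finite I" and ij: "i \<in> I" "j \<in> I" "i \<noteq> j"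
    and w: "\<And>k. k \<in> I \<Longrightarrow> 0 \<le> w k \<and> exp s * w k \<le> M"
    and Q: "monotone_poly_on M Q"
  shows "0 \<le> (\<Sum>g\<in>mix_index I (degree Q). mix_coeff I Q w g * (real (g i) * real (g j)) * exp s ^ sum g I * mix_gauss I q g)"
proof -
  let ?m = "degree Q"
  define R where "R k = (if k \<in> {i, j} then pCons 0 (pderiv Q) else Q)" for k
  have coeff_R: "coeff (R k) l = (if k \<in> {i, j} then real l else 1) * coeff Q l" for k l
    by (simp add: R_def coeff_X_pderiv)
  have deg: "degree (R k) \<le> ?m" for k by (rule degree_le) (simp add: coeff_R coeff_eq_0)
  have coeff_prod: "(\<Prod>k\<in>I. coeff (R k) (g k) * w k ^ g k) = mix_coeff I Q w g * (real (g i) * real (g j))" for g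
  proof -
    have "(\<Prod>k\<in>I. coeff (R k) (g k) * w k ^ g k) = (\<Prod>k\<in>I. (if k \<in> {i, j} then real (g k) else 1) * (coeff Q (g k) * w k ^ g k))"
      by (simp add: coeff_R mult_ac)
    also have "\<dots> = (\<Prod>k\<in>I. if k \<in> {i, j} then real (g k) else 1) * mix_coeff I Q w g"
      by (simp add: prod.distrib mix_coeff_def)
    also have "(\<Prod>k\<in>I. if k \<in> {i, j} then real (g k) else 1) = (\<Prod>k\<in>I \<inter> {k. k \<in> {i, j}}. real (g k))"
      using I by (subst prod.inter_restrict) (auto intro: prod.cong)
    also have "I \<inter> {k. k \<in> {i, j}} = {i, j}" using ij by auto
    also have "(\<Prod>k\<in>{i, j}. real (g k)) = real (g i) * real (g j)" using ij by simp
    finally show ?thesis by (simp add: mult.commute)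
  qed
  \<comment> \<open>Unlike in \<open>mix_integral_has_integral\<close>, no constant is subtracted:
    the zero multi-index carries the factor g_i g_j = 0.\<close>
  have eq: "(\<Prod>k\<in>I. poly (R k) (exp s * w k * exp (- (dist x (q k))\<^sup>2)))
      = (\<Sum>g\<in>mix_index I ?m. mix_coeff I Q w g * (real (g i) * real (g j)) * exp s ^ sum g I * exp (- (\<Sum>k\<in>I. real (g k) * (dist x (q k))\<^sup>2)))" for x
    unfolding prod_poly_expand[OF I deg] coeff_prod
    using I ij by (simp add: PiE_eq_insert_mix_index finite_mix_index)
  have "has_bochner_integral lborel (\<lambda>x. \<Prod>k\<in>I. poly (R k) (exp s * w k * exp (- (dist x (q k))\<^sup>2)))
     (\<Sum>g\<in>mix_index I ?m. mix_coeff I Q w g * (real (g i) * real (g j)) * exp s ^ sum g I * mix_gauss I q g)"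
    unfolding eq
    by (intro has_bochner_integral_sum has_bochner_integral_mult_right mix_gauss_integral) (simp add: mix_index_def)
  moreover have "0 \<le> (\<Prod>k\<in>I. poly (R k) (exp s * w k * exp (- (dist x (q k))\<^sup>2)))" for x
  proof -
    define z where "z k = exp s * w k * exp (- (dist x (q k))\<^sup>2)" for k
    have z: "0 \<le> z k" "z k \<le> M" if "k \<in> I" for k
    proof -
      show "0 \<le> z k" using w[OF that] by (simp add: z_def)
      have "z k \<le> (exp s * w k) * 1" unfolding z_def using w[OF that] by (intro mult_left_mono) auto
      then show "z k \<le> M" using w[OF that] by simp
    qed
    have "(\<Prod>k\<in>I. poly (R k) (z k)) = (\<Prod>k\<in>{i, j}. poly (R k) (z k)) * (\<Prod>k\<in>I - {i, j}. poly (R k) (z k))"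
      using I ij by (subst prod.subset_diff[of "{i, j}" I]) (auto simp: mult.commute)
    also have "(\<Prod>k\<in>{i, j}. poly (R k) (z k)) = (z i * z j) * (poly (pderiv Q) (z i) * poly (pderiv Q) (z j))"
      using ij by (simp add: R_def)
    also have "(\<Prod>k\<in>I - {i, j}. poly (R k) (z k)) = (\<Prod>k\<in>I - {i, j}. poly Q (z k))"
      by (intro prod.cong) (auto simp: R_def)
    finally have eq: "(\<Prod>k\<in>I. poly (R k) (z k))
      = (z i * z j) * (poly (pderiv Q) (z i) * poly (pderiv Q) (z j)) * (\<Prod>k\<in>I - {i, j}. poly Q (z k))" .
    have "0 \<le> z i * z j" using z ij by simp
    moreover have "0 \<le> poly (pderiv Q) (z i) * poly (pderiv Q) (z j)" using Q z ij by (simp add: monotone_poly_on_def)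
    moreover have "0 \<le> (\<Prod>k\<in>I - {i, j}. poly Q (z k))" using z Q by (intro prod_nonneg) (simp add: monotone_poly_on_def)
    ultimately show ?thesis
      unfolding z_def[symmetric] eq by (rule mult_nonneg_nonneg[OF mult_nonneg_nonneg])
  qed
  ultimately show ?thesis
    by (auto dest!: has_bochner_integral_integral_eq[symmetric] intro!: Bochner_Integration.integral_nonneg)
qed

text \<open>Differentiating \<open>mix_gauss\<close> in t brings down minus the sum of g_i g_j D_ij
  over twice the total degree, and each D_ij is nonnegative. Summed over the multi-indices, every
  pair contributes a sum controlled by \<open>mix_second_difference_nonneg\<close>. Derivatives are
  available inside the interval, continuity up to its ends.\<close>

lemma mix_rate_antimono:
  fixes p :: "real \<Rightarrow> 'i \<Rightarrow> 'a::euclidean_space"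
  assumes I: "finite I" and t: "t1 \<le> t2"
    and cont: "\<And>i j. i \<in> I \<Longrightarrow> j \<in> I \<Longrightarrow> continuous_on {t1..t2} (\<lambda>t. (dist (p t i) (p t j))\<^sup>2)"
    and deriv: "\<And>i j t. i \<in> I \<Longrightarrow> j \<in> I \<Longrightarrow> t1 < t \<Longrightarrow> t < t2 \<Longrightarrow>
      \<exists>D\<ge>0. ((\<lambda>t. (dist (p t i) (p t j))\<^sup>2) has_real_derivative D) (at t)"
    and w: "\<And>k. k \<in> I \<Longrightarrow> 0 \<le> w k \<and> exp s * w k \<le> M"
    and Q: "monotone_poly_on M Q"
  shows "mix_rate I Q w (p t2) s \<le> mix_rate I Q w (p t1) s"
proof (rule DERIV_nonpos_imp_decreasing_open[OF t])
  let ?G = "mix_index I (degree Q)"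
  show "continuous_on {t1..t2} (\<lambda>t. mix_rate I Q w (p t) s)" unfolding mix_rate_def mix_gauss_def
    by (intro continuous_on_sum continuous_on_mult continuous_on_const continuous_on_exp
        continuous_on_divide continuous_on_minus cont) (auto simp: mix_index_def simp del: of_nat_sum)
  fix t assume tt: "t1 < t" "t < t2"
  obtain D where D: "\<And>i j. i \<in> I \<Longrightarrow> j \<in> I \<Longrightarrow> 0 \<le> D i j \<and>
      ((\<lambda>t. (dist (p t i) (p t j))\<^sup>2) has_real_derivative D i j) (at t)"
    using deriv[OF _ _ tt] by metis
  \<comment> \<open>The distance of a point from itself is constant; this disposes of the diagonal,
    where \<open>mix_second_difference_nonneg\<close> says nothing.\<close>
  have D_diag: "D i i = 0" if "i \<in> I" for i
    using D[OF that that] DERIV_unique[of "\<lambda>_. 0" "D i i" t 0] by simp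
  define A where "A g = real (sum g I)" for g :: "'i \<Rightarrow> nat"
  let ?c = "\<lambda>i j g. mix_coeff I Q w g * (real (g i) * real (g j)) * exp s ^ sum g I * mix_gauss I (p t) g"
  let ?d = "\<lambda>g. - (\<Sum>i\<in>I. \<Sum>j\<in>I. real (g i) * real (g j) * D i j) / (2 * A g)"
  let ?e = "\<lambda>g. mix_coeff I Q w g * (real (sum g I) * exp s ^ sum g I) * (mix_gauss I (p t) g * ?d g)"
  have gauss_deriv: "((\<lambda>t. mix_gauss I (p t) g) has_real_derivative mix_gauss I (p t) g * ?d g) (at t)" for g
  proof -
    have "((\<lambda>t. - (\<Sum>i\<in>I. \<Sum>j\<in>I. real (g i) * real (g j) * (dist (p t i) (p t j))\<^sup>2) / (2 * A g)) has_real_derivative ?d g) (at t)"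
      using D by (intro DERIV_cdivide DERIV_minus DERIV_sum DERIV_cmult) auto
    from DERIV_cmult[OF DERIV_chain2[OF DERIV_exp this], of "gauss_mass TYPE('a) (A g)"]
    show ?thesis unfolding mix_gauss_def A_def by (simp only: mult.assoc)
  qed
  have "((\<lambda>t. mix_rate I Q w (p t) s) has_real_derivative (\<Sum>g\<in>?G. ?e g)) (at t)"
    unfolding mix_rate_def by (intro DERIV_sum DERIV_cmult gauss_deriv)
  moreover have "(\<Sum>g\<in>?G. ?e g) \<le> 0"
  proof -
    \<comment> \<open>The total degree from the s-derivative cancels against \<open>A g\<close>,
      leaving only the factor 1/2 for ordered pairs.\<close>
    have "(\<Sum>g\<in>?G. ?e g) = (\<Sum>g\<in>?G. - (1/2) * (\<Sum>i\<in>I. \<Sum>j\<in>I. D i j * ?c i j g))"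
    proof (rule sum.cong[OF refl])
      fix g assume "g \<in> ?G"
      then have "0 < A g" by (simp add: mix_index_def A_def del: of_nat_sum)
      moreover have "(\<Sum>i\<in>I. \<Sum>j\<in>I. D i j * ?c i j g)
          = (mix_coeff I Q w g * exp s ^ sum g I * mix_gauss I (p t) g) * (\<Sum>i\<in>I. \<Sum>j\<in>I. real (g i) * real (g j) * D i j)"
        unfolding sum_distrib_left by (intro sum.cong refl) (simp add: mult_ac)
      ultimately show "?e g = - (1/2) * (\<Sum>i\<in>I. \<Sum>j\<in>I. D i j * ?c i j g)"
        unfolding A_def[symmetric] by (simp add: field_simps)
    qed
    also have "\<dots> = - (1/2) * (\<Sum>i\<in>I. \<Sum>j\<in>I. D i j * (\<Sum>g\<in>?G. ?c i j g))"
    proof -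
      have "(\<Sum>g\<in>?G. \<Sum>i\<in>I. \<Sum>j\<in>I. D i j * ?c i j g)
        = (\<Sum>i\<in>I. \<Sum>j\<in>I. \<Sum>g\<in>?G. D i j * ?c i j g)"
        by (subst sum.swap) (intro sum.cong refl sum.swap)
      then show ?thesis by (simp only: sum_distrib_left[symmetric])
    qed
    also have "\<dots> \<le> 0"
    proof -
      have "0 \<le> D i j * (\<Sum>g\<in>?G. ?c i j g)" if "i \<in> I" "j \<in> I" for i j
      proof (cases "i = j")
        case True
        then show ?thesis using D_diag that by simp
      next
        case False
        then show ?thesis
          using D[OF that] mix_second_difference_nonneg[OF I that False w Q] by (intro mult_nonneg_nonneg) auto
      qed
      then show ?thesis by (auto intro!: sum_nonneg)
    qed
    finally show ?thesis .
  qed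
  ultimately show "\<exists>y. ((\<lambda>t. mix_rate I Q w (p t) s) has_real_derivative y) (at t) \<and> y \<le> 0" by blast
qed

section \<open>Monotonicity of volume differences\<close>

lemma mix_integral_difference_antimono:
  fixes p :: "real \<Rightarrow> 'i \<Rightarrow> 'a::euclidean_space"
  assumes I: "finite I" and t: "t1 \<le> t2" and s: "s \<le> s'"
    and cont: "\<And>i j. i \<in> I \<Longrightarrow> j \<in> I \<Longrightarrow> continuous_on {t1..t2} (\<lambda>t. (dist (p t i) (p t j))\<^sup>2)"
    and deriv: "\<And>i j t. i \<in> I \<Longrightarrow> j \<in> I \<Longrightarrow> t1 < t \<Longrightarrow> t < t2 \<Longrightarrow>
      \<exists>D\<ge>0. ((\<lambda>t. (dist (p t i) (p t j))\<^sup>2) has_real_derivative D) (at t)"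
    and w: "\<And>k. k \<in> I \<Longrightarrow> 0 \<le> w k \<and> exp s' * w k \<le> M"
    and Q: "monotone_poly_on M Q"
  shows "mix_integral I Q w (p t2) s' - mix_integral I Q w (p t1) s'
    \<le> mix_integral I Q w (p t2) s - mix_integral I Q w (p t1) s"
proof (rule DERIV_nonpos_imp_nonincreasing[OF s])
  fix \<sigma> assume \<sigma>: "s \<le> \<sigma>" "\<sigma> \<le> s'"
  \<comment> \<open>The bound at the largest parameter \<open>s'\<close> covers all smaller
    ones.\<close>
  have w\<sigma>: "0 \<le> w k \<and> exp \<sigma> * w k \<le> M" if "k \<in> I" for k
  proof -
    have "exp \<sigma> * w k \<le> exp s' * w k" using \<sigma> w[OF that] by (intro mult_right_mono) auto
    then show ?thesis using w[OF that] by simp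
  qed
  have "((\<lambda>s. mix_integral I Q w (p t2) s - mix_integral I Q w (p t1) s) has_real_derivative
      mix_rate I Q w (p t2) \<sigma> - mix_rate I Q w (p t1) \<sigma>) (at \<sigma>)"
    by (intro DERIV_diff mix_integral_deriv I)
  moreover have "mix_rate I Q w (p t2) \<sigma> - mix_rate I Q w (p t1) \<sigma> \<le> 0"
    using mix_rate_antimono[OF I t cont deriv w\<sigma> Q] by simp
  ultimately show "\<exists>y. ((\<lambda>s. mix_integral I Q w (p t2) s - mix_integral I Q w (p t1) s) has_real_derivative y) (at \<sigma>) \<and> y \<le> 0"
    by blast
qed

text \<open>
  On \<open>[0, M]\<close> these polynomials decrease from 1 to the step at \<open>z = 1\<close> as \<open>k\<close> grows: by Bernoulli's
  inequality they are at least \<open>1 - z ^ k\<close>, and they are at most \<open>exp (- z ^ k)\<close>.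
\<close>

definition step_poly :: "nat \<Rightarrow> nat \<Rightarrow> real poly" where
  "step_poly M k = (1 - monom (1 / real M ^ k) k) ^ (M ^ k)"

lemma poly_step_poly: "poly (step_poly M k) z = (1 - (z / real M) ^ k) ^ (M ^ k)"
  by (simp add: step_poly_def poly_monom power_divide)

lemma step_poly_range:
  assumes "0 < M" "0 \<le> z" "z \<le> real M"
  shows "0 \<le> poly (step_poly M k) z" "poly (step_poly M k) z \<le> 1"
proof -
  have "0 \<le> (z / real M) ^ k" "(z / real M) ^ k \<le> 1" using assms by (auto intro!: power_le_one)
  then show "0 \<le> poly (step_poly M k) z" "poly (step_poly M k) z \<le> 1"
    unfolding poly_step_poly by (auto intro!: power_le_one)
qed

lemma step_poly_lower:
  assumes "0 < M" "0 \<le> z" "z \<le> real M"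
  shows "1 - z ^ k \<le> poly (step_poly M k) z"
proof -
  have "(z / real M) ^ k \<le> 1" using assms by (auto intro!: power_le_one)
  then have "1 + real (M ^ k) * (- ((z / real M) ^ k)) \<le> (1 + - ((z / real M) ^ k)) ^ (M ^ k)"
    by (intro Bernoulli_inequality) simp
  moreover have "real (M ^ k) * (- ((z / real M) ^ k)) = - (z ^ k)"
    using assms by (simp add: power_divide)
  ultimately show ?thesis by (simp add: poly_step_poly)
qed

lemma step_poly_upper:
  assumes "0 < M" "0 \<le> z" "z \<le> real M"
  shows "poly (step_poly M k) z \<le> exp (- (z ^ k))"
proof -
  have "0 \<le> 1 - (z / real M) ^ k" using assms by (auto intro!: power_le_one)
  moreover have "1 - (z / real M) ^ k \<le> exp (- ((z / real M) ^ k))"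
    using exp_ge_add_one_self[of "- ((z / real M) ^ k)"] by simp
  ultimately have "(1 - (z / real M) ^ k) ^ (M ^ k) \<le> exp (- ((z / real M) ^ k)) ^ (M ^ k)"
    by (intro power_mono)
  also have "\<dots> = exp (real (M ^ k) * - ((z / real M) ^ k))" by (rule exp_of_nat_mult[symmetric])
  also have "real (M ^ k) * - ((z / real M) ^ k) = - (z ^ k)"
    using assms by (simp add: power_divide)
  finally show ?thesis by (simp add: poly_step_poly)
qed

text \<open>The jump at \<open>z = 1\<close> is excluded; in the application it corresponds to
  points on the spheres, a null set.\<close>

lemma step_poly_tendsto:
  assumes "0 < M" "0 \<le> z" "z \<le> real M" "z \<noteq> 1"
  shows "(\<lambda>k. poly (step_poly M k) z) \<longlonglongrightarrow> (if z < 1 then 1 else 0)"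
proof (cases "z < 1")
  case True
  have "(\<lambda>k. 1 - z ^ k) \<longlonglongrightarrow> 1 - 0"
    using True assms by (intro tendsto_diff tendsto_const LIMSEQ_power_zero) auto
  then have lim: "(\<lambda>k. 1 - z ^ k) \<longlonglongrightarrow> 1" by simp
  have "(\<lambda>k. poly (step_poly M k) z) \<longlonglongrightarrow> 1"
  proof (rule tendsto_sandwich[OF _ _ lim tendsto_const])
    show "\<forall>\<^sub>F k in sequentially. 1 - z ^ k \<le> poly (step_poly M k) z"
      by (rule always_eventually) (rule allI, rule step_poly_lower[OF assms(1-3)])
    show "\<forall>\<^sub>F k in sequentially. poly (step_poly M k) z \<le> 1"
      by (rule always_eventually) (rule allI, rule step_poly_range(2)[OF assms(1-3)])
  qed
  then show ?thesis using True by simp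
next
  case False
  then have "1 < z" using assms by simp
  then have "filterlim (\<lambda>k. z ^ k) at_top sequentially"
    by (intro filterlim_at_infinity_imp_filterlim_at_top filterlim_realpow_sequentially_gt1 always_eventually) auto
  then have "filterlim (\<lambda>k. - (z ^ k)) at_bot sequentially" by (simp add: filterlim_uminus_at_bot)
  then have lim: "(\<lambda>k. exp (- (z ^ k))) \<longlonglongrightarrow> 0" by (rule filterlim_compose[OF exp_at_bot])
  have "(\<lambda>k. poly (step_poly M k) z) \<longlonglongrightarrow> 0"
  proof (rule tendsto_sandwich[OF _ _ tendsto_const lim])
    show "\<forall>\<^sub>F k in sequentially. 0 \<le> poly (step_poly M k) z"
      by (rule always_eventually) (rule allI, rule step_poly_range(1)[OF assms(1-3)])
    show "\<forall>\<^sub>F k in sequentially. poly (step_poly M k) z \<le> exp (- (z ^ k))"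
      by (rule always_eventually) (rule allI, rule step_poly_upper[OF assms(1-3)])
  qed
  then show ?thesis using False by simp
qed

text \<open>A bound uniform in \<open>k\<close>, giving an integrable majorant for dominated
  convergence. The index starts at 1 because \<open>step_poly M 0\<close> is the zero
  polynomial.\<close>

lemma step_poly_lower_linear:
  assumes "0 < M" "0 \<le> z" "z \<le> real M"
  shows "1 - poly (step_poly M (Suc k)) z \<le> z"
proof (cases "z \<le> 1")
  case True
  have "z ^ Suc k \<le> z * 1" using True assms unfolding power_Suc by (intro mult_left_mono power_le_one) auto
  then show ?thesis using step_poly_lower[OF assms, of "Suc k"] by simp
next
  case False
  then show ?thesis using step_poly_range(1)[OF assms, of "Suc k"] by simp
qed

lemma step_poly_deriv:
  "poly (pderiv (step_poly M k)) z =
    - (real (M ^ k) * (1 - (z / real M) ^ k) ^ (M ^ k - 1) * (real k * (z / real M) ^ (k - 1) / real M))"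
proof (rule DERIV_unique)
  show "((\<lambda>z. poly (step_poly M k) z) has_real_derivative poly (pderiv (step_poly M k)) z) (at z)"
    by (rule poly_DERIV)
  have "((\<lambda>z. (z / real M) ^ k) has_real_derivative real k * (1 / real M * (z / real M) ^ (k - Suc 0))) (at z)"
    by (rule DERIV_power) (rule DERIV_cdivide[OF DERIV_ident])
  then have "((\<lambda>z. 1 - (z / real M) ^ k) has_real_derivative 0 - real k * (1 / real M * (z / real M) ^ (k - Suc 0))) (at z)"
    by (intro DERIV_diff DERIV_const)
  from DERIV_power[OF this, of "M ^ k"]
  show "((\<lambda>z. poly (step_poly M k) z) has_real_derivative
    - (real (M ^ k) * (1 - (z / real M) ^ k) ^ (M ^ k - 1) * (real k * (z / real M) ^ (k - 1) / real M))) (at z)"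
    unfolding poly_step_poly by (rule DERIV_cong) (simp add: mult_ac)
qed

lemma step_poly_deriv_nonpos:
  assumes "0 < M" "0 \<le> z" "z \<le> real M"
  shows "poly (pderiv (step_poly M k)) z \<le> 0"
proof -
  have "(z / real M) ^ k \<le> 1" using assms by (auto intro!: power_le_one)
  then show ?thesis unfolding step_poly_deriv using assms by (auto intro!: mult_nonneg_nonneg)
qed

lemma monotone_step_poly:
  assumes "0 < M"
  shows "monotone_poly_on (real M) (step_poly M k)" "monotone_poly_on (real M) (1 - step_poly M k)"
  using step_poly_range[OF assms] step_poly_deriv_nonpos[OF assms]
  by (simp_all add: monotone_poly_on_def pderiv_diff mult_nonpos_nonpos)

lemma coeff_step_poly_0: "0 < M \<Longrightarrow> coeff (step_poly M (Suc k)) 0 = 1"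
  by (simp add: poly_0_coeff_0[symmetric] poly_step_poly)

section \<open>From polynomials in Gaussians to indicators of unions and intersections\<close>

lemma one_minus_prod_le:
  fixes a :: "'i \<Rightarrow> real"
  assumes "finite I" "\<And>i. i \<in> I \<Longrightarrow> 0 \<le> a i \<and> a i \<le> 1"
  shows "1 - (\<Prod>i\<in>I. a i) \<le> (\<Sum>i\<in>I. 1 - a i)"
  using assms
proof (induction I)
  case (insert i I)
  have P: "(\<Prod>i\<in>I. a i) \<le> 1" using insert.prems by (intro prod_le_1) auto
  have "a i * (1 - (\<Prod>i\<in>I. a i)) \<le> 1 * (1 - (\<Prod>i\<in>I. a i))"
    using P insert.prems by (intro mult_right_mono) auto
  also have "\<dots> \<le> (\<Sum>i\<in>I. 1 - a i)" using insert.IH insert.prems by simp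
  finally show ?case using insert.hyps by (simp add: algebra_simps)
qed simp

lemma AE_power_dist_neq:
  fixes q :: "nat \<Rightarrow> 'a::euclidean_space"
  assumes "finite I"
  shows "AE x in lborel. \<forall>i\<in>I. power_dist q r i x \<noteq> s"
proof -
  have "AE x in lborel. power_dist q r i x \<noteq> s" for i
  proof (rule AE_I')
    have "negligible (sphere (q i) (sqrt ((r i)\<^sup>2 + s)))" by (rule negligible_sphere)
    then show "sphere (q i) (sqrt ((r i)\<^sup>2 + s)) \<in> null_sets lborel"
      by (intro null_setsI negligible_imp_emeasure_lborel) auto
    show "{x \<in> space lborel. \<not> power_dist q r i x \<noteq> s} \<subseteq> sphere (q i) (sqrt ((r i)\<^sup>2 + s))"
    proof
      fix x assume "x \<in> {x \<in> space lborel. \<not> power_dist q r i x \<noteq> s}"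
      then have "(dist x (q i))\<^sup>2 = (r i)\<^sup>2 + s" by (simp add: power_dist_def)
      then have "dist x (q i) = sqrt ((r i)\<^sup>2 + s)"
        by (metis real_sqrt_abs abs_of_nonneg zero_le_dist)
      then show "x \<in> sphere (q i) (sqrt ((r i)\<^sup>2 + s))" by (simp add: dist_commute)
    qed
  qed
  then show ?thesis using assms by (simp add: AE_ball_countable countable_finite)
qed

text \<open>With the weights exp (r_i^2) this is exp (s - power), so for s \<ge> 0 the ball of
  radius sqrt (r_i^2 + s) is where the level is at least 1, the threshold of the step
  polynomials.\<close>

definition gauss_level :: "(nat \<Rightarrow> 'a::euclidean_space) \<Rightarrow> (nat \<Rightarrow> real) \<Rightarrow> real \<Rightarrow> nat \<Rightarrow> 'a \<Rightarrow> real" where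
  "gauss_level q r s i x = exp s * exp ((r i)\<^sup>2) * exp (- (dist x (q i))\<^sup>2)"

context
  fixes N M :: nat and r :: "nat \<Rightarrow> real" and s :: real and q :: "nat \<Rightarrow> 'a::euclidean_space"
  assumes N: "1 \<le> N" and s: "0 \<le> s" and M: "0 < M"
    and w_le: "\<And>i. i \<in> {1..N} \<Longrightarrow> exp s * exp ((r i)\<^sup>2) \<le> real M"
begin

lemma gauss_level_exp: "gauss_level q r s i x = exp (s - power_dist q r i x)"
  by (simp add: gauss_level_def power_dist_def exp_add[symmetric])

lemma gauss_level_range: "i \<in> {1..N} \<Longrightarrow> 0 \<le> gauss_level q r s i x" "i \<in> {1..N} \<Longrightarrow> gauss_level q r s i x \<le> real M"
proof -
  assume i: "i \<in> {1..N}"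
  have "gauss_level q r s i x \<le> exp s * exp ((r i)\<^sup>2) * 1"
    unfolding gauss_level_def by (intro mult_left_mono) auto
  then show "gauss_level q r s i x \<le> real M" using w_le[OF i] by simp
qed (simp add: gauss_level_exp)

lemma integrable_gauss_level: "integrable lborel (gauss_level q r s i)"
proof -
  have "integrable lborel (\<lambda>x. exp (- (\<Sum>j\<in>{i}. 1 * (dist x (q j))\<^sup>2)))"
    by (rule integrable.intros[OF gauss_mixture_integral]) simp
  then show ?thesis unfolding gauss_level_def by (intro integrable_mult_right) simp
qed

text \<open>Dominated convergence, with the subtracted constant term carried along: the limit of the
  products is \<open>F + c\<close>, and \<open>F\<close> is what remains integrable. The constant is
  0 for intersections and 1 for unions.\<close>

lemma mix_integral_tendsto:
  fixes F b :: "'a \<Rightarrow> real"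
  assumes F: "F \<in> borel_measurable lborel" and b: "integrable lborel b"
    and c: "\<And>k. coeff (Q k) 0 ^ N = c"
    and lim: "\<And>x. (\<And>i. i \<in> {1..N} \<Longrightarrow> gauss_level q r s i x \<noteq> 1) \<Longrightarrow>
      (\<lambda>k. \<Prod>i\<in>{1..N}. poly (Q k) (gauss_level q r s i x)) \<longlonglongrightarrow> F x + c"
    and bound: "\<And>k x. \<bar>(\<Prod>i\<in>{1..N}. poly (Q k) (gauss_level q r s i x)) - c\<bar> \<le> b x"
  shows "(\<lambda>k. mix_integral {1..N} (Q k) (\<lambda>i. exp ((r i)\<^sup>2)) q s) \<longlonglongrightarrow> integral\<^sup>L lborel F"
proof -
  let ?f = "\<lambda>k x. (\<Prod>i\<in>{1..N}. poly (Q k) (gauss_level q r s i x)) - c"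
  have f: "has_bochner_integral lborel (?f k) (mix_integral {1..N} (Q k) (\<lambda>i. exp ((r i)\<^sup>2)) q s)" for k
    using mix_integral_has_integral[of "{1..N}" "Q k" s "\<lambda>i. exp ((r i)\<^sup>2)" q]
    by (simp add: gauss_level_def c)
  have "(\<lambda>k. integral\<^sup>L lborel (?f k)) \<longlonglongrightarrow> integral\<^sup>L lborel F"
  proof (rule integral_dominated_convergence[OF F _ b])
    show "?f k \<in> borel_measurable lborel" for k using f[of k] by (auto simp: has_bochner_integral_iff)
    show "AE x in lborel. (\<lambda>k. ?f k x) \<longlonglongrightarrow> F x"
      using AE_power_dist_neq[of "{1..N}" q r s, OF finite_atLeastAtMost]
    proof eventually_elim
      case (elim x)
      then have "(\<lambda>k. \<Prod>i\<in>{1..N}. poly (Q k) (gauss_level q r s i x)) \<longlonglongrightarrow> F x + c"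
        by (intro lim) (auto simp: gauss_level_exp)
      from tendsto_diff[OF this tendsto_const[of c]] show ?case by simp
    qed
    show "AE x in lborel. norm (?f k x) \<le> b x" for k by (rule AE_I2) (use bound in simp)
  qed
  then show ?thesis by (simp only: has_bochner_integral_integral_eq[OF f])
qed

lemma gauss_level_limit:
  assumes "i \<in> {1..N}" "gauss_level q r s i x \<noteq> 1"
  shows "(\<lambda>k. poly (step_poly M (Suc k)) (gauss_level q r s i x)) \<longlonglongrightarrow> (if power_dist q r i x \<le> s then 0 else 1)"
proof -
  have "gauss_level q r s i x < 1 \<longleftrightarrow> \<not> power_dist q r i x \<le> s"
    by (auto simp: gauss_level_exp)
  then show ?thesis
    using LIMSEQ_Suc[OF step_poly_tendsto[OF M gauss_level_range[OF assms(1)] assms(2)]] by (simp split: if_splits)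
qed

lemma gauss_level_step_range:
  assumes "i \<in> {1..N}"
  shows "0 \<le> poly (step_poly M (Suc k)) (gauss_level q r s i x)"
    "poly (step_poly M (Suc k)) (gauss_level q r s i x) \<le> 1"
    "1 - poly (step_poly M (Suc k)) (gauss_level q r s i x) \<le> gauss_level q r s i x"
  using step_poly_range[OF M gauss_level_range(1,2)[OF assms]]
    step_poly_lower_linear[OF M gauss_level_range(1,2)[OF assms]] by simp_all

text \<open>The factors tend to the indicators of the balls, so the product tends to that of the
  intersection.\<close>

lemma mix_integral_inter_tendsto:
  "(\<lambda>k. mix_integral {1..N} (1 - step_poly M (Suc k)) (\<lambda>i. exp ((r i)\<^sup>2)) q s)
    \<longlonglongrightarrow> measure lebesgue (ball_inter N q (shifted_radii r s))"
proof -
  let ?X = "ball_inter N q (shifted_radii r s)" and ?z = "gauss_level q r s"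
  have X: "?X \<in> sets borel"
    unfolding ball_inter_def using N by (intro borel_compact compact_Inter) auto
  have "(\<lambda>k. mix_integral {1..N} (1 - step_poly M (Suc k)) (\<lambda>i. exp ((r i)\<^sup>2)) q s)
    \<longlonglongrightarrow> integral\<^sup>L lborel (indicator ?X :: 'a \<Rightarrow> real)"
  proof (rule mix_integral_tendsto[where c = 0 and b = "?z 1"])
    fix x :: 'a assume z: "\<And>i. i \<in> {1..N} \<Longrightarrow> ?z i x \<noteq> 1"
    have "(\<lambda>k. \<Prod>i\<in>{1..N}. 1 - poly (step_poly M (Suc k)) (?z i x))
        \<longlonglongrightarrow> (\<Prod>i\<in>{1..N}. 1 - (if power_dist q r i x \<le> s then 0 else 1))"
      by (intro tendsto_prod tendsto_diff tendsto_const gauss_level_limit z)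
    moreover have "(\<Prod>i\<in>{1..N}. 1 - (if power_dist q r i x \<le> s then 0 else 1)) = (indicator ?X x :: real)"
    proof (cases "x \<in> ?X")
      case True
      then show ?thesis
        by (intro trans[OF prod.neutral]) (auto simp: ball_inter_def mem_cball_shifted[OF s] simp del: mem_cball)
    next
      case False
      then obtain i where "i \<in> {1..N}" "\<not> power_dist q r i x \<le> s"
        unfolding ball_inter_def INT_iff mem_cball_shifted[OF s] by blast
      then show ?thesis
        using False by (intro trans[OF prod_zero]) (auto intro!: bexI[of _ i])
    qed
    ultimately show "(\<lambda>k. \<Prod>i\<in>{1..N}. poly (1 - step_poly M (Suc k)) (?z i x)) \<longlonglongrightarrow> indicator ?X x + 0"
      by simp
  next
    fix k :: nat and x :: 'a
    let ?P = "\<lambda>i. 1 - poly (step_poly M (Suc k)) (?z i x)"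
    have P: "0 \<le> ?P i \<and> ?P i \<le> 1" if "i \<in> {1..N}" for i
      using gauss_level_step_range(1,2)[OF that, of k x] by simp
    \<comment> \<open>A single factor already gives an integrable bound, as the others are at most
      1; index 1 exists because \<open>N\<close> is positive.\<close>
    have "(\<Prod>i\<in>{1..N}. ?P i) = ?P 1 * (\<Prod>i\<in>{1..N} - {1}. ?P i)" using N by (intro prod.remove) auto
    also have "\<dots> \<le> ?P 1 * 1" using N P by (intro mult_left_mono prod_le_1) auto
    also have "\<dots> \<le> ?z 1 x" using gauss_level_step_range(3)[of 1 k x] N by simp
    finally have "(\<Prod>i\<in>{1..N}. ?P i) \<le> ?z 1 x" .
    moreover have "0 \<le> (\<Prod>i\<in>{1..N}. ?P i)" using P by (intro prod_nonneg) auto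
    ultimately show "\<bar>(\<Prod>i\<in>{1..N}. poly (1 - step_poly M (Suc k)) (?z i x)) - 0\<bar> \<le> ?z 1 x" by simp
  qed (use N M X in \<open>auto simp: integrable_gauss_level coeff_step_poly_0 power_0_left\<close>)
  then show ?thesis using X by (simp add: measure_completion)
qed

text \<open>The factors tend to the indicators of the complements, whose product is 1 minus the
  indicator of the union. Subtracting the constant term 1 leaves minus the volume; the majorant is
  the sum of the levels.\<close>

lemma mix_integral_union_tendsto:
  "(\<lambda>k. mix_integral {1..N} (step_poly M (Suc k)) (\<lambda>i. exp ((r i)\<^sup>2)) q s)
    \<longlonglongrightarrow> - measure lebesgue (ball_union N q (shifted_radii r s))"
proof -
  let ?X = "ball_union N q (shifted_radii r s)" and ?z = "gauss_level q r s"
  have X: "?X \<in> sets borel" unfolding ball_union_def by (intro borel_compact compact_UN) auto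
  have "(\<lambda>k. mix_integral {1..N} (step_poly M (Suc k)) (\<lambda>i. exp ((r i)\<^sup>2)) q s)
    \<longlonglongrightarrow> integral\<^sup>L lborel (\<lambda>x. - (indicator ?X x :: real))"
  proof (rule mix_integral_tendsto[where c = 1 and b = "\<lambda>x. \<Sum>i\<in>{1..N}. ?z i x"])
    fix x :: 'a assume z: "\<And>i. i \<in> {1..N} \<Longrightarrow> ?z i x \<noteq> 1"
    have "(\<lambda>k. \<Prod>i\<in>{1..N}. poly (step_poly M (Suc k)) (?z i x))
        \<longlonglongrightarrow> (\<Prod>i\<in>{1..N}. if power_dist q r i x \<le> s then 0 else 1)"
      by (intro tendsto_prod gauss_level_limit z)
    moreover have "(\<Prod>i\<in>{1..N}. if power_dist q r i x \<le> s then 0 else 1) = 1 - (indicator ?X x :: real)"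
    proof (cases "x \<in> ?X")
      case True
      then obtain i where "i \<in> {1..N}" "power_dist q r i x \<le> s"
        unfolding ball_union_def UN_iff mem_cball_shifted[OF s] by blast
      then show ?thesis
        using True by (intro trans[OF prod_zero]) (auto intro!: bexI[of _ i])
    next
      case False
      then show ?thesis
        by (intro trans[OF prod.neutral]) (auto simp: ball_union_def mem_cball_shifted[OF s] simp del: mem_cball)
    qed
    ultimately show "(\<lambda>k. \<Prod>i\<in>{1..N}. poly (step_poly M (Suc k)) (?z i x)) \<longlonglongrightarrow> - indicator ?X x + 1"
      by simp
  next
    fix k :: nat and x :: 'a
    let ?P = "\<lambda>i. poly (step_poly M (Suc k)) (?z i x)"
    have P: "0 \<le> ?P i \<and> ?P i \<le> 1" if "i \<in> {1..N}" for i
      using gauss_level_step_range(1,2)[OF that, of k x] by simp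
    have "1 - (\<Prod>i\<in>{1..N}. ?P i) \<le> (\<Sum>i\<in>{1..N}. 1 - ?P i)"
      by (rule one_minus_prod_le[OF finite_atLeastAtMost P])
    also have "\<dots> \<le> (\<Sum>i\<in>{1..N}. ?z i x)" by (intro sum_mono gauss_level_step_range)
    finally have "1 - (\<Prod>i\<in>{1..N}. ?P i) \<le> (\<Sum>i\<in>{1..N}. ?z i x)" .
    moreover have "(\<Prod>i\<in>{1..N}. ?P i) \<le> 1" using P by (rule prod_le_1)
    ultimately show "\<bar>(\<Prod>i\<in>{1..N}. ?P i) - 1\<bar> \<le> (\<Sum>i\<in>{1..N}. ?z i x)" by simp
  qed (use M X in \<open>auto simp: integrable_gauss_level coeff_step_poly_0\<close>)
  then show ?thesis using X by (simp add: measure_completion)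
qed

end

section \<open>Expanding motions and the limit inequalities for volumes\<close>

lemma smooth_on_continuous: "smooth_on S f \<Longrightarrow> continuous_on S f"
proof -
  assume "smooth_on S f"
  then obtain D where D: "\<And>t. t \<in> S \<Longrightarrow> D 0 t = f t"
    "\<And>k t. t \<in> S \<Longrightarrow> (D k has_vector_derivative D (Suc k) t) (at t within S)"
    unfolding smooth_on_def by blast
  have "continuous_on S (D 0)"
    using D(2)[of _ 0] has_vector_derivative_continuous continuous_on_eq_continuous_within by blast
  then show "continuous_on S f" by (rule continuous_on_eq) (use D(1) in auto)
qed

lemma smooth_on_interior_derivative:
  assumes "smooth_on {a..b} f" "a < t" "t < b"
  obtains v where "(f has_vector_derivative v) (at t)"
proof -
  obtain D where D: "\<And>t. t \<in> {a..b} \<Longrightarrow> D 0 t = f t"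
    "\<And>k t. t \<in> {a..b} \<Longrightarrow> (D k has_vector_derivative D (Suc k) t) (at t within {a..b})"
    using assms(1) unfolding smooth_on_def by blast
  have "(D 0 has_vector_derivative D (Suc 0) t) (at t within {a..b})"
    using assms by (intro D(2)) auto
  then have "(f has_vector_derivative D (Suc 0) t) (at t within {a..b})"
    by (rule has_vector_derivative_transform_within[where d = 1]) (use assms D(1) in auto)
  then have "(f has_vector_derivative D (Suc 0) t) (at t)"
    using assms by (simp add: at_within_Icc_at)
  then show thesis by (rule that)
qed

text \<open>The square of the distance is an inner product of differences, hence differentiable by
  the product rule, and it inherits monotonicity from the distance.\<close>

lemma distance_square_derivative_nonneg:
  fixes f g :: "real \<Rightarrow> 'a::real_inner"
  assumes "(f has_vector_derivative f') (at t)" "(g has_vector_derivative g') (at t)"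
    and mono: "mono_on {0..1} (\<lambda>t. dist (f t) (g t))" and t: "0 < t" "t < 1"
  shows "\<exists>D\<ge>0. ((\<lambda>t. (dist (f t) (g t))\<^sup>2) has_real_derivative D) (at t)"
proof -
  have "((\<lambda>t. (f t - g t) \<bullet> (f t - g t)) has_vector_derivative
      (f t - g t) \<bullet> (f' - g') + (f' - g') \<bullet> (f t - g t)) (at t)"
    by (intro bounded_bilinear.has_vector_derivative[OF bounded_bilinear_inner] has_vector_derivative_diff assms)
  then obtain D where D: "((\<lambda>t. (dist (f t) (g t))\<^sup>2) has_real_derivative D) (at t)"
    by (simp add: has_real_derivative_iff_has_vector_derivative dist_norm power2_norm_eq_inner)
  have "mono_on {0..1} (\<lambda>t. (dist (f t) (g t))\<^sup>2)"
    using mono by (auto simp: mono_on_def intro: power_mono)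
  then have "0 \<le> D" by (rule mono_on_imp_deriv_nonneg[OF _ D]) (use t in simp)
  then show ?thesis using D by blast
qed

context
  fixes N :: nat and p :: "real \<Rightarrow> nat \<Rightarrow> 'a::euclidean_space" and r :: "nat \<Rightarrow> real" and t1 t2 :: real
  assumes N: "1 \<le> N" and smooth: "smooth_motion N p" and expanding: "expanding_motion N p"
    and t: "0 \<le> t1" "t1 \<le> t2" "t2 \<le> 1"
begin

lemma distance_square_continuous:
  assumes "i \<in> {1..N}" "j \<in> {1..N}"
  shows "continuous_on {t1..t2} (\<lambda>t. (dist (p t i) (p t j))\<^sup>2)"
proof -
  have "continuous_on {t1..t2} (\<lambda>t. p t k)" if "k \<in> {1..N}" for k
  proof (rule continuous_on_subset[OF smooth_on_continuous])
    show "smooth_on {0..1} (\<lambda>t. p t k)" using smooth that by (simp add: smooth_motion_def)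
  qed (use t in auto)
  then show ?thesis using assms by (intro continuous_intros) auto
qed

lemma distance_square_derivative:
  assumes "i \<in> {1..N}" "j \<in> {1..N}" "t1 < \<tau>" "\<tau> < t2"
  shows "\<exists>D\<ge>0. ((\<lambda>t. (dist (p t i) (p t j))\<^sup>2) has_real_derivative D) (at \<tau>)"
proof -
  have \<tau>: "0 < \<tau>" "\<tau> < 1" using assms t by auto
  have "smooth_on {0..1} (\<lambda>t. p t i)" "smooth_on {0..1} (\<lambda>t. p t j)"
    using smooth assms by (auto simp: smooth_motion_def)
  then obtain v v' where "((\<lambda>t. p t i) has_vector_derivative v) (at \<tau>)" "((\<lambda>t. p t j) has_vector_derivative v') (at \<tau>)"
    using \<tau> smooth_on_interior_derivative by metis
  then show ?thesis
    using expanding assms \<tau> by (intro distance_square_derivative_nonneg) (auto simp: expanding_motion_def)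
qed

lemma weight_bound:
  obtains M :: nat where "0 < M" "\<And>i. i \<in> {1..N} \<Longrightarrow> exp s' * exp ((r i)\<^sup>2) \<le> real M"
proof -
  obtain M where M: "Max ((\<lambda>i. exp s' * exp ((r i)\<^sup>2)) ` {1..N}) \<le> real M"
    using real_arch_simple by blast
  have le: "exp s' * exp ((r i)\<^sup>2) \<le> real M" if "i \<in> {1..N}" for i
    using M that by (meson Max_ge finite_atLeastAtMost finite_imageI imageI order_trans)
  have "0 < exp s' * exp ((r 1)\<^sup>2)" by simp
  also have "\<dots> \<le> real M" using le N by simp
  finally show thesis using le by (intro that) simp_all
qed

text \<open>The inequality is stated for differences at four parameter pairs, so it survives the
  limit in \<open>k\<close> although nothing is known about derivatives of \<open>L\<close>.\<close>

lemma mix_limit_difference_antimono: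
  fixes Q :: "nat \<Rightarrow> real poly" and L :: "real \<Rightarrow> real \<Rightarrow> real"
  assumes s: "s \<le> s'"
    and w: "\<And>i. i \<in> {1..N} \<Longrightarrow> 0 \<le> w i \<and> exp s' * w i \<le> M"
    and Q: "\<And>k. monotone_poly_on M (Q k)"
    and lim: "\<And>\<tau> \<sigma>. \<sigma> \<in> {s, s'} \<Longrightarrow> (\<lambda>k. mix_integral {1..N} (Q k) w (p \<tau>) \<sigma>) \<longlonglongrightarrow> L \<tau> \<sigma>"
  shows "L t2 s' - L t1 s' \<le> L t2 s - L t1 s"
proof (rule LIMSEQ_le[OF tendsto_diff[OF lim lim] tendsto_diff[OF lim lim]])
  show "\<exists>K. \<forall>k\<ge>K. mix_integral {1..N} (Q k) w (p t2) s' - mix_integral {1..N} (Q k) w (p t1) s'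
      \<le> mix_integral {1..N} (Q k) w (p t2) s - mix_integral {1..N} (Q k) w (p t1) s"
    by (intro exI[of _ 0] allI impI mix_integral_difference_antimono[OF finite_atLeastAtMost t(2) s
          distance_square_continuous distance_square_derivative w Q])
qed simp_all

lemma inter_volume_difference_antimono:
  assumes s: "0 \<le> s" "s \<le> s'"
  defines "V \<equiv> \<lambda>t s. measure lebesgue (ball_inter N (p t) (shifted_radii r s))"
  shows "V t2 s' - V t1 s' \<le> V t2 s - V t1 s"
proof -
  obtain M :: nat where M: "0 < M" "\<And>i. i \<in> {1..N} \<Longrightarrow> exp s' * exp ((r i)\<^sup>2) \<le> real M"
    using weight_bound by blast
  show ?thesis
  proof (rule mix_limit_difference_antimono[where Q = "\<lambda>k. 1 - step_poly M (Suc k)"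
        and w = "\<lambda>i. exp ((r i)\<^sup>2)" and M = "real M"])
    show "(\<lambda>k. mix_integral {1..N} (1 - step_poly M (Suc k)) (\<lambda>i. exp ((r i)\<^sup>2)) (p \<tau>) \<sigma>) \<longlonglongrightarrow> V \<tau> \<sigma>"
      if "\<sigma> \<in> {s, s'}" for \<tau> \<sigma>
      unfolding V_def
    proof (rule mix_integral_inter_tendsto[OF N _ M(1)])
      show "exp \<sigma> * exp ((r i)\<^sup>2) \<le> real M" if "i \<in> {1..N}" for i
        using order_trans[OF mult_right_mono M(2)[OF that], of "exp \<sigma>"] \<open>\<sigma> \<in> {s, s'}\<close> s by auto
    qed (use that s in auto)
  qed (use s M(2) monotone_step_poly[OF M(1)] in auto)
qed

text \<open>The polynomial integrals converge to minus the volume, which reverses the inequality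
  obtained for intersections.\<close>

lemma union_volume_difference_mono:
  assumes s: "0 \<le> s" "s \<le> s'"
  defines "V \<equiv> \<lambda>t s. measure lebesgue (ball_union N (p t) (shifted_radii r s))"
  shows "V t2 s - V t1 s \<le> V t2 s' - V t1 s'"
proof -
  obtain M :: nat where M: "0 < M" "\<And>i. i \<in> {1..N} \<Longrightarrow> exp s' * exp ((r i)\<^sup>2) \<le> real M"
    using weight_bound by blast
  have "- V t2 s' - - V t1 s' \<le> - V t2 s - - V t1 s"
  proof (rule mix_limit_difference_antimono[where Q = "\<lambda>k. step_poly M (Suc k)"
        and w = "\<lambda>i. exp ((r i)\<^sup>2)" and M = "real M" and L = "\<lambda>t s. - V t s"])
    show "(\<lambda>k. mix_integral {1..N} (step_poly M (Suc k)) (\<lambda>i. exp ((r i)\<^sup>2)) (p \<tau>) \<sigma>) \<longlonglongrightarrow> - V \<tau> \<sigma>"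
      if "\<sigma> \<in> {s, s'}" for \<tau> \<sigma>
      unfolding V_def
    proof (rule mix_integral_union_tendsto[OF N _ M(1)])
      show "exp \<sigma> * exp ((r i)\<^sup>2) \<le> real M" if "i \<in> {1..N}" for i
        using order_trans[OF mult_right_mono M(2)[OF that], of "exp \<sigma>"] \<open>\<sigma> \<in> {s, s'}\<close> s by auto
    qed (use that s in auto)
  qed (use s M(2) monotone_step_poly[OF M(1)] in auto)
  then show ?thesis by simp
qed

end

lemma right_derivative_le:
  fixes f g :: "real \<Rightarrow> real"
  assumes f: "(f has_real_derivative f') (at 0 within {0..})" and g: "(g has_real_derivative g') (at 0 within {0..})"
    and le: "\<And>s. 0 \<le> s \<Longrightarrow> f s - f 0 \<le> g s - g 0"
  shows "f' \<le> g'"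
proof (rule tendsto_le)
  show "((\<lambda>s. (f s - f 0) / (s - 0)) \<longlongrightarrow> f') (at_right 0)" "((\<lambda>s. (g s - g 0) / (s - 0)) \<longlongrightarrow> g') (at_right 0)"
    using f g by (simp_all only: has_field_derivative_iff at_within_Ici_at_right)
  show "\<forall>\<^sub>F s in at_right 0. (f s - f 0) / (s - 0) \<le> (g s - g 0) / (s - 0)"
    using eventually_at_right_less[of "0::real"]
  proof eventually_elim
    case (elim s)
    then show ?case using le[of s] by (intro divide_right_mono) auto
  qed
qed simp

text \<open>The directions of monotonicity are made explicit: under an expanding motion the weighted
  boundary volume grows for the union and falls for the intersection.\<close>

theorem theorem3:
  fixes N :: nat
    and r :: "nat \<Rightarrow> real"
    and p :: "real \<Rightarrow> nat \<Rightarrow> 'a::euclidean_space"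
  assumes dim: "DIM('a) \<ge> 2"
    and N: "N \<ge> 1"
    and radii: "\<And>i. i \<in> {1..N} \<Longrightarrow> r i > 0"
    and smooth: "smooth_motion N p"
    and distinct: "\<And>t. t \<in> {0..1} \<Longrightarrow> inj_on (p t) {1..N}"
  shows "(\<forall>t\<in>{0..1}.
            ((\<lambda>s. measure lebesgue (ball_union N (p t) (shifted_radii r s)))
               has_real_derivative 1/2 * (\<Sum>i=1..N. union_face_volume N (p t) r i / r i))
              (at 0 within {0..}) \<and>
            ((\<lambda>s. measure lebesgue (ball_inter N (p t) (shifted_radii r s)))
               has_real_derivative 1/2 * (\<Sum>i=1..N. inter_face_volume N (p t) r i / r i))
              (at 0 within {0..})) \<and>
         (expanding_motion N p \<longrightarrow>
            mono_on {0..1} (\<lambda>t. 1/2 * (\<Sum>i=1..N. union_face_volume N (p t) r i / r i)) \<and>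
            antimono_on {0..1} (\<lambda>t. 1/2 * (\<Sum>i=1..N. inter_face_volume N (p t) r i / r i)))"
proof (intro conjI ballI impI)
  note U = union_volume_derivative[OF dim radii distinct N] and I = inter_volume_derivative[OF dim radii distinct N]
  fix t :: real assume t: "t \<in> {0..1}"
  show "((\<lambda>s. measure lebesgue (ball_union N (p t) (shifted_radii r s)))
      has_real_derivative 1/2 * (\<Sum>i=1..N. union_face_volume N (p t) r i / r i)) (at 0 within {0..})"
    by (rule U[OF _ t])
  show "((\<lambda>s. measure lebesgue (ball_inter N (p t) (shifted_radii r s)))
      has_real_derivative 1/2 * (\<Sum>i=1..N. inter_face_volume N (p t) r i / r i)) (at 0 within {0..})"
    by (rule I[OF _ t])
next
  note U = union_volume_derivative[OF dim radii distinct N] and I = inter_volume_derivative[OF dim radii distinct N]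
  assume exp: "expanding_motion N p"
  show "mono_on {0..1} (\<lambda>t. 1/2 * (\<Sum>i=1..N. union_face_volume N (p t) r i / r i))"
  proof (rule mono_onI)
    let ?V = "\<lambda>t s. measure lebesgue (ball_union N (p t) (shifted_radii r s))"
    fix t1 t2 :: real assume t: "t1 \<in> {0..1}" "t2 \<in> {0..1}" "t1 \<le> t2"
    show "1/2 * (\<Sum>i=1..N. union_face_volume N (p t1) r i / r i) \<le> 1/2 * (\<Sum>i=1..N. union_face_volume N (p t2) r i / r i)"
    proof (rule right_derivative_le[OF U[OF _ t(1)] U[OF _ t(2)]])
      fix s :: real assume "0 \<le> s"
      then show "?V t1 s - ?V t1 0 \<le> ?V t2 s - ?V t2 0"
        using union_volume_difference_mono[OF N smooth exp, of t1 t2 0 s r] t by simp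
    qed
  qed
  show "antimono_on {0..1} (\<lambda>t. 1/2 * (\<Sum>i=1..N. inter_face_volume N (p t) r i / r i))"
  proof (rule monotone_onI)
    let ?V = "\<lambda>t s. measure lebesgue (ball_inter N (p t) (shifted_radii r s))"
    fix t1 t2 :: real assume t: "t1 \<in> {0..1}" "t2 \<in> {0..1}" "t1 \<le> t2"
    show "1/2 * (\<Sum>i=1..N. inter_face_volume N (p t2) r i / r i) \<le> 1/2 * (\<Sum>i=1..N. inter_face_volume N (p t1) r i / r i)"
    \<comment> \<open>The two times are exchanged compared with the union: it is the later volume
      that grows more slowly in \<open>s\<close>.\<close>
    proof (rule right_derivative_le[OF I[OF _ t(2)] I[OF _ t(1)]])
      fix s :: real assume "0 \<le> s"
      then show "?V t2 s - ?V t2 0 \<le> ?V t1 s - ?V t1 0"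
        using inter_volume_difference_antimono[OF N smooth exp, of t1 t2 0 s r] t by simp
    qed
  qed
qed

end
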